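(* Fix an integer $k\ge2$, a permutation $\alpha=\alpha_1\ldots\alpha_k$ of length $k$ and an integer $r\ge2$. Let $T_n$ be a random split tree with split vector $\mathcal V=(V_1,\dots,V_b)$ and $n$ balls (with fixed parameters $b,s,s_0,s_1$, $s_0\ge1$), and let $\varkappa_r=\varkappa_r(R(\alpha,T_n))$ be the $r$-th cumulant of $R(\alpha,T_n)$ with respect to the uniformly random ball labelling of the (given) tree $T_n$. Let $$D_{\alpha,r}=\sum_{\tau\in P(r)}(-1)^{|\tau|-1}(|\tau|-1)!\prod_{S\in\tau}a_{k,|S|}(\alpha),\qquad a_{k,\ell}(\alpha)=\frac{\big((\alpha_1-1)\ell\big)!\,\big((k-\alpha_1)\ell\big)!}{\big((\alpha_1-1)!\,(k-\alpha_1)!\big)^{\ell}\,\big((k-1)\ell+1\big)!},$$ where $P(r)$ is the set of all partitions of $\{1,\dots,r\}$ into non-empty sets and $|\tau|$ is the number of parts of $\tau$. Then with high probability the split tree $T_n$ satisfies $$\varkappa_r=D_{\alpha,r}\,\Upsilon_r^k(T_n)+o\big(\Upsilon_r^k(T_n)\big);$$ that is, there is a deterministic sequence $\varepsilon_n\to0$ such that with probability tending to $1$ as $n\to\infty$ (over the random split tree $T_n$), $|\varkappa_r-D_{\alpha,r}\Upsilon_r^k(T_n)|\le\varepsilon_n\Upsilon_r^k(T_n)$.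
   Context: Split trees. Fix integers $b,s,s_0,s_1$ with $2\le b$, $0<s$, $0\le s_0\le s$, $0\le bs_1\le s+1-s_0$, and a random vector $\mathcal V=(V_1,\dots,V_b)$ of non-negative components with $\sum_iV_i=1$ (the split vector). Standing assumptions: the $V_i$ are identically distributed, $\mathbb P\{\exists i:V_i=1\}<1$, and $s_0\ge1$. All these parameters are fixed as $n\to\infty$. The random split tree $T_n$ is built as follows. Take the infinite rooted $b$-ary tree $\mathcal U$; give each node $u$ an independent copy $\mathcal V_u=(V_{u,1},\dots,V_{u,b})$ of $\mathcal V$; let $C(u)$ be the number of balls in node $u$, initially $0$. A node $u$ is a leaf if $C(u)>0$ and $C(v)=0$ for all children $v$ of $u$, and internal if $C(v)>0$ for some proper descendant $v$. Balls $1,\dots,n$ are added one by one; ball $j$ is added thus: (1) put $j$ at the root; (2) while $j$ is at an internal node $u$, choose child $i$ with probability $V_{u,i}$ and move $j$ there; (3) if $j$ is at a leaf (or still empty node) $u$ with $C(u)<s$, it stays and $C(u)$ increases by $1$; if $C(u)=s$, the $s+1$ balls now at $u$ are redistributed: $s_0$ of them chosen uniformly at random stay at $u$; of the remaining $s+1-s_0$ balls, uniformly at random $s_1$ balls are given to each of the $b$ children; each of the remaining $s+1-s_0-bs_1$ balls goes independently to a child chosen according to $\mathcal V_u$; the splitting is repeated at any child receiving more than $s$ balls. After all $n$ balls are placed, delete all nodes whose subtree contains no balls. In $T_n$ every internal node contains exactly $s_0$ balls and every leaf between $1$ and $s$ balls. Order on balls: for balls $j_1,j_2$ in nodes $u_1,u_2$,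 $j_1<j_2$ iff $u_1$ is a proper ancestor of $u_2$; distinct balls in the same node are incomparable. Given $T_n$, let $\pi$ be a uniformly random bijection from the set of balls to $[n]$. For balls $u_1<\dots<u_k$, $\pi(u)\approx\alpha$ means that $(\pi(u_1),\dots,\pi(u_k))$ has the same relative order as $\alpha$, and $R(\alpha,T_n)=\sum_{u_1<\dots<u_k}\mathbf 1[\pi(u)\approx\alpha]$, summed over all chains of $k$ balls. For balls $v_1,\dots,v_r$ let $c(v_1,\dots,v_r)$ be the number of balls $u$ with $u\le v_i$ for all $i$, and let $d(v)$ be the number of balls $u$ with $u<v$. Define $$\Upsilon_r^k(T_n)=\sum_{v_1,\dots,v_r}c(v_1,\dots,v_r)\prod_{i=1}^r\binom{d(v_i)}{k-2},$$ summed over all ordered $r$-tuples of balls, with $\binom x0=1$. The cumulants $\varkappa_r(X)$ are defined by $\log\mathbb E(e^{\xi X})=\sum_r\varkappa_r(X)\xi^r/r!$. "With high probability" means with probability tending to $1$ as $n\to\infty$. *)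

theory Defs
  imports "HOL-Probability.Probability" "HOL-Combinatorics.Multiset_Permutations"
    "HOL-Library.Sublist"
begin

section \<open>Random split trees\<close>

text \<open>
  A node of the infinite rooted \<open>b\<close>-ary tree is the list of child indices (in \<open>{..<b}\<close>) leading to it
  from the root \<open>[]\<close>; ancestors are prefixes.  A split tree is represented by the list of the nodes
  that contain its balls: the ball numbered \<open>j + 1\<close> in order of insertion has index \<open>j\<close> and sits in
  node \<open>T ! j\<close>.  The nodes that remain after pruning the empty subtrees are the prefixes of the
  entries of \<open>T\<close>.
\<close>

type_synonym node = "nat list"
type_synonym split_tree = "node list"

definition internal :: "split_tree \<Rightarrow> node \<Rightarrow> bool" where
  "internal T u \<longleftrightarrow> (\<exists>w\<in>set T. strict_prefix u w)"

text \<open>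
  The fallback for vectors that are not probability vectors concerns a null set only; it makes
  the construction measurable on the whole space.
\<close>

definition child_pmf :: "nat \<Rightarrow> (nat \<Rightarrow> real) \<Rightarrow> nat pmf" where
  "child_pmf b v =
     (if (\<forall>i<b. 0 \<le> v i) \<and> (\<Sum>i<b. v i) = 1
      then embed_pmf (\<lambda>i. if i < b then v i else 0) else return_pmf 0)"

text \<open>
  In the functions below, \<open>V u\<close> is the split vector of node \<open>u\<close>.
\<close>

function descend :: "nat \<Rightarrow> (node \<Rightarrow> nat \<Rightarrow> real) \<Rightarrow> split_tree \<Rightarrow> node \<Rightarrow> node pmf" where
  "descend b V T u =
     (if internal T u then do { i \<leftarrow> child_pmf b (V u); descend b V T (u @ [i]) }
      else return_pmf u)"
  by auto
termination
proof (relation "Wellfounded.measure (\<lambda>(b, V, T, u). \<Sum>w\<in>set T. length w - length u)", goal_cases)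
  case (2 b V T u i)
  then obtain w where w: "w \<in> set T" "strict_prefix u w"
    by (auto simp: internal_def)
  then have "length u < length w"
    by (simp add: prefix_length_less)
  with w(1) have "(\<Sum>w\<in>set T. length w - length (u @ [i])) < (\<Sum>w\<in>set T. length w - length u)"
    by (intro sum_strict_mono_ex1) (auto intro!: bexI[of _ w])
  then show ?case by simp
qed auto

declare descend.simps [simp del]

text \<open>
  Splitting the node \<open>u\<close>.  The balls at \<open>u\<close> are put in uniformly random order; the first \<open>s\<^sub>0\<close> of them
  stay at \<open>u\<close>, the next \<open>s\<^sub>1\<close> go to the first child, the next \<open>s\<^sub>1\<close> to the second child, and so on,
  and the remaining ones go to independently chosen children.
\<close>

definition split_node ::
    "nat \<Rightarrow> nat \<Rightarrow> nat \<Rightarrow> (node \<Rightarrow> nat \<Rightarrow> real) \<Rightarrow> node \<Rightarrow> split_tree \<Rightarrow> split_tree pmf" where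
  "split_node b s\<^sub>0 s\<^sub>1 V u T = do {
     js \<leftarrow> pmf_of_set (permutations_of_set {j. j < length T \<and> T ! j = u});
     is \<leftarrow> replicate_pmf (length js - s\<^sub>0 - b * s\<^sub>1) (child_pmf b (V u));
     let dest = replicate s\<^sub>0 u @ concat (map (\<lambda>i. replicate s\<^sub>1 (u @ [i])) [0..<b])
                  @ map (\<lambda>i. u @ [i]) is;
     return_pmf (map (\<lambda>j. case map_of (zip js dest) j of None \<Rightarrow> T ! j | Some w \<Rightarrow> w)
                   [0..<length T])
   }"

text \<open>
  Nodes with more than \<open>s\<close> balls are split until there are none left.  The first argument bounds the
  number of splittings.  It is instantiated with the number of balls, which is never reached before
  the process stops: if \<open>s\<^sub>0 \<ge> 1\<close>, then a split node keeps \<open>s\<^sub>0\<close> balls for good.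
\<close>

primrec split_overfull ::
    "nat \<Rightarrow> nat \<Rightarrow> nat \<Rightarrow> nat \<Rightarrow> nat \<Rightarrow> (node \<Rightarrow> nat \<Rightarrow> real) \<Rightarrow> split_tree \<Rightarrow> split_tree pmf" where
  "split_overfull 0 b s s\<^sub>0 s\<^sub>1 V T = return_pmf T"
| "split_overfull (Suc m) b s s\<^sub>0 s\<^sub>1 V T =
     (if \<exists>u. s < count_list T u
      then do { T' \<leftarrow> split_node b s\<^sub>0 s\<^sub>1 V (SOME u. s < count_list T u) T;
                split_overfull m b s s\<^sub>0 s\<^sub>1 V T' }
      else return_pmf T)"

primrec split_tree_given ::
    "nat \<Rightarrow> nat \<Rightarrow> nat \<Rightarrow> nat \<Rightarrow> (node \<Rightarrow> nat \<Rightarrow> real) \<Rightarrow> nat \<Rightarrow> split_tree pmf" where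
  "split_tree_given b s s\<^sub>0 s\<^sub>1 V 0 = return_pmf []"
| "split_tree_given b s s\<^sub>0 s\<^sub>1 V (Suc n) = do {
     T \<leftarrow> split_tree_given b s s\<^sub>0 s\<^sub>1 V n;
     u \<leftarrow> descend b V T [];
     split_overfull (Suc n) b s s\<^sub>0 s\<^sub>1 V (T @ [u])
   }"

text \<open>
  The law of the random split tree with \<open>n\<close> balls, where \<open>\<nu>\<close> is the law of the split vector, a
  measure on the functions on \<open>{..<b}\<close>.
\<close>

definition random_split_tree ::
    "nat \<Rightarrow> nat \<Rightarrow> nat \<Rightarrow> nat \<Rightarrow> (nat \<Rightarrow> real) measure \<Rightarrow> nat \<Rightarrow> split_tree measure" where
  "random_split_tree b s s\<^sub>0 s\<^sub>1 \<nu> n =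
     (PiM UNIV (\<lambda>_::node. \<nu>)) \<bind> (\<lambda>V. measure_pmf (split_tree_given b s s\<^sub>0 s\<^sub>1 V n))"

subsection \<open>Measurability of the construction\<close>

lemma borel_measurable_nn_integral_countable:
  fixes f :: "'w \<Rightarrow> 'a::countable \<Rightarrow> ennreal"
  assumes "\<And>y. (\<lambda>w. f w y) \<in> borel_measurable M"
  shows "(\<lambda>w. \<integral>\<^sup>+y. f w y \<partial>count_space UNIV) \<in> borel_measurable M"
proof (rule sigma_finite_measure.borel_measurable_nn_integral)
  show "case_prod f \<in> borel_measurable (M \<Otimes>\<^sub>M count_space UNIV)"
    unfolding case_prod_beta
    by (rule measurable_compose_countable[where f = "\<lambda>y p. f (fst p) y"])
       (auto intro: measurable_compose[OF measurable_fst assms])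
qed (simp add: sigma_finite_measure_count_space)

lemma measurable_pmfI:
  fixes f :: "'w \<Rightarrow> 'a::countable pmf"
  assumes "\<And>y. (\<lambda>w. pmf (f w) y) \<in> borel_measurable M"
  shows "(\<lambda>w. measure_pmf (f w)) \<in> M \<rightarrow>\<^sub>M prob_algebra (count_space UNIV)"
proof -
  have "(\<lambda>w. emeasure (measure_pmf (f w)) A) \<in> borel_measurable M" for A
  proof -
    have "emeasure (measure_pmf (f w)) A
        = (\<integral>\<^sup>+y. ennreal (pmf (f w) y) * indicator A y \<partial>count_space UNIV)" for w
      by (simp add: nn_integral_measure_pmf flip: nn_integral_indicator)
    moreover have "(\<lambda>w. \<integral>\<^sup>+y. ennreal (pmf (f w) y) * indicator A y \<partial>count_space UNIV)
        \<in> borel_measurable M"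
      by (intro borel_measurable_nn_integral_countable borel_measurable_times_ennreal
            measurable_compose[OF _ measurable_ennreal] assms) simp
    ultimately show ?thesis by simp
  qed
  then show ?thesis
    by (intro measurable_prob_algebraI measurable_subprob_algebra)
       (auto simp: prob_space_measure_pmf prob_space_imp_subprob_space)
qed

lemma measurable_bind_pmf:
  fixes f :: "'w \<Rightarrow> 'a::countable pmf" and g :: "'w \<Rightarrow> 'a \<Rightarrow> 'b pmf"
  assumes "\<And>y. (\<lambda>w. pmf (f w) y) \<in> borel_measurable M"
    and "\<And>x. (\<lambda>w. pmf (g w x) y) \<in> borel_measurable M"
  shows "(\<lambda>w. pmf (bind_pmf (f w) (g w)) y) \<in> borel_measurable M"
proof -
  have "ennreal (pmf (bind_pmf (f w) (g w)) y)
      = (\<integral>\<^sup>+x. ennreal (pmf (f w) x) * ennreal (pmf (g w x) y) \<partial>count_space UNIV)" for w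
    by (simp add: ennreal_pmf_bind nn_integral_measure_pmf)
  moreover have "(\<lambda>w. \<integral>\<^sup>+x. ennreal (pmf (f w) x) * ennreal (pmf (g w x) y) \<partial>count_space UNIV)
      \<in> borel_measurable M"
    by (intro borel_measurable_nn_integral_countable borel_measurable_times_ennreal
          measurable_compose[OF _ measurable_ennreal] assms)
  ultimately have "(\<lambda>w. ennreal (pmf (bind_pmf (f w) (g w)) y)) \<in> borel_measurable M"
    by simp
  from borel_measurable_enn2real[OF this] show ?thesis by simp
qed

lemma pmf_child_pmf:
  "pmf (child_pmf b v) i =
     (if (\<forall>i<b. 0 \<le> v i) \<and> (\<Sum>i<b. v i) = 1 then (if i < b then v i else 0)
      else of_bool (i = 0))"
proof (cases "(\<forall>i<b. 0 \<le> v i) \<and> (\<Sum>i<b. v i) = 1")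
  case True
  let ?f = "\<lambda>i. if i < b then v i else 0"
  have "(\<integral>\<^sup>+i. ennreal (?f i) \<partial>count_space UNIV) = (\<integral>\<^sup>+i. ennreal (v i) \<partial>count_space {..<b})"
    by (subst nn_integral_count_space_indicator)
       (auto intro!: nn_integral_cong simp: indicator_def)
  also have "\<dots> = (\<Sum>i<b. ennreal (v i))"
    by (simp add: nn_integral_count_space_finite)
  also have "\<dots> = ennreal (\<Sum>i<b. v i)"
    using True by (intro sum_ennreal) auto
  also have "\<dots> = 1"
    using True by simp
  finally show ?thesis
    using True by (simp add: child_pmf_def pmf_embed_pmf)
qed (auto simp: child_pmf_def)

context
  fixes \<nu> :: "(nat \<Rightarrow> real) measure" and b :: nat
  assumes sets_\<nu>: "sets \<nu> = sets (PiM {..<b} (\<lambda>_. borel))"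
begin

lemma measurable_component: "i < b \<Longrightarrow> (\<lambda>V. V u i) \<in> borel_measurable (PiM UNIV (\<lambda>_::node. \<nu>))"
proof -
  assume "i < b"
  then have "(\<lambda>v. v i) \<in> borel_measurable \<nu>"
    using measurable_component_singleton[of i "{..<b}" "\<lambda>_. borel"]
    by (simp add: measurable_cong_sets[OF sets_\<nu> refl])
  from measurable_compose[OF measurable_component_singleton[of u UNIV "\<lambda>_. \<nu>"] this]
  show ?thesis by simp
qed

lemma measurable_child_pmf:
  "(\<lambda>V. pmf (child_pmf b (V u)) i) \<in> borel_measurable (PiM UNIV (\<lambda>_::node. \<nu>))"
proof -
  let ?P = "PiM UNIV (\<lambda>_::node. \<nu>)"
  have "Measurable.pred ?P (\<lambda>V. \<forall>i\<in>{..<b}. 0 \<le> V u i)"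
  proof (rule pred_intros_finite(3))
    fix i assume "i \<in> {..<b}"
    then show "Measurable.pred ?P (\<lambda>V. 0 \<le> V u i)"
      unfolding pred_def
      by (intro borel_measurable_le borel_measurable_const measurable_component) simp
  qed simp
  moreover have "Measurable.pred ?P (\<lambda>V. (\<Sum>i<b. V u i) = 1)"
    unfolding pred_def
    by (intro borel_measurable_eq borel_measurable_sum borel_measurable_const measurable_component)
       simp
  ultimately have "Measurable.pred ?P (\<lambda>V. (\<forall>i\<in>{..<b}. 0 \<le> V u i) \<and> (\<Sum>i<b. V u i) = 1)"
    by (rule pred_intros_logic(3))
  moreover have "(\<lambda>V. if i < b then V u i else 0) \<in> borel_measurable ?P"
    by (cases "i < b") (simp_all add: measurable_component)
  ultimately have "(\<lambda>V. if (\<forall>i\<in>{..<b}. 0 \<le> V u i) \<and> (\<Sum>i<b. V u i) = 1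
      then (if i < b then V u i else 0) else of_bool (i = 0)) \<in> borel_measurable ?P"
    unfolding pred_def by (rule measurable_If[OF _ borel_measurable_const, rotated])
  then show ?thesis
    by (simp only: pmf_child_pmf Ball_def lessThan_iff)
qed

lemma measurable_descend:
  "(\<lambda>V. pmf (descend b V T u) w) \<in> borel_measurable (PiM UNIV (\<lambda>_::node. \<nu>))"
proof (induction "\<Sum>w\<in>set T. length w - length u" arbitrary: u w rule: less_induct)
  case less
  show ?case
  proof (cases "internal T u")
    case True
    then obtain x where x: "x \<in> set T" "strict_prefix u x"
      by (auto simp: internal_def)
    then have "length u < length x"
      by (simp add: prefix_length_less)
    with x(1) have "(\<Sum>w\<in>set T. length w - length (u @ [i])) < (\<Sum>w\<in>set T. length w - length u)"
      for i
      by (intro sum_strict_mono_ex1) (auto intro!: bexI[of _ x])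
    with less have "(\<lambda>V. pmf (descend b V T (u @ [i])) w) \<in> borel_measurable (PiM UNIV (\<lambda>_. \<nu>))"
      for i by blast
    then show ?thesis
      using True by (subst descend.simps) (simp add: measurable_bind_pmf measurable_child_pmf)
  qed (subst descend.simps, simp)
qed

lemma measurable_replicate_pmf:
  "(\<lambda>V. pmf (replicate_pmf m (child_pmf b (V u))) is) \<in> borel_measurable (PiM UNIV (\<lambda>_::node. \<nu>))"
proof (induction m arbitrary: "is")
  case (Suc m)
  then show ?case
    unfolding replicate_pmf.simps
    by (intro measurable_bind_pmf measurable_child_pmf borel_measurable_const)
qed simp

lemma measurable_split_node:
  "(\<lambda>V. pmf (split_node b s\<^sub>0 s\<^sub>1 V u T) T') \<in> borel_measurable (PiM UNIV (\<lambda>_::node. \<nu>))"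
  unfolding split_node_def Let_def
  by (intro measurable_bind_pmf measurable_replicate_pmf borel_measurable_const)

lemma measurable_split_overfull:
  "(\<lambda>V. pmf (split_overfull m b s s\<^sub>0 s\<^sub>1 V T) T') \<in> borel_measurable (PiM UNIV (\<lambda>_::node. \<nu>))"
proof (induction m arbitrary: T T')
  case (Suc m)
  then show ?case
    by (cases "\<exists>u. s < count_list T u") (simp_all add: measurable_bind_pmf measurable_split_node)
qed simp

lemma measurable_split_tree_given:
  "(\<lambda>V. pmf (split_tree_given b s s\<^sub>0 s\<^sub>1 V n) T) \<in> borel_measurable (PiM UNIV (\<lambda>_::node. \<nu>))"
proof (induction n arbitrary: T)
  case (Suc n)
  then show ?case
    unfolding split_tree_given.simps
    by (intro measurable_bind_pmf measurable_descend measurable_split_overfull)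
qed simp

lemma prob_space_random_split_tree:
  assumes "prob_space \<nu>"
  shows "prob_space (random_split_tree b s s\<^sub>0 s\<^sub>1 \<nu> n)"
    and "sets (random_split_tree b s s\<^sub>0 s\<^sub>1 \<nu> n) = UNIV"
proof -
  interpret product_prob_space "\<lambda>_::node. \<nu>" UNIV
    using assms by (intro product_prob_spaceI) auto
  have *: "(\<lambda>V. measure_pmf (split_tree_given b s s\<^sub>0 s\<^sub>1 V n))
      \<in> PiM UNIV (\<lambda>_::node. \<nu>) \<rightarrow>\<^sub>M subprob_algebra (count_space UNIV)"
    by (intro measurable_prob_algebraD measurable_pmfI measurable_split_tree_given)
  show "prob_space (random_split_tree b s s\<^sub>0 s\<^sub>1 \<nu> n)"
    unfolding random_split_tree_def
    by (rule P.prob_space_bind[OF _ *]) (simp add: prob_space_measure_pmf)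
  show "sets (random_split_tree b s s\<^sub>0 s\<^sub>1 \<nu> n) = UNIV"
    unfolding random_split_tree_def
    by (subst sets_bind[where N = "count_space UNIV"]) (use sets_kernel[OF *] P.not_empty in auto)
qed

end


section \<open>Balls, chains and patterns\<close>

abbreviation balls :: "split_tree \<Rightarrow> nat set" where
  "balls T \<equiv> {..<length T}"

definition ball_less :: "split_tree \<Rightarrow> nat \<Rightarrow> nat \<Rightarrow> bool" where
  "ball_less T j\<^sub>1 j\<^sub>2 \<longleftrightarrow> strict_prefix (T ! j\<^sub>1) (T ! j\<^sub>2)"

abbreviation ball_le :: "split_tree \<Rightarrow> nat \<Rightarrow> nat \<Rightarrow> bool" where
  "ball_le T j\<^sub>1 j\<^sub>2 \<equiv> j\<^sub>1 = j\<^sub>2 \<or> ball_less T j\<^sub>1 j\<^sub>2"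

definition chains :: "split_tree \<Rightarrow> nat \<Rightarrow> nat list set" where
  "chains T k = {us. length us = k \<and> set us \<subseteq> balls T \<and> sorted_wrt (ball_less T) us}"

definition labellings :: "split_tree \<Rightarrow> (nat \<Rightarrow> nat) set" where
  "labellings T = {\<pi> \<in> balls T \<rightarrow>\<^sub>E {1..length T}. bij_betw \<pi> (balls T) {1..length T}}"

definition same_relative_order :: "nat list \<Rightarrow> nat list \<Rightarrow> bool" where
  "same_relative_order xs ys \<longleftrightarrow>
     length xs = length ys \<and> (\<forall>i<length xs. \<forall>j<length xs. xs ! i < xs ! j \<longleftrightarrow> ys ! i < ys ! j)"

definition R :: "nat list \<Rightarrow> split_tree \<Rightarrow> (nat \<Rightarrow> nat) \<Rightarrow> real" where
  "R \<alpha> T \<pi> = (\<Sum>us\<in>chains T (length \<alpha>). of_bool (same_relative_order (map \<pi> us) \<alpha>))"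

definition common_ancestors :: "split_tree \<Rightarrow> nat list \<Rightarrow> nat" where
  "common_ancestors T vs = card {u \<in> balls T. \<forall>v\<in>set vs. ball_le T u v}"

definition ball_depth :: "split_tree \<Rightarrow> nat \<Rightarrow> nat" where
  "ball_depth T v = card {u \<in> balls T. ball_less T u v}"

definition Upsilon :: "nat \<Rightarrow> nat \<Rightarrow> split_tree \<Rightarrow> real" where
  "Upsilon r k T =
     (\<Sum>vs | length vs = r \<and> set vs \<subseteq> balls T.
        real (common_ancestors T vs) * (\<Prod>i<r. real (ball_depth T (vs ! i) choose (k - 2))))"


section \<open>Cumulants and the leading coefficient\<close>

definition cumulant :: "nat \<Rightarrow> 'a measure \<Rightarrow> ('a \<Rightarrow> real) \<Rightarrow> real" where
  "cumulant r M X =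
     fact r * fps_nth (THE F. (\<lambda>\<xi>. ln (\<integral>\<omega>. exp (\<xi> * X \<omega>) \<partial>M)) has_fps_expansion F) r"

definition a_coeff :: "nat \<Rightarrow> nat \<Rightarrow> nat list \<Rightarrow> real" where
  "a_coeff k l \<alpha> =
     fact ((\<alpha> ! 0 - 1) * l) * fact ((k - \<alpha> ! 0) * l) /
     ((fact (\<alpha> ! 0 - 1) * fact (k - \<alpha> ! 0)) ^ l * fact ((k - 1) * l + 1))"

definition D_coeff :: "nat \<Rightarrow> nat list \<Rightarrow> nat \<Rightarrow> real" where
  "D_coeff k \<alpha> r =
     (\<Sum>\<tau> | partition_on {1..r} \<tau>.
        (-1) ^ (card \<tau> - 1) * fact (card \<tau> - 1) * (\<Prod>S\<in>\<tau>. a_coeff k (card S) \<alpha>))"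

end

theory Submission
  imports Defs
begin

text \<open>
  Writing \<open>R(\<alpha>, T)\<close> as a sum of indicators over chains, \<open>\<kappa>\<^sub>r\<close> is the sum of the joint cumulants of the
  indicators of all \<open>r\<close>-tuples of chains.  Since disjoint sets of balls are labelled in independent
  relative orders, a tuple contributes only if its chains overlap.  Among these, the tuples whose
  chains have the first ball in common and are otherwise disjoint each contribute \<open>D\<^bsub>\<alpha>,r\<^esub>\<close>.  Up to
  few exceptions they are the configurations counted by \<open>\<Upsilon>\<close>: the last balls \<open>v\<^sub>1, \<dots>, v\<^sub>r\<close>, a common
  ancestor, and \<open>k - 2\<close> further ancestors of each \<open>v\<^sub>i\<close>.  In any other overlapping tuple, some chain
  contains two balls that lie above both its own last ball \<open>v\<^sub>i\<close> and another \<open>v\<^sub>j\<close>.  Typically there are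
  \<open>O(1)\<close> such balls, compared with a depth of order \<open>log n\<close>, so these tuples are fewer by a factor
  \<open>log n\<close>.

  Two things have to be known about the tree.  Most balls have depth at least a multiple of \<open>log n\<close>,
  because a node has at most \<open>b\<close> children and holds at most \<open>s\<close> balls.  And paths rarely coincide for
  long: the expected number of pairs of balls that descend through a node \<open>g\<close> is at most \<open>n\<^sup>2\<close> times
  the squared product of the split probabilities on the path to \<open>g\<close>, and the sum of these squares
  over the nodes \<open>g\<close> at depth \<open>j\<close> has mean \<open>q\<^sup>j\<close>, where \<open>q = E \<Sum> V\<^sub>i\<^sup>2 < 1\<close>.
\<close>

subsection \<open>Joint cumulants\<close>

text \<open>The error is estimated with an upper bound on depths and compared with a lower bound on
  \<open>Upsilon\<close>, so both must have the same order: depths have to be O(log n) as well. This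
  height bound and all moments of the length shared by two paths come from one quantity,
  \<open>weighted_excess\<close>, the sum over levels j of x^j times the number of ordered pairs of
  excess balls in a common subtree of level j. Any x > 1 makes it dominate the height and every
  polynomial in j, while x q < 1 keeps its mean of order n^2. Markov's inequality at n^2 sqrt(log n)
  then fails with probability O(1 / sqrt(log n)) and costs a relative error of the same order. Pairs
  are counted by y (y - 1) and not by y^2 because the one-step increment 2 y has no constant term. A
  constant term would bring in path probabilities to the first power, whose sum over a level is 1
  and does not decay. On the cumulant side all rests on one recursion: coefficients of the
  logarithm, multilinearity and vanishing under independence each follow by exhibiting a solution
  and using uniqueness.\<close>

definition joint_cumulant :: "('i set \<Rightarrow> real) \<Rightarrow> 'i set \<Rightarrow> real" where
  "joint_cumulant m S =
     (\<Sum>\<tau> | partition_on S \<tau>. (-1) ^ (card \<tau> - 1) * fact (card \<tau> - 1) * (\<Prod>B\<in>\<tau>. m B))"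

lemma joint_cumulant_cong:
  assumes "\<And>B. B \<subseteq> S \<Longrightarrow> B \<noteq> {} \<Longrightarrow> m B = m' B"
  shows "joint_cumulant m S = joint_cumulant m' S"
  unfolding joint_cumulant_def
proof (intro sum.cong refl arg_cong2[where f = "(*)"] prod.cong)
  fix \<tau> B assume "\<tau> \<in> {\<tau>. partition_on S \<tau>}" "B \<in> \<tau>"
  then show "m B = m' B"
    by (intro assms) (auto simp: partition_on_def)
qed

lemma card_ge_Suc0: "finite A \<Longrightarrow> x \<in> A \<Longrightarrow> 1 \<le> card A"
  by (metis One_nat_def Suc_leI card_gt_0_iff empty_iff)

text \<open>
  A pair of a set \<open>B \<subset> S\<close> containing \<open>a\<close> and a partition of \<open>B\<close> is the same as a partition \<open>\<tau>\<close> of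
  \<open>S\<close> with one of the \<open>|\<tau>| - 1\<close> parts avoiding \<open>a\<close> marked, namely \<open>S - B\<close>.
\<close>

lemma joint_cumulant_rec:
  assumes S: "finite S" "a \<in> S" and m: "m {} = 1"
  shows "m S = (\<Sum>B | B \<subseteq> S \<and> a \<in> B. joint_cumulant m B * m (S - B))"
proof -
  let ?w = "\<lambda>\<tau>::'a set set. (-1) ^ (card \<tau> - 1) * fact (card \<tau> - 1) :: real"
  define P where "P = {\<tau>. partition_on S \<tau>}"
  have finP: "finite P"
    unfolding P_def by (rule finitely_many_partition_on[OF S(1)])
  have fin\<tau>: "finite \<tau>" if "\<tau> \<in> P" for \<tau>
    using that S finite_elements unfolding P_def by blast
  have SP: "{S} \<in> P"
    unfolding P_def using S by (auto intro!: partition_on_space)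
  let ?Bs = "{B. B \<subset> S \<and> a \<in> B}"
  have finBs: "finite ?Bs"
    using S by (auto intro: finite_subset[of _ "Pow S"])
  have part: "{\<tau>. partition_on B \<tau>} \<noteq> {} \<and> finite {\<tau>. partition_on B \<tau>}" if "B \<in> ?Bs" for B
    using that finite_subset[OF _ S(1), of B] finitely_many_partition_on[of B] partition_on_space[of B] by auto
  have "(\<Sum>B\<in>?Bs. joint_cumulant m B * m (S - B))
      = (\<Sum>B\<in>?Bs. \<Sum>\<tau> | partition_on B \<tau>. ?w \<tau> * (\<Prod>C\<in>\<tau>. m C) * m (S - B))"
    unfolding joint_cumulant_def sum_distrib_right ..
  also have "\<dots> = (\<Sum>(B, \<tau>)\<in>Sigma ?Bs (\<lambda>B. {\<tau>. partition_on B \<tau>}). ?w \<tau> * (\<Prod>C\<in>\<tau>. m C) * m (S - B))"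
    using finBs part by (intro sum.Sigma) auto
  also have "\<dots> = (\<Sum>(\<sigma>, C)\<in>Sigma P (\<lambda>\<sigma>. {C\<in>\<sigma>. a \<notin> C}). (-1) ^ (card \<sigma> - 2) * fact (card \<sigma> - 2) * (\<Prod>C\<in>\<sigma>. m C))"
  proof (rule sum.reindex_bij_witness[where i = "\<lambda>(\<sigma>, C). (S - C, \<sigma> - {C})"
        and j = "\<lambda>(B, \<tau>). (insert (S - B) \<tau>, S - B)"], goal_cases)
    case (1 x)
    obtain B \<tau> where x: "x = (B, \<tau>)" by force
    with 1 have *: "B \<subset> S" "a \<in> B" "partition_on B \<tau>" by auto
    then have "S - B \<notin> \<tau>" by (auto simp: partition_on_def)
    with * show ?case using x by (auto simp: double_diff)
  next
    case (2 x)
    obtain B \<tau> where x: "x = (B, \<tau>)" by force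
    with 2 have *: "B \<subset> S" "a \<in> B" "partition_on B \<tau>" by auto
    then have "disjnt (S - B) (\<Union>\<tau>)" by (auto simp: partition_on_def disjnt_def)
    then have "partition_on S (insert (S - B) \<tau>)"
      using * by (subst partition_on_insert) (auto simp: double_diff)
    with * show ?case using x by (auto simp: P_def)
  next
    case (3 x)
    obtain \<sigma> C where x: "x = (\<sigma>, C)" by force
    with 3 have *: "partition_on S \<sigma>" "C \<in> \<sigma>" "a \<notin> C" by (auto simp: P_def)
    then have "C \<subseteq> S" by (auto simp: partition_on_def)
    with * show ?case using x by (auto simp: double_diff)
  next
    case (4 x)
    obtain \<sigma> C where x: "x = (\<sigma>, C)" by force
    with 4 have *: "partition_on S \<sigma>" "C \<in> \<sigma>" "a \<notin> C" by (auto simp: P_def)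
    then have C: "C \<subseteq> S" "C \<noteq> {}" by (auto simp: partition_on_def)
    have "disjnt C (\<Union>(\<sigma> - {C}))"
      using * by (auto simp: partition_on_def disjnt_def disjoint_def)
    then have "partition_on (S - C) (\<sigma> - {C})"
      using * partition_on_insert[of C "\<sigma> - {C}" S] by (simp add: insert_absorb)
    with * show ?case using x C S by auto
  next
    case (5 x)
    obtain B \<tau> where x: "x = (B, \<tau>)" by force
    with 5 have *: "B \<subset> S" "a \<in> B" "partition_on B \<tau>" by auto
    then have "S - B \<notin> \<tau>" by (auto simp: partition_on_def)
    moreover have "finite \<tau>"
      using * S finite_elements finite_subset by blast
    moreover have "\<tau> \<noteq> {}" using * by (auto simp: partition_on_def)
    ultimately show ?case using x by (simp add: mult_ac)
  qed
  also have "\<dots> = (\<Sum>\<sigma>\<in>P. \<Sum>C\<in>{C\<in>\<sigma>. a \<notin> C}. (-1) ^ (card \<sigma> - 2) * fact (card \<sigma> - 2) * (\<Prod>C\<in>\<sigma>. m C))"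
    using finP fin\<tau> by (intro sum.Sigma[symmetric]) auto
  also have "\<dots> = (\<Sum>\<sigma>\<in>P. real (card \<sigma> - 1) * ((-1) ^ (card \<sigma> - 2) * fact (card \<sigma> - 2)) * (\<Prod>C\<in>\<sigma>. m C))"
  proof (rule sum.cong[OF refl])
    fix \<sigma> assume \<sigma>: "\<sigma> \<in> P"
    then obtain D where D: "D \<in> \<sigma>" "a \<in> D"
      using S by (auto simp: P_def partition_on_def)
    have "{C\<in>\<sigma>. a \<notin> C} = \<sigma> - {D}"
      using \<sigma> D by (auto simp: P_def partition_on_def disjoint_def)
    then have "card {C\<in>\<sigma>. a \<notin> C} = card \<sigma> - 1"
      using D fin\<tau>[OF \<sigma>] by simp
    then show "(\<Sum>C\<in>{C\<in>\<sigma>. a \<notin> C}. (-1) ^ (card \<sigma> - 2) * fact (card \<sigma> - 2) * (\<Prod>C\<in>\<sigma>. m C))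
        = real (card \<sigma> - 1) * ((-1) ^ (card \<sigma> - 2) * fact (card \<sigma> - 2)) * (\<Prod>C\<in>\<sigma>. m C)"
      by simp
  qed
  also have "\<dots> = (\<Sum>\<sigma>\<in>P. (if \<sigma> = {S} then m S else 0) - ?w \<sigma> * (\<Prod>C\<in>\<sigma>. m C))"
  proof (rule sum.cong[OF refl])
    fix \<sigma> assume \<sigma>: "\<sigma> \<in> P"
    then obtain D where D: "D \<in> \<sigma>" "a \<in> D"
      using S by (auto simp: P_def partition_on_def)
    show "real (card \<sigma> - 1) * ((-1) ^ (card \<sigma> - 2) * fact (card \<sigma> - 2)) * (\<Prod>C\<in>\<sigma>. m C)
      = (if \<sigma> = {S} then m S else 0) - ?w \<sigma> * (\<Prod>C\<in>\<sigma>. m C)"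
    proof (cases "card \<sigma> = 1")
      case True
      then have "\<sigma> = {D}" using D card_1_singletonE by (metis singletonD)
      with \<sigma> have "D = S" by (auto simp: P_def partition_on_def)
      with \<open>\<sigma> = {D}\<close> show ?thesis by simp
    next
      case False
      then obtain c where c: "card \<sigma> = Suc (Suc c)"
        using card_ge_Suc0[OF fin\<tau>[OF \<sigma>] D(1)] by (metis One_nat_def not0_implies_Suc not_one_le_zero)
      then have "\<sigma> \<noteq> {S}" by auto
      with c show ?thesis by (simp add: algebra_simps)
    qed
  qed
  also have "\<dots> = m S - joint_cumulant m S"
    unfolding sum_subtractf using SP finP by (simp add: joint_cumulant_def P_def)
  finally have "(\<Sum>B\<in>?Bs. joint_cumulant m B * m (S - B)) = m S - joint_cumulant m S" .
  moreover have "{B. B \<subseteq> S \<and> a \<in> B} = insert S ?Bs" using S by auto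
  ultimately show ?thesis using finBs m by simp
qed

text \<open>The recursion isolates the term \<open>C = B\<close>, with factor
  \<open>m {} = 1\<close>, and so determines \<open>K\<close> on \<open>B\<close> from its proper
  subsets. The pivot \<open>a\<close> may depend on \<open>B\<close>.\<close>

lemma joint_cumulant_unique:
  assumes S: "finite S" "S \<noteq> {}" and m: "m {} = 1"
    and K: "\<And>B. B \<subseteq> S \<Longrightarrow> B \<noteq> {} \<Longrightarrow> \<exists>a\<in>B. m B = (\<Sum>C | C \<subseteq> B \<and> a \<in> C. K C * m (B - C))"
  shows "K S = joint_cumulant m S"
  using S K
proof (induction S rule: finite_psubset_induct)
  case (psubset S)
  then obtain a where a: "a \<in> S" "m S = (\<Sum>C | C \<subseteq> S \<and> a \<in> C. K C * m (S - C))" by blast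
  let ?Bs = "{B. B \<subset> S \<and> a \<in> B}"
  have fin: "finite ?Bs" using psubset.hyps by (auto intro: finite_subset[of _ "Pow S"])
  have eq: "{B. B \<subseteq> S \<and> a \<in> B} = insert S ?Bs" using a by auto
  have "m S = K S + (\<Sum>C\<in>?Bs. K C * m (S - C))"
    using a(2) fin m unfolding eq by simp
  also have "(\<Sum>C\<in>?Bs. K C * m (S - C)) = (\<Sum>C\<in>?Bs. joint_cumulant m C * m (S - C))"
    using psubset.prems by (intro sum.cong refl arg_cong2[where f = "(*)"] psubset.IH) auto
  finally have "m S = K S + \<dots>" .
  moreover have "m S = joint_cumulant m S + (\<Sum>C\<in>?Bs. joint_cumulant m C * m (S - C))"
    using joint_cumulant_rec[of S a m, OF psubset.hyps a(1) m] fin m unfolding eq by simp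
  ultimately show ?case by simp
qed

text \<open>A solution of the recursion is guessed: joint cumulants on sets inside one of the two
  groups, zero on mixed sets. Since \<open>S\<close> is mixed, uniqueness gives the claim.\<close>

lemma joint_cumulant_indep:
  assumes S: "finite S" and m: "m {} = 1" and S1: "S1 \<inter> S \<noteq> {}" "S - S1 \<noteq> {}"
    and ind: "\<And>B. B \<subseteq> S \<Longrightarrow> m B = m (B \<inter> S1) * m (B - S1)"
  shows "joint_cumulant m S = 0"
proof -
  define K where "K C = (if C \<subseteq> S1 \<or> C \<inter> S1 = {} then joint_cumulant m C else 0)" for C
  have "K S = joint_cumulant m S"
  proof (rule joint_cumulant_unique)
    fix B assume B: "B \<subseteq> S" "B \<noteq> {}"
    have finB: "finite B" using B S finite_subset by blast
    \<comment> \<open>\<open>T\<close> is the group of \<open>a\<close>, so that both cases are one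
      computation: sets \<open>C\<close> meeting the other group drop out, and the moment of that
      group is a common factor of the remaining terms.\<close>
    have half: "m B = (\<Sum>C | C \<subseteq> B \<and> a \<in> C. K C * m (B - C))"
      if a: "a \<in> B" "a \<in> T" and T: "T = S1 \<or> T = - S1" for a T
    proof -
      have "(\<Sum>C | C \<subseteq> B \<and> a \<in> C. K C * m (B - C)) = (\<Sum>C | C \<subseteq> B \<inter> T \<and> a \<in> C. K C * m (B - C))"
      proof (rule sum.mono_neutral_right)
        show "\<forall>C\<in>{C. C \<subseteq> B \<and> a \<in> C} - {C. C \<subseteq> B \<inter> T \<and> a \<in> C}. K C * m (B - C) = 0"
          using a T by (auto simp: K_def)
      qed (use finB in auto)
      also have "\<dots> = (\<Sum>C | C \<subseteq> B \<inter> T \<and> a \<in> C. joint_cumulant m C * m (B \<inter> T - C) * m (B - T))"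
      proof (rule sum.cong[OF refl])
        fix C assume C: "C \<in> {C. C \<subseteq> B \<inter> T \<and> a \<in> C}"
        have "m (B - C) = m ((B - C) \<inter> S1) * m ((B - C) - S1)"
          using B by (intro ind) auto
        also have "\<dots> = m (B \<inter> T - C) * m (B - T)"
        proof (cases "T = S1")
          case True
          moreover have "(B - C) \<inter> S1 = B \<inter> S1 - C" by auto
          moreover have "(B - C) - S1 = B - S1" using C True by auto
          ultimately show ?thesis by simp
        next
          case False
          then have [simp]: "T = - S1" using T by auto
          have "(B - C) \<inter> S1 = B - T" using C by auto
          moreover have "(B - C) - S1 = B \<inter> T - C" by auto
          ultimately show ?thesis by (simp only: mult.commute)
        qed
        finally show "K C * m (B - C) = joint_cumulant m C * m (B \<inter> T - C) * m (B - T)"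
          using C T by (auto simp: K_def)
      qed
      also have "\<dots> = m (B \<inter> T) * m (B - T)"
        unfolding sum_distrib_right[symmetric]
        by (subst joint_cumulant_rec[where a = a and S = "B \<inter> T" and m = m]) (use a finB m in auto)
      also have "\<dots> = m B"
        using ind[OF B(1)] T by (auto simp: Diff_eq mult.commute)
      finally show ?thesis ..
    qed
    obtain a where a: "a \<in> B" using B by auto
    show "\<exists>a\<in>B. m B = (\<Sum>C | C \<subseteq> B \<and> a \<in> C. K C * m (B - C))"
      using half[OF a, of S1] half[OF a, of "- S1"] a by (cases "a \<in> S1") auto
  qed (use S S1 m in auto)
  moreover have "K S = 0" using S1 by (auto simp: K_def)
  ultimately show ?thesis by simp
qed

section \<open>Multilinearity of joint cumulants\<close>

lemma sum_PiE_split: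
  assumes "finite S" "B \<subseteq> S"
  shows "(\<Sum>f\<in>S \<rightarrow>\<^sub>E C. g (restrict f B) (restrict f (S - B)))
    = (\<Sum>f1\<in>B \<rightarrow>\<^sub>E C. \<Sum>f2\<in>(S - B) \<rightarrow>\<^sub>E C. g f1 f2)"
  unfolding sum.cartesian_product
proof (rule sum.reindex_bij_witness[where j = "\<lambda>f. (restrict f B, restrict f (S - B))"
      and i = "\<lambda>(f1, f2). \<lambda>x. if x \<in> B then f1 x else f2 x"], goal_cases)
  case (1 f)
  then show ?case using assms by (auto simp: fun_eq_iff PiE_def extensional_def)
next
  case (2 f)
  then show ?case using assms by (auto simp: PiE_iff)
next
  case (3 p)
  then show ?case using assms
    by (auto simp: fun_eq_iff PiE_def extensional_def split: if_splits prod.splits)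
next
  case (4 p)
  then show ?case using assms by (auto simp: PiE_iff extensional_def split: prod.splits)
qed auto

text \<open>\<open>M f B\<close> stands for the mixed moment of the summands that \<open>f\<close>
  picks on \<open>B\<close>; its sum over \<open>f\<close> is the mixed moment of the sums. As
  \<open>M f\<close> sees only the values of \<open>f\<close> on its argument, sums over families on
  \<open>B\<close> factor over \<open>D\<close> and \<open>B - D\<close>, and the recursion passes
  from the single \<open>f\<close> to the total.\<close>

lemma joint_cumulant_sum:
  fixes M :: "('i \<Rightarrow> 'c) \<Rightarrow> 'i set \<Rightarrow> real"
  assumes S: "finite S" "S \<noteq> {}" and C: "finite C"
    and empty: "\<And>f. M f {} = 1"
    and local: "\<And>f g B. B \<subseteq> S \<Longrightarrow> (\<And>i. i \<in> B \<Longrightarrow> f i = g i) \<Longrightarrow> M f B = M g B"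
  shows "joint_cumulant (\<lambda>B. \<Sum>f\<in>B \<rightarrow>\<^sub>E C. M f B) S = (\<Sum>f\<in>S \<rightarrow>\<^sub>E C. joint_cumulant (M f) S)"
proof (rule joint_cumulant_unique[symmetric, OF S])
  fix B assume B: "B \<subseteq> S" "B \<noteq> {}"
  then obtain a where a: "a \<in> B" by auto
  have finB: "finite B" using B S finite_subset by blast
  have "(\<Sum>f\<in>B \<rightarrow>\<^sub>E C. M f B) = (\<Sum>f\<in>B \<rightarrow>\<^sub>E C. \<Sum>D | D \<subseteq> B \<and> a \<in> D. joint_cumulant (M f) D * M f (B - D))"
    by (intro sum.cong refl joint_cumulant_rec finB a empty)
  also have "\<dots> = (\<Sum>D | D \<subseteq> B \<and> a \<in> D. \<Sum>f\<in>B \<rightarrow>\<^sub>E C. joint_cumulant (M f) D * M f (B - D))"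
    by (rule sum.swap)
  also have "\<dots> = (\<Sum>D | D \<subseteq> B \<and> a \<in> D. (\<Sum>f\<in>D \<rightarrow>\<^sub>E C. joint_cumulant (M f) D) * (\<Sum>f\<in>(B - D) \<rightarrow>\<^sub>E C. M f (B - D)))"
  proof (rule sum.cong[OF refl])
    fix D assume D: "D \<in> {D. D \<subseteq> B \<and> a \<in> D}"
    have "(\<Sum>f\<in>B \<rightarrow>\<^sub>E C. joint_cumulant (M f) D * M f (B - D))
      = (\<Sum>f\<in>B \<rightarrow>\<^sub>E C. joint_cumulant (M (restrict f D)) D * M (restrict f (B - D)) (B - D))"
      using D B by (intro sum.cong refl arg_cong2[where f = "(*)"] joint_cumulant_cong local) auto
    also have "\<dots> = (\<Sum>f\<in>D \<rightarrow>\<^sub>E C. joint_cumulant (M f) D) * (\<Sum>f\<in>(B - D) \<rightarrow>\<^sub>E C. M f (B - D))"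
      using D by (subst sum_PiE_split[OF finB, where g = "\<lambda>f1 f2. joint_cumulant (M f1) D * M f2 (B - D)"])
        (auto simp: sum_product)
    finally show "(\<Sum>f\<in>B \<rightarrow>\<^sub>E C. joint_cumulant (M f) D * M f (B - D)) = \<dots>" .
  qed
  finally show "\<exists>a\<in>B. (\<Sum>f\<in>B \<rightarrow>\<^sub>E C. M f B) = (\<Sum>D | D \<subseteq> B \<and> a \<in> D.
      (\<Sum>f\<in>D \<rightarrow>\<^sub>E C. joint_cumulant (M f) D) * (\<Sum>f\<in>(B - D) \<rightarrow>\<^sub>E C. M f (B - D)))"
    using a by blast
qed (simp add: empty)

lemma abs_joint_cumulant_le:
  assumes "\<And>B. B \<subseteq> S \<Longrightarrow> \<bar>m B\<bar> \<le> 1"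
  shows "\<bar>joint_cumulant m S\<bar> \<le> (\<Sum>\<tau> | partition_on S \<tau>. fact (card \<tau> - 1))"
  unfolding joint_cumulant_def
proof (rule order.trans[OF sum_abs sum_mono])
  fix \<tau> assume \<tau>: "\<tau> \<in> {\<tau>. partition_on S \<tau>}"
  have "\<bar>\<Prod>B\<in>\<tau>. m B\<bar> = (\<Prod>B\<in>\<tau>. \<bar>m B\<bar>)" by (rule abs_prod)
  also have "\<dots> \<le> 1" using \<tau> by (intro prod_le_1) (auto intro!: assms simp: partition_on_def)
  finally show "\<bar>(-1) ^ (card \<tau> - 1) * fact (card \<tau> - 1) * (\<Prod>B\<in>\<tau>. m B)\<bar> \<le> fact (card \<tau> - 1)"
    by (simp add: abs_mult power_abs mult_left_le)
qed

subsection \<open>Cumulants of a finitely supported random variable\<close>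

text \<open>Turns the recursion over subsets into a binomial one when all values depend on
  cardinalities only.\<close>

lemma sum_subsets_containing:
  assumes S: "finite S" "a \<in> S" and n: "card S = Suc n"
  shows "(\<Sum>B | B \<subseteq> S \<and> a \<in> B. h (card B)) = (\<Sum>i\<le>n. real (n choose i) * h (Suc i))"
proof -
  have fin: "finite (S - {a})" and card: "card (S - {a}) = n" using S n by auto
  have "(\<Sum>B | B \<subseteq> S \<and> a \<in> B. h (card B)) = (\<Sum>B\<in>Pow (S - {a}). h (Suc (card B)))"
  proof (rule sum.reindex_bij_witness[where i = "insert a" and j = "\<lambda>B. B - {a}"], goal_cases)
    case (5 B)
    have "finite B" using 5 finite_subset[OF _ S(1)] by auto
    then show ?case using 5 by (metis (mono_tags, lifting) card.remove mem_Collect_eq)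
  qed (use S in auto)
  also have "\<dots> = (\<Sum>i\<le>n. \<Sum>B | B \<in> Pow (S - {a}) \<and> card B = i. h (Suc (card B)))"
    using card card_mono[OF fin] by (intro sum.group[symmetric]) (use S in auto)
  also have "\<dots> = (\<Sum>i\<le>n. \<Sum>B | B \<subseteq> S - {a} \<and> card B = i. h (Suc i))"
    by (intro sum.cong) auto
  also have "\<dots> = (\<Sum>i\<le>n. real (n choose i) * h (Suc i))"
    using n_subsets[OF fin] card by simp
  finally show ?thesis .
qed

text \<open>Evaluation at 0 gives the constant terms, and differentiating both series on an open set
  reduces coefficient n + 1 to coefficient n of the derivatives. Thereby the \<open>THE\<close> in
  \<open>cumulant\<close> denotes a unique series.\<close>

lemma eval_fps_eqD_real:
  fixes F G :: "real fps"
  assumes "fps_conv_radius F > 0" "fps_conv_radius G > 0"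
    and "eventually (\<lambda>z. eval_fps F z = eval_fps G z) (nhds 0)"
  shows "fps_nth F n = fps_nth G n"
  using assms
proof (induction n arbitrary: F G)
  case 0
  then show ?case by (auto simp: eval_fps_at_0 dest: eventually_nhds_x_imp_x)
next
  case (Suc n)
  obtain U where U: "open U" "0 \<in> U" "\<And>z. z \<in> U \<Longrightarrow> eval_fps F z = eval_fps G z"
    using Suc.prems(3) unfolding eventually_nhds by blast
  define W where "W = U \<inter> eball 0 (fps_conv_radius F) \<inter> eball 0 (fps_conv_radius G)"
  have W: "open W" "0 \<in> W"
    using U Suc.prems by (auto simp: W_def zero_ereal_def)
  have "eval_fps (fps_deriv F) z = eval_fps (fps_deriv G) z" if z: "z \<in> W" for z
  proof (rule DERIV_unique)
    show "(eval_fps F has_real_derivative eval_fps (fps_deriv F) z) (at z)"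
      by (rule has_field_derivative_eval_fps) (use z in \<open>auto simp: W_def\<close>)
    have "(eval_fps G has_real_derivative eval_fps (fps_deriv G) z) (at z)"
      by (rule has_field_derivative_eval_fps) (use z in \<open>auto simp: W_def\<close>)
    then show "(eval_fps F has_real_derivative eval_fps (fps_deriv G) z) (at z)"
      by (rule has_field_derivative_transform_within_open[OF _ W(1) z]) (use U in \<open>auto simp: W_def\<close>)
  qed
  then have "eventually (\<lambda>z. eval_fps (fps_deriv F) z = eval_fps (fps_deriv G) z) (nhds 0)"
    using W unfolding eventually_nhds by blast
  moreover have "fps_conv_radius (fps_deriv F) > 0" "fps_conv_radius (fps_deriv G) > 0"
    using Suc.prems(1,2) fps_conv_radius_deriv less_le_trans by blast+
  ultimately have "fps_nth (fps_deriv F) n = fps_nth (fps_deriv G) n"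
    by (intro Suc.IH)
  then show ?case by (simp del: of_nat_Suc)
qed

lemma has_fps_expansion_unique_real:
  fixes F G :: "real fps"
  assumes "f has_fps_expansion F" "f has_fps_expansion G"
  shows "F = G"
proof (intro fps_ext eval_fps_eqD_real)
  have "eventually (\<lambda>z. eval_fps F z = f z) (nhds 0)" "eventually (\<lambda>z. eval_fps G z = f z) (nhds 0)"
    using assms by (auto simp: has_fps_expansion_def)
  then show "eventually (\<lambda>z. eval_fps F z = eval_fps G z) (nhds 0)"
    by eventually_elim simp
qed (use assms in \<open>auto simp: has_fps_expansion_def\<close>)

text \<open>Term n + 1 of the integrated series at \<open>\<rho>\<close> is term n of
  \<open>G\<close> times \<open>\<rho>\<close> / (n + 1), so absolute convergence carries
  over.\<close>

lemma fps_conv_radius_integral: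
  fixes G :: "real fps"
  shows "fps_conv_radius G \<le> fps_conv_radius (fps_integral G c)"
  unfolding fps_conv_radius_def
proof (rule conv_radius_geI_ex)
  fix \<rho> :: real assume \<rho>: "0 < \<rho>" "ereal \<rho> < conv_radius (fps_nth G)"
  have "summable (\<lambda>n. norm (fps_nth G n * \<rho> ^ n))"
    by (rule abs_summable_in_conv_radius) (use \<rho> in auto)
  then have "summable (\<lambda>n. \<rho> * norm (fps_nth G n * \<rho> ^ n))" by (rule summable_mult)
  then have "summable (\<lambda>n. fps_nth (fps_integral G c) (Suc n) * \<rho> ^ Suc n)"
  proof (rule summable_comparison_test'[where N = 0])
    fix n :: nat
    have "\<rho> * norm (fps_nth G n * \<rho> ^ n) / real (Suc n) \<le> \<rho> * norm (fps_nth G n * \<rho> ^ n) / 1"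
      using \<rho> by (intro divide_left_mono) auto
    moreover have "norm (fps_nth (fps_integral G c) (Suc n) * \<rho> ^ Suc n)
        = \<rho> * norm (fps_nth G n * \<rho> ^ n) / real (Suc n)"
      using \<rho> by (simp add: abs_mult divide_inverse del: of_nat_Suc)
    ultimately show "norm (fps_nth (fps_integral G c) (Suc n) * \<rho> ^ Suc n) \<le> \<rho> * norm (fps_nth G n * \<rho> ^ n)"
      by simp
  qed
  then have "summable (\<lambda>n. fps_nth (fps_integral G c) n * \<rho> ^ n)"
    by (subst (asm) summable_Suc_iff)
  then show "\<exists>z. norm z = \<rho> \<and> summable (\<lambda>n. fps_nth (fps_integral G c) n * z ^ n)"
    using \<rho> by (intro exI[of _ \<rho>]) auto
qed

text \<open>The integral of M' / M has the same derivative as ln f near 0, and both vanish at 0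
  because f 0 = 1. Agreement on a small ball is all that an expansion at 0 asks for.\<close>

lemma has_fps_expansion_ln:
  fixes f :: "real \<Rightarrow> real"
  assumes f: "f has_fps_expansion M" and M0: "fps_nth M 0 = 1"
    and f': "f' has_fps_expansion fps_deriv M"
    and deriv: "\<And>x. (f has_real_derivative f' x) (at x)"
  shows "(\<lambda>x. ln (f x)) has_fps_expansion fps_integral0 (fps_deriv M / M)"
proof -
  define G where "G = fps_deriv M / M"
  have G: "(\<lambda>x. f' x / f x) has_fps_expansion G"
    unfolding G_def by (rule has_fps_expansion_divide'[OF f' f]) (simp add: M0)
  have f0: "f 0 = 1"
    using f M0 by (auto simp: has_fps_expansion_def eval_fps_at_0 dest: eventually_nhds_x_imp_x)
  have "isCont f 0" using deriv DERIV_isCont by blast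
  then have "eventually (\<lambda>x. f x > 0) (nhds 0)"
    using f0 order_tendstoD(1)[of f 1 "nhds 0" 0] tendsto_at_iff_tendsto_nhds[of f 0] by (simp add: isCont_def)
  moreover have "eventually (\<lambda>x. eval_fps G x = f' x / f x) (nhds 0)"
    using G by (simp add: has_fps_expansion_def)
  moreover have rG: "fps_conv_radius G > 0" using G by (simp add: has_fps_expansion_def)
  then have "eventually (\<lambda>x. x \<in> eball 0 (fps_conv_radius G)) (nhds (0::real))"
    by (intro eventually_nhds_in_open) (auto simp: zero_ereal_def)
  ultimately have "eventually (\<lambda>x. f x > 0 \<and> eval_fps G x = f' x / f x \<and> x \<in> eball 0 (fps_conv_radius G)) (nhds 0)"
    by eventually_elim auto
  then obtain d where d: "d > 0" "\<And>x. dist x 0 < d \<Longrightarrow> f x > 0 \<and> eval_fps G x = f' x / f x \<and> x \<in> eball 0 (fps_conv_radius G)"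
    unfolding eventually_nhds_metric by blast
  define L where "L = fps_integral0 G"
  have rL: "fps_conv_radius G \<le> fps_conv_radius L"
    unfolding L_def by (rule fps_conv_radius_integral)
  have "eval_fps L x = ln (f x)" if x: "dist x 0 < d" for x
  proof -
    have "((\<lambda>x. eval_fps L x - ln (f x)) has_field_derivative 0) (at y within ball 0 d)" if y: "y \<in> ball 0 d" for y
    proof -
      from y have dy: "dist y 0 < d" by (simp add: dist_commute)
      note dd = d(2)[OF dy]
      have "ereal (norm y) < fps_conv_radius L"
        using dd rL less_le_trans by fastforce
      then have "(eval_fps L has_field_derivative eval_fps (fps_deriv L) y) (at y within ball 0 d)"
        by (rule has_field_derivative_eval_fps)
      also have "fps_deriv L = G" unfolding L_def by (rule fps_deriv_fps_integral)
      finally have 1: "(eval_fps L has_field_derivative eval_fps G y) (at y within ball 0 d)" .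
      have "((\<lambda>x. ln (f x)) has_field_derivative inverse (f y) * f' y) (at y)"
        using dd by (intro DERIV_chain2[OF DERIV_ln deriv]) auto
      then have 2: "((\<lambda>x. ln (f x)) has_field_derivative inverse (f y) * f' y) (at y within ball 0 d)"
        by (rule has_field_derivative_at_within)
      show ?thesis
        using DERIV_diff[OF 1 2] dd by (simp add: field_simps)
    qed
    then obtain c where c: "\<And>y. y \<in> ball 0 d \<Longrightarrow> eval_fps L y - ln (f y) = c"
      using has_field_derivative_zero_constant[of "ball 0 d" "\<lambda>x. eval_fps L x - ln (f x)"] by auto
    have "eval_fps L x - ln (f x) = eval_fps L 0 - ln (f 0)"
      using c[of x] c[of 0] x d(1) by (simp add: dist_commute)
    then show ?thesis by (simp add: f0 eval_fps_at_0 L_def)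
  qed
  then have "eventually (\<lambda>x. eval_fps L x = ln (f x)) (nhds 0)"
    unfolding eventually_nhds_metric using d(1) by blast
  then show ?thesis
    using rL rG unfolding has_fps_expansion_def L_def G_def by auto
qed

text \<open>Let L be the series of the logarithm. Comparing coefficients in M' = L' M expresses the
  moment of order n + 1 as the sum over i of (n choose i) times cumulant i + 1 times moment n - i.
  This is the recursion of \<open>joint_cumulant_rec\<close> for moments that depend on the
  cardinality only.\<close>

lemma cumulant_eq_joint_cumulant:
  assumes fin: "finite (set_pmf p)" and r: "1 \<le> r"
  shows "cumulant r (measure_pmf p) X
    = joint_cumulant (\<lambda>B. measure_pmf.expectation p (\<lambda>\<omega>. X \<omega> ^ card B)) {1..r}"
proof -
  define \<mu> where "\<mu> j = measure_pmf.expectation p (\<lambda>\<omega>. X \<omega> ^ j)" for j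
  have \<mu>: "\<mu> j = (\<Sum>\<omega>\<in>set_pmf p. pmf p \<omega> * X \<omega> ^ j)" for j
    unfolding \<mu>_def by (subst integral_measure_pmf[OF fin]) auto
  define f where "f \<xi> = (\<Sum>\<omega>\<in>set_pmf p. pmf p \<omega> * exp (X \<omega> * \<xi>))" for \<xi>
  define f' where "f' \<xi> = (\<Sum>\<omega>\<in>set_pmf p. pmf p \<omega> * (X \<omega> * exp (X \<omega> * \<xi>)))" for \<xi>
  define M where "M = (\<Sum>\<omega>\<in>set_pmf p. fps_const (pmf p \<omega>) * fps_exp (X \<omega>))"
  have fexp: "(\<lambda>\<xi>. measure_pmf.expectation p (\<lambda>\<omega>. exp (\<xi> * X \<omega>))) = f"
    unfolding f_def by (rule ext, subst integral_measure_pmf[OF fin]) (auto simp: mult.commute)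
  have M: "f has_fps_expansion M"
    unfolding f_def M_def by (intro fps_expansion_intros)
  have M_nth: "fps_nth M j = \<mu> j / fact j" for j
    unfolding M_def \<mu> by (simp add: fps_sum_nth sum_divide_distrib)
  have "fps_deriv M = (\<Sum>\<omega>\<in>set_pmf p. fps_const (pmf p \<omega>) * (fps_const (X \<omega>) * fps_exp (X \<omega>)))"
    unfolding M_def by (simp add: fps_deriv_sum)
  moreover have "f' has_fps_expansion \<dots>"
    unfolding f'_def by (intro fps_expansion_intros)
  ultimately have M': "f' has_fps_expansion fps_deriv M" by simp
  have deriv: "(f has_real_derivative f' x) (at x)" for x
    unfolding f_def f'_def by (auto intro!: derivative_eq_intros sum.cong)
  have \<mu>0: "\<mu> 0 = 1" unfolding \<mu>_def by simp
  then have M0: "fps_nth M 0 = 1" by (simp add: M_nth)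
  define L where "L = fps_integral0 (fps_deriv M / M)"
  have L: "(\<lambda>\<xi>. ln (f \<xi>)) has_fps_expansion L"
    unfolding L_def by (rule has_fps_expansion_ln[OF M M0 M' deriv])
  have "(THE F. (\<lambda>\<xi>. ln (measure_pmf.expectation p (\<lambda>\<omega>. exp (\<xi> * X \<omega>)))) has_fps_expansion F) = L"
    using L has_fps_expansion_unique_real unfolding fun_cong[OF fexp] by (intro the_equality) blast+
  then have cum: "cumulant r (measure_pmf p) X = fact r * fps_nth L r"
    unfolding cumulant_def by simp
  have LM: "fps_deriv M = fps_deriv L * M"
  proof -
    have "fps_deriv L * M = fps_deriv M * (inverse M * M)"
      unfolding L_def fps_deriv_fps_integral by (subst fps_divide_unit) (simp_all only: M0 mult.assoc one_neq_zero not_False_eq_True)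
    also have "inverse M * M = 1"
      by (rule inverse_mult_eq_1) (simp only: M0 one_neq_zero not_False_eq_True)
    finally show ?thesis by simp
  qed
  have rec: "\<mu> (Suc n) = (\<Sum>i\<le>n. real (n choose i) * (fact (Suc i) * fps_nth L (Suc i) * \<mu> (n - i)))" for n
  proof -
    have "\<mu> (Suc n) = fact n * fps_nth (fps_deriv M) n"
      by (simp add: M_nth del: of_nat_Suc)
    also have "\<dots> = (\<Sum>i\<le>n. fact n * (of_nat (Suc i) * fps_nth L (Suc i) * (\<mu> (n - i) / fact (n - i))))"
      unfolding LM fps_mult_nth by (simp add: M_nth sum_distrib_left atLeast0AtMost)
    also have "\<dots> = (\<Sum>i\<le>n. real (n choose i) * (fact (Suc i) * fps_nth L (Suc i) * \<mu> (n - i)))"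
    proof (rule sum.cong[OF refl])
      fix i assume "i \<in> {..n}"
      then have "real (n choose i) = fact n / (fact i * fact (n - i))"
        by (intro binomial_fact) auto
      then show "fact n * (of_nat (Suc i) * fps_nth L (Suc i) * (\<mu> (n - i) / fact (n - i)))
          = real (n choose i) * (fact (Suc i) * fps_nth L (Suc i) * \<mu> (n - i))"
        by (simp add: fact_Suc del: of_nat_Suc)
    qed
    finally show ?thesis .
  qed
  have "fact (card {1..r}) * fps_nth L (card {1..r}) = joint_cumulant (\<lambda>B. \<mu> (card B)) {1..r}"
  proof (rule joint_cumulant_unique[where K = "\<lambda>B. fact (card B) * fps_nth L (card B)"])
    fix B assume B: "B \<subseteq> {1..r}" "B \<noteq> {}"
    then obtain a where a: "a \<in> B" by auto
    have finB: "finite B" using B finite_subset by blast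
    obtain n where n: "card B = Suc n"
      using finB a by (metis card_gt_0_iff empty_iff gr0_implies_Suc)
    have "(\<Sum>C | C \<subseteq> B \<and> a \<in> C. fact (card C) * fps_nth L (card C) * \<mu> (card (B - C)))
      = (\<Sum>C | C \<subseteq> B \<and> a \<in> C. fact (card C) * fps_nth L (card C) * \<mu> (Suc n - card C))"
      using finB n by (intro sum.cong refl) (auto simp: card_Diff_subset finite_subset)
    also have "\<dots> = \<mu> (card B)"
      using sum_subsets_containing[OF finB a n, of "\<lambda>c. fact c * fps_nth L c * \<mu> (Suc n - c)"] rec[of n] n
      by simp
    finally show "\<exists>a\<in>B. \<mu> (card B) = (\<Sum>C | C \<subseteq> B \<and> a \<in> C. fact (card C) * fps_nth L (card C) * \<mu> (card (B - C)))"
      using a by metis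
  qed (use r in \<open>auto simp: \<mu>0\<close>)
  then show ?thesis using cum by (simp add: \<mu>_def)
qed

subsection \<open>Uniformly random orders\<close>

text \<open>Orders of \<open>A\<close> are lists, so that restriction to a subset is
  \<open>filter\<close> and the ways to merge two orders are \<open>shuffles\<close>.\<close>

definition order_prob :: "'a set \<Rightarrow> ('a list \<Rightarrow> bool) \<Rightarrow> real" where
  "order_prob A P = real (card {zs \<in> permutations_of_set A. P zs}) / fact (card A)"

lemma order_prob_cong:
  assumes "A = B" and "\<And>zs. zs \<in> permutations_of_set B \<Longrightarrow> P zs = Q zs"
  shows "order_prob A P = order_prob B Q"
proof -
  have "{zs \<in> permutations_of_set A. P zs} = {zs \<in> permutations_of_set B. Q zs}"
    using assms by auto
  then show ?thesis using assms(1) by (simp add: order_prob_def)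
qed

lemma order_prob_True: "finite A \<Longrightarrow> order_prob A (\<lambda>_. True) = 1"
  by (simp add: order_prob_def)

lemma shuffles_eq_permutations:
  assumes "A \<inter> B = {}" and xs: "xs \<in> permutations_of_set A" and ys: "ys \<in> permutations_of_set B"
  shows "shuffles xs ys = {zs \<in> permutations_of_set (A \<union> B).
    filter (\<lambda>x. x \<in> A) zs = xs \<and> filter (\<lambda>x. x \<in> B) zs = ys}"
proof -
  have [simp]: "set xs = A" "distinct xs" "set ys = B" "distinct ys"
    using xs ys by (auto simp: permutations_of_set_def)
  show ?thesis
  proof (intro equalityI subsetI)
    fix zs assume zs: "zs \<in> shuffles xs ys"
    then show "zs \<in> {zs \<in> permutations_of_set (A \<union> B).
        filter (\<lambda>x. x \<in> A) zs = xs \<and> filter (\<lambda>x. x \<in> B) zs = ys}"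
      using filter_shuffles_disjoint1(1)[of xs ys zs] filter_shuffles_disjoint2(1)[of xs ys zs]
        distinct_disjoint_shuffles[of xs ys zs] set_shuffles[OF zs] assms(1)
      by (auto simp: permutations_of_set_def)
  next
    fix zs assume zs: "zs \<in> {zs \<in> permutations_of_set (A \<union> B).
        filter (\<lambda>x. x \<in> A) zs = xs \<and> filter (\<lambda>x. x \<in> B) zs = ys}"
    then have "filter (\<lambda>x. x \<notin> A) zs = filter (\<lambda>x. x \<in> B) zs"
      using assms(1) by (intro filter_cong) (auto simp: permutations_of_set_def)
    then show "zs \<in> shuffles xs ys"
      using partition_in_shuffles[of zs "\<lambda>x. x \<in> A"] zs by auto
  qed
qed

text \<open>Every pair of orders of \<open>A\<close> and \<open>B\<close> has the same number of
  shuffles, a binomial coefficient. Hence the two restricted orders are uniform and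
  independent.\<close>

lemma order_prob_mult:
  assumes fin: "finite A" "finite B" and disj: "A \<inter> B = {}"
  shows "order_prob (A \<union> B) (\<lambda>zs. P (filter (\<lambda>x. x \<in> A) zs) \<and> Q (filter (\<lambda>x. x \<in> B) zs))
    = order_prob A P * order_prob B Q"
proof -
  let ?X = "{xs \<in> permutations_of_set A. P xs}" and ?Y = "{ys \<in> permutations_of_set B. Q ys}"
  let ?Z = "{zs \<in> permutations_of_set (A \<union> B). P (filter (\<lambda>x. x \<in> A) zs) \<and> Q (filter (\<lambda>x. x \<in> B) zs)}"
  let ?c = "(card A + card B) choose card A"
  have sh: "shuffles xs ys = {zs \<in> permutations_of_set (A \<union> B).
      filter (\<lambda>x. x \<in> A) zs = xs \<and> filter (\<lambda>x. x \<in> B) zs = ys}"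
    if "xs \<in> ?X" "ys \<in> ?Y" for xs ys
    using shuffles_eq_permutations[OF disj] that by blast
  have "?Z = (\<Union>(xs, ys)\<in>?X \<times> ?Y. shuffles xs ys)"
  proof -
    have "filter (\<lambda>x. x \<in> A) zs \<in> permutations_of_set A \<and> filter (\<lambda>x. x \<in> B) zs \<in> permutations_of_set B"
      if "zs \<in> permutations_of_set (A \<union> B)" for zs
      using that by (auto simp: permutations_of_set_def)
    then show ?thesis using sh by auto
  qed
  moreover have "card (\<Union>(xs, ys)\<in>?X \<times> ?Y. shuffles xs ys) = (\<Sum>(xs, ys)\<in>?X \<times> ?Y. card (shuffles xs ys))"
    by (subst card_UN_disjoint) (auto simp: sh case_prod_beta)
  moreover have "\<dots> = (\<Sum>(xs, ys)\<in>?X \<times> ?Y. ?c)"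
    using disj by (intro sum.cong)
      (auto simp: card_disjoint_shuffles permutations_of_set_def distinct_card[symmetric])
  ultimately have "card ?Z = card ?X * card ?Y * ?c"
    by (simp add: case_prod_beta card_cartesian_product)
  moreover have "real ?c = fact (card A + card B) / (fact (card A) * fact (card B))"
    by (simp add: binomial_fact)
  moreover have "card (A \<union> B) = card A + card B"
    using fin disj by (rule card_Un_disjoint)
  ultimately show ?thesis
    unfolding order_prob_def by simp
qed

lemma order_prob_restrict:
  assumes "finite V" "A \<subseteq> V"
  shows "order_prob V (\<lambda>zs. P (filter (\<lambda>x. x \<in> A) zs)) = order_prob A P"
  using order_prob_mult[of A "V - A" P "\<lambda>_. True"] assms finite_subset[OF assms(2,1)]
  by (simp add: order_prob_True Un_absorb1)

lemma filter_filter_subset: "B \<subseteq> A \<Longrightarrow> filter (\<lambda>x. x \<in> B) (filter (\<lambda>x. x \<in> A) zs) = filter (\<lambda>x. x \<in> B) zs"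
  by (auto simp: intro!: filter_cong)

text \<open>Each event depends only on the restriction of the order to the union of its own group,
  \<open>A\<close> or \<open>B\<close>, and these unions are disjoint.\<close>

lemma order_prob_family_mult:
  assumes V: "finite V" and sub: "\<And>i. i \<in> S1 \<union> S2 \<Longrightarrow> U i \<subseteq> V"
    and disj: "\<And>i j. i \<in> S1 \<Longrightarrow> j \<in> S2 \<Longrightarrow> U i \<inter> U j = {}"
  shows "order_prob V (\<lambda>zs. \<forall>i\<in>S1 \<union> S2. filter (\<lambda>x. x \<in> U i) zs = L i)
    = order_prob V (\<lambda>zs. \<forall>i\<in>S1. filter (\<lambda>x. x \<in> U i) zs = L i)
      * order_prob V (\<lambda>zs. \<forall>i\<in>S2. filter (\<lambda>x. x \<in> U i) zs = L i)"
proof -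
  define A B where "A = (\<Union>i\<in>S1. U i)" and "B = (\<Union>i\<in>S2. U i)"
  have AB: "A \<subseteq> V" "B \<subseteq> V" using sub by (auto simp: A_def B_def)
  have AB: "A \<subseteq> V" "B \<subseteq> V" "A \<inter> B = {}" "finite A" "finite B"
    using AB finite_subset[OF _ V] disj unfolding A_def B_def by blast+
  have A: "filter (\<lambda>x. x \<in> U i) (filter (\<lambda>x. x \<in> A) zs) = filter (\<lambda>x. x \<in> U i) zs" if "i \<in> S1" for i zs
    using that by (intro filter_filter_subset) (auto simp: A_def)
  have B: "filter (\<lambda>x. x \<in> U i) (filter (\<lambda>x. x \<in> B) zs) = filter (\<lambda>x. x \<in> U i) zs" if "i \<in> S2" for i zs
    using that by (intro filter_filter_subset) (auto simp: B_def)
  have [simp]: "filter (\<lambda>x. x \<in> A) (filter (\<lambda>x. x \<in> A \<union> B) zs) = filter (\<lambda>x. x \<in> A) zs"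
    "filter (\<lambda>x. x \<in> B) (filter (\<lambda>x. x \<in> A \<union> B) zs) = filter (\<lambda>x. x \<in> B) zs" for zs
    by (rule filter_filter_subset; auto)+
  let ?P = "\<lambda>zs. \<forall>i\<in>S1. filter (\<lambda>x. x \<in> U i) zs = L i" and ?Q = "\<lambda>zs. \<forall>i\<in>S2. filter (\<lambda>x. x \<in> U i) zs = L i"
  have "order_prob V (\<lambda>zs. \<forall>i\<in>S1 \<union> S2. filter (\<lambda>x. x \<in> U i) zs = L i)
    = order_prob V (\<lambda>zs. (\<lambda>zs. ?P (filter (\<lambda>x. x \<in> A) zs) \<and> ?Q (filter (\<lambda>x. x \<in> B) zs)) (filter (\<lambda>x. x \<in> A \<union> B) zs))"
    by (intro order_prob_cong refl) (simp add: A B ball_Un del: filter_filter Un_iff)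
  also have "\<dots> = order_prob (A \<union> B) (\<lambda>zs. ?P (filter (\<lambda>x. x \<in> A) zs) \<and> ?Q (filter (\<lambda>x. x \<in> B) zs))"
    using AB by (intro order_prob_restrict V) auto
  also have "\<dots> = order_prob A ?P * order_prob B ?Q"
    by (rule order_prob_mult) (use AB in auto)
  also have "order_prob A ?P = order_prob V (\<lambda>zs. ?P (filter (\<lambda>x. x \<in> A) zs))"
    by (rule order_prob_restrict[symmetric, OF V AB(1)])
  also have "\<dots> = order_prob V ?P"
    by (intro order_prob_cong refl) (simp add: A del: filter_filter)
  also have "order_prob B ?Q = order_prob V (\<lambda>zs. ?Q (filter (\<lambda>x. x \<in> B) zs))"
    by (rule order_prob_restrict[symmetric, OF V AB(2)])
  also have "\<dots> = order_prob V ?Q"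
    by (intro order_prob_cong refl) (simp add: B del: filter_filter)
  finally show ?thesis .
qed

lemma order_prob_disjoint_lists:
  assumes "finite S" and "\<And>i. i \<in> S \<Longrightarrow> distinct (L i)"
    and "\<And>i j. i \<in> S \<Longrightarrow> j \<in> S \<Longrightarrow> i \<noteq> j \<Longrightarrow> set (L i) \<inter> set (L j) = {}"
  shows "order_prob (\<Union>i\<in>S. set (L i)) (\<lambda>zs. \<forall>i\<in>S. filter (\<lambda>x. x \<in> set (L i)) zs = L i)
    = (\<Prod>i\<in>S. 1 / fact (length (L i)))"
  using assms
proof (induction S rule: finite_induct)
  case empty
  then show ?case by (simp add: order_prob_def)
next
  case (insert j S)
  let ?A = "\<Union>i\<in>S. set (L i)"
  let ?P = "\<lambda>zs. \<forall>i\<in>S. filter (\<lambda>x. x \<in> set (L i)) zs = L i"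
  have sub: "filter (\<lambda>x. x \<in> set (L i)) (filter (\<lambda>x. x \<in> ?A) zs) = filter (\<lambda>x. x \<in> set (L i)) zs"
    if "i \<in> S" for i zs
    using that by (intro filter_filter_subset) auto
  have "order_prob (\<Union>i\<in>insert j S. set (L i)) (\<lambda>zs. \<forall>i\<in>insert j S. filter (\<lambda>x. x \<in> set (L i)) zs = L i)
    = order_prob (?A \<union> set (L j)) (\<lambda>zs. ?P (filter (\<lambda>x. x \<in> ?A) zs) \<and> filter (\<lambda>x. x \<in> set (L j)) zs = L j)"
    using sub by (intro order_prob_cong) (auto simp del: filter_filter)
  also have "\<dots> = order_prob ?A ?P * order_prob (set (L j)) (\<lambda>zs. zs = L j)"
    using insert by (intro order_prob_mult[where Q = "\<lambda>zs. zs = L j"]) auto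
  also have "order_prob (set (L j)) (\<lambda>zs. zs = L j) = 1 / fact (length (L j))"
  proof -
    have "{zs \<in> permutations_of_set (set (L j)). zs = L j} = {L j}"
      using insert.prems by (auto simp: permutations_of_set_def)
    then show ?thesis using insert.prems by (simp add: order_prob_def distinct_card)
  qed
  also have "order_prob ?A ?P = (\<Prod>i\<in>S. 1 / fact (length (L i)))"
    using insert by (intro insert.IH) auto
  finally show ?case using insert by simp
qed

text \<open>
  An order compatible with all the lists splits at \<open>u\<close> into an order of the elements preceding \<open>u\<close> in
  their lists and one of the elements following it.
\<close>

lemma order_prob_pivot:
  assumes S: "finite S" and dist: "\<And>i. i \<in> S \<Longrightarrow> distinct (lo i @ u # hi i)"
    and disj: "\<And>i j. i \<in> S \<Longrightarrow> j \<in> S \<Longrightarrow> i \<noteq> j \<Longrightarrow> set (lo i @ u # hi i) \<inter> set (lo j @ u # hi j) = {u}"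
    and len: "\<And>i. i \<in> S \<Longrightarrow> length (lo i) = p" "\<And>i. i \<in> S \<Longrightarrow> length (hi i) = q"
  shows "order_prob (insert u (\<Union>i\<in>S. set (lo i @ u # hi i)))
      (\<lambda>zs. \<forall>i\<in>S. filter (\<lambda>x. x \<in> set (lo i @ u # hi i)) zs = lo i @ u # hi i)
    = fact (p * card S) * fact (q * card S) / ((fact p * fact q) ^ card S * fact ((p + q) * card S + 1))"
proof -
  define A B where "A = (\<Union>i\<in>S. set (lo i))" and "B = (\<Union>i\<in>S. set (hi i))"
  let ?W = "insert u (\<Union>i\<in>S. set (lo i @ u # hi i))"
  let ?Z = "{zs \<in> permutations_of_set ?W. \<forall>i\<in>S. filter (\<lambda>x. x \<in> set (lo i @ u # hi i)) zs = lo i @ u # hi i}"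
  let ?X = "{zs \<in> permutations_of_set A. \<forall>i\<in>S. filter (\<lambda>x. x \<in> set (lo i)) zs = lo i}"
  let ?Y = "{zs \<in> permutations_of_set B. \<forall>i\<in>S. filter (\<lambda>x. x \<in> set (hi i)) zs = hi i}"
  have W: "?W = insert u (A \<union> B)" by (auto simp: A_def B_def)
  have u: "u \<notin> A" "u \<notin> B" using dist by (auto simp: A_def B_def)
  have disj': "x \<in> set (lo i) \<or> x \<in> set (hi i) \<Longrightarrow> x \<in> set (lo j) \<or> x \<in> set (hi j) \<Longrightarrow> i \<in> S \<Longrightarrow> j \<in> S \<Longrightarrow> i = j" for x i j
    using disj[of i j] dist[of i] dist[of j] by (cases "i = j") auto
  have AB: "A \<inter> B = {}"
  proof -
    have False if "i \<in> S" "j \<in> S" "x \<in> set (lo i)" "x \<in> set (hi j)" for i j x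
      using disj'[of x i j] dist[of i] that by auto
    then show ?thesis unfolding A_def B_def by blast
  qed
  have fin: "finite A" "finite B" using S by (auto simp: A_def B_def)
  have disj2: "set (lo i) \<inter> set (lo j) = {}" "set (hi i) \<inter> set (hi j) = {}"
    if "i \<in> S" "j \<in> S" "i \<noteq> j" for i j
    using disj' that by blast+
  have cA: "card A = p * card S"
    unfolding A_def using S dist disj2 len
    by (subst card_UN_disjoint) (auto simp: distinct_card)
  have cB: "card B = q * card S"
    unfolding B_def using S dist disj2 len
    by (subst card_UN_disjoint) (auto simp: distinct_card)
  have fA: "filter (\<lambda>x. x \<in> set (lo i @ u # hi i)) xs = filter (\<lambda>x. x \<in> set (lo i)) xs"
    if "i \<in> S" "set xs \<subseteq> A" for i xs
    using that u AB by (intro filter_cong refl) (auto simp: B_def)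
  have fB: "filter (\<lambda>x. x \<in> set (lo i @ u # hi i)) xs = filter (\<lambda>x. x \<in> set (hi i)) xs"
    if "i \<in> S" "set xs \<subseteq> B" for i xs
    using that u AB by (intro filter_cong refl) (auto simp: A_def)
  have "?Z = (\<lambda>(xs, ys). xs @ u # ys) ` (?X \<times> ?Y)"
  proof (intro equalityI subsetI)
    fix zs assume zs: "zs \<in> ?Z"
    then have "u \<in> set zs" by (auto simp: permutations_of_set_def)
    then obtain xs ys where xy: "zs = xs @ u # ys" by (auto dest: split_list)
    have d: "distinct zs" "set zs = insert u (A \<union> B)"
      using zs unfolding W by (auto simp: permutations_of_set_def)
    then have xy': "u \<notin> set xs" "u \<notin> set ys" "set xs \<inter> set ys = {}" "distinct xs" "distinct ys"
      "set xs \<union> set ys = A \<union> B"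
      using xy u by auto
    have split: "filter (\<lambda>x. x \<in> set (lo i @ u # hi i)) xs = lo i \<and> filter (\<lambda>x. x \<in> set (lo i @ u # hi i)) ys = hi i"
      if i: "i \<in> S" for i
    proof -
      have "filter (\<lambda>x. x \<in> set (lo i @ u # hi i)) xs @ u # filter (\<lambda>x. x \<in> set (lo i @ u # hi i)) ys = lo i @ u # hi i"
        using zs i unfolding xy by simp
      then show ?thesis
        using xy' by (subst (asm) append_Cons_eq_iff) auto
    qed
    have "set xs \<subseteq> A" "set ys \<subseteq> B"
    proof -
      have *: "x \<in> set (lo i)" if "x \<in> set xs" "x \<in> set (lo i @ u # hi i)" "i \<in> S" for x i
      proof -
        have "x \<in> set (filter (\<lambda>x. x \<in> set (lo i @ u # hi i)) xs)"
          using that by (simp only: set_filter mem_Collect_eq)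
        then show ?thesis using split[OF that(3)] by metis
      qed
      have **: "x \<in> set (hi i)" if "x \<in> set ys" "x \<in> set (lo i @ u # hi i)" "i \<in> S" for x i
      proof -
        have "x \<in> set (filter (\<lambda>x. x \<in> set (lo i @ u # hi i)) ys)"
          using that by (simp only: set_filter mem_Collect_eq)
        then show ?thesis using split[OF that(3)] by metis
      qed
      show "set xs \<subseteq> A"
      proof
        fix x assume x: "x \<in> set xs"
        then have "x \<in> A \<union> B" using xy' by auto
        then obtain i where "i \<in> S" "x \<in> set (lo i @ u # hi i)" by (auto simp: A_def B_def)
        then show "x \<in> A" using *[OF x] by (auto simp: A_def)
      qed
      show "set ys \<subseteq> B"
      proof
        fix x assume x: "x \<in> set ys"
        then have "x \<in> A \<union> B" using xy' by auto
        then obtain i where "i \<in> S" "x \<in> set (lo i @ u # hi i)" by (auto simp: A_def B_def)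
        then show "x \<in> B" using **[OF x] by (auto simp: B_def)
      qed
    qed
    then have sets: "set xs = A" "set ys = B" using xy' AB by auto
    have "xs \<in> ?X" "ys \<in> ?Y"
      using sets xy' split fA fB by (auto simp: permutations_of_set_def)
    then show "zs \<in> (\<lambda>(xs, ys). xs @ u # ys) ` (?X \<times> ?Y)"
      using xy by auto
  next
    fix zs assume "zs \<in> (\<lambda>(xs, ys). xs @ u # ys) ` (?X \<times> ?Y)"
    then obtain xs ys where xy: "zs = xs @ u # ys" "xs \<in> ?X" "ys \<in> ?Y" by auto
    have d: "distinct zs" "set zs = ?W"
      using xy u AB unfolding W by (auto simp: permutations_of_set_def)
    have "filter (\<lambda>x. x \<in> set (lo i @ u # hi i)) zs = lo i @ u # hi i" if i: "i \<in> S" for i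
      using fA[OF i, of xs] fB[OF i, of ys] xy i by (auto simp: permutations_of_set_def)
    then show "zs \<in> ?Z" using d by (auto simp: permutations_of_set_def)
  qed
  moreover have "inj_on (\<lambda>(xs, ys). xs @ u # ys) (?X \<times> ?Y)"
    using u by (auto simp: inj_on_def permutations_of_set_def append_Cons_eq_iff)
  ultimately have "card ?Z = card ?X * card ?Y"
    by (simp add: card_image card_cartesian_product)
  moreover have "real (card ?X) = fact (p * card S) / fact p ^ card S"
  proof -
    have "order_prob A (\<lambda>zs. \<forall>i\<in>S. filter (\<lambda>x. x \<in> set (lo i)) zs = lo i) = (\<Prod>i\<in>S. 1 / fact (length (lo i)))"
      unfolding A_def using S dist disj2 by (intro order_prob_disjoint_lists) auto
    also have "\<dots> = 1 / fact p ^ card S" using len by (simp add: power_one_over)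
    finally show ?thesis unfolding order_prob_def cA by (simp add: field_simps)
  qed
  moreover have "real (card ?Y) = fact (q * card S) / fact q ^ card S"
  proof -
    have "order_prob B (\<lambda>zs. \<forall>i\<in>S. filter (\<lambda>x. x \<in> set (hi i)) zs = hi i) = (\<Prod>i\<in>S. 1 / fact (length (hi i)))"
      unfolding B_def using S dist disj2 by (intro order_prob_disjoint_lists) auto
    also have "\<dots> = 1 / fact q ^ card S" using len by (simp add: power_one_over)
    finally show ?thesis unfolding order_prob_def cB by (simp add: field_simps)
  qed
  moreover have "card ?W = (p + q) * card S + 1"
    unfolding W using u fin cA cB AB by (simp add: card_Un_disjoint algebra_simps)
  ultimately show ?thesis
    unfolding order_prob_def by (simp add: power_mult_distrib)
qed

subsection \<open>Random labellings as random orders\<close>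

lemma sorted_wrt_key_unique:
  fixes key :: "'a \<Rightarrow> 'b :: linorder"
  assumes "sorted_wrt (\<lambda>a b. key a < key b) xs" "sorted_wrt (\<lambda>a b. key a < key b) ys" "set xs = set ys"
  shows "xs = ys"
proof -
  have *: "sorted_wrt (<) (map key xs)" "sorted_wrt (<) (map key ys)"
    using assms by (simp_all add: sorted_wrt_map)
  then have "map key xs = map key ys"
    using assms(3) by (intro strict_sorted_equal) auto
  moreover have "inj_on key (set xs \<union> set ys)"
    using * assms(3) strict_sorted_iff[of "map key ys"] by (simp add: distinct_map)
  ultimately show ?thesis by (rule map_inj_on)
qed

text \<open>A labelling becomes the list of the balls by increasing label. Conversely a ball gets
  its position plus one, as labels start at 1.\<close>

lemma bij_betw_labellings:
  "bij_betw (\<lambda>\<pi>. sort_key \<pi> [0..<length T]) (labellings T) (permutations_of_set (balls T))"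
proof -
  let ?n = "length T"
  let ?\<Phi> = "\<lambda>\<pi>. sort_key \<pi> [0..<?n]"
  have map: "map \<pi> (?\<Phi> \<pi>) = [1..<Suc ?n]" if "\<pi> \<in> labellings T" for \<pi>
  proof -
    have \<pi>: "bij_betw \<pi> {..<?n} {1..?n}" using that by (auto simp: labellings_def)
    have "distinct (map \<pi> (?\<Phi> \<pi>))"
      using \<pi> by (simp add: distinct_map bij_betw_def atLeast0LessThan)
    moreover have "set (map \<pi> (?\<Phi> \<pi>)) = set [1..<Suc ?n]"
      using \<pi> by (auto simp: bij_betw_def atLeast0LessThan)
    moreover have "sorted (map \<pi> (?\<Phi> \<pi>))" by simp
    ultimately show ?thesis
      by (intro sorted_distinct_set_unique) (simp_all only: sorted_upt distinct_upt)
  qed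
  have inj: "inj_on ?\<Phi> (labellings T)"
  proof (rule inj_onI)
    fix \<pi> \<sigma> assume \<pi>: "\<pi> \<in> labellings T" "\<sigma> \<in> labellings T" and eq: "?\<Phi> \<pi> = ?\<Phi> \<sigma>"
    then have "map \<pi> (?\<Phi> \<pi>) = map \<sigma> (?\<Phi> \<pi>)" using map by metis
    then have "\<pi> j = \<sigma> j" if "j < ?n" for j using that by simp
    moreover have "\<pi> \<in> {..<?n} \<rightarrow>\<^sub>E {1..?n}" "\<sigma> \<in> {..<?n} \<rightarrow>\<^sub>E {1..?n}"
      using \<pi> unfolding labellings_def by blast+
    ultimately show "\<pi> = \<sigma>" by (intro PiE_ext) auto
  qed
  moreover have "?\<Phi> ` labellings T = permutations_of_set (balls T)"
  proof (intro equalityI subsetI)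
    fix zs assume "zs \<in> ?\<Phi> ` labellings T"
    then show "zs \<in> permutations_of_set (balls T)"
      by (auto simp: permutations_of_set_def)
  next
    fix zs assume zs: "zs \<in> permutations_of_set (balls T)"
    then have z: "set zs = {..<?n}" "distinct zs" by (auto simp: permutations_of_set_def)
    have "length zs = ?n" using distinct_card[OF z(2)] z(1) by (metis card_lessThan)
    note z = z this
    then have bij: "bij_betw ((!) zs) {..<?n} {..<?n}"
      by (intro bij_betw_nth) simp_all
    define \<pi> where "\<pi> = restrict (Suc \<circ> inv_into {..<?n} ((!) zs)) {..<?n}"
    have "bij_betw (Suc \<circ> inv_into {..<?n} ((!) zs)) {..<?n} {1..?n}"
      by (rule bij_betw_trans[OF bij_betw_inv_into[OF bij]])
         (auto simp: bij_betw_def image_Suc_lessThan)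
    then have "bij_betw \<pi> {..<?n} {1..?n}"
      using bij_betw_cong[of "{..<?n}" "Suc \<circ> inv_into {..<?n} ((!) zs)" \<pi>] by (simp add: \<pi>_def)
    moreover have "\<pi> \<in> extensional {..<?n}" by (simp add: \<pi>_def)
    ultimately have \<pi>: "\<pi> \<in> labellings T"
      by (auto simp: labellings_def PiE_def bij_betw_def)
    have nth: "\<pi> (zs ! i) = Suc i" if "i < ?n" for i
    proof -
      have "zs ! i \<in> {..<?n}" using that z nth_mem[of i zs] by simp
      moreover have "inv_into {..<?n} ((!) zs) (zs ! i) = i"
        using that bij by (intro inv_into_f_f) (auto simp: bij_betw_def)
      ultimately show ?thesis by (simp add: \<pi>_def)
    qed
    have "?\<Phi> \<pi> = zs"
    proof (rule sorted_wrt_key_unique)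
      have "sorted_wrt (<) (map \<pi> (?\<Phi> \<pi>))"
        unfolding map[OF \<pi>] by (rule sorted_wrt_upt)
      then show "sorted_wrt (\<lambda>a b. \<pi> a < \<pi> b) (?\<Phi> \<pi>)" by (simp add: sorted_wrt_map)
      show "sorted_wrt (\<lambda>a b. \<pi> a < \<pi> b) zs"
        using z nth by (auto simp: sorted_wrt_iff_nth_less)
    qed (simp add: z(1) atLeast0LessThan)
    then show "zs \<in> ?\<Phi> ` labellings T" using \<pi> by blast
  qed
  ultimately show ?thesis by (simp add: bij_betw_def)
qed

lemma finite_labellings: "finite (labellings T)" and labellings_nonempty: "labellings T \<noteq> {}"
  and card_labellings: "card (labellings T) = fact (length T)"
proof -
  show fin: "finite (labellings T)"
    using bij_betw_finite[OF bij_betw_labellings[of T]] by simp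
  show card: "card (labellings T) = fact (length T)"
    using bij_betw_same_card[OF bij_betw_labellings[of T]] by simp
  show "labellings T \<noteq> {}" using card by auto
qed

lemma prob_labellings:
  "measure_pmf.prob (pmf_of_set (labellings T)) {\<pi>. \<Phi> (sort_key \<pi> [0..<length T])} = order_prob (balls T) \<Phi>"
proof -
  have "bij_betw (\<lambda>\<pi>. sort_key \<pi> [0..<length T]) {\<pi>\<in>labellings T. \<Phi> (sort_key \<pi> [0..<length T])}
      {zs \<in> permutations_of_set (balls T). \<Phi> zs}"
    using bij_betw_labellings[of T] by (auto simp: bij_betw_def inj_on_def)
  then have "card {\<pi>\<in>labellings T. \<Phi> (sort_key \<pi> [0..<length T])}
      = card {zs \<in> permutations_of_set (balls T). \<Phi> zs}"
    by (rule bij_betw_same_card)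
  then show ?thesis
    unfolding order_prob_def measure_pmf_of_set[OF labellings_nonempty finite_labellings] card_labellings
    by (simp add: Int_def)
qed

text \<open>The elements of \<open>us\<close> in the order in which their labels increase if they are ordered like \<open>\<alpha>\<close>.\<close>

definition arrange :: "nat list \<Rightarrow> 'a list \<Rightarrow> 'a list" where
  "arrange \<alpha> us = map (\<lambda>p. us ! inv_into {..<length \<alpha>} ((!) \<alpha>) p) [1..<Suc (length \<alpha>)]"

text \<open>Entries of \<open>\<alpha>\<close> start at 1 and list positions at 0, whence the shift
  in \<open>\<alpha> ! i - 1\<close>.\<close>

lemma arrange:
  assumes \<alpha>: "\<alpha> \<in> permutations_of_set {1..k}" and us: "length us = k" "distinct us"
  shows length_arrange: "length (arrange \<alpha> us) = k"
    and nth_arrange: "i < k \<Longrightarrow> arrange \<alpha> us ! (\<alpha> ! i - 1) = us ! i"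
    and set_arrange: "set (arrange \<alpha> us) = set us"
    and distinct_arrange: "distinct (arrange \<alpha> us)"
proof -
  have \<alpha>': "set \<alpha> = {1..k}" "distinct \<alpha>" "length \<alpha> = k"
    using \<alpha> distinct_card[of \<alpha>] by (auto simp: permutations_of_set_def)
  then have bij: "bij_betw ((!) \<alpha>) {..<k} {1..k}" by (intro bij_betw_nth) auto
  show "length (arrange \<alpha> us) = k" using \<alpha>' by (simp add: arrange_def)
  show "arrange \<alpha> us ! (\<alpha> ! i - 1) = us ! i" if "i < k"
  proof -
    have "\<alpha> ! i \<in> {1..k}" using that \<alpha>' nth_mem by blast
    then show ?thesis
      using that \<alpha>' bij by (auto simp: arrange_def bij_betw_def nth_upt simp del: upt_Suc)
  qed
  have us': "bij_betw ((!) us) {..<k} (set us)"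
    using us by (intro bij_betw_nth) auto
  have "bij_betw (\<lambda>p. us ! inv_into {..<k} ((!) \<alpha>) p) {1..k} (set us)"
    using bij_betw_trans[OF bij_betw_inv_into[OF bij] us'] by (simp add: comp_def)
  moreover have "set [1..<Suc k] = {1..k}" by auto
  ultimately show "set (arrange \<alpha> us) = set us" "distinct (arrange \<alpha> us)"
    unfolding arrange_def \<alpha>'(3) by (auto simp: distinct_map bij_betw_def simp del: upt_Suc)
qed

lemma same_relative_order_iff_sorted:
  assumes \<alpha>: "\<alpha> \<in> permutations_of_set {1..k}" and us: "length us = k" "distinct us"
  shows "same_relative_order (map \<pi> us) \<alpha> \<longleftrightarrow> sorted_wrt (\<lambda>a b. \<pi> a < \<pi> b) (arrange \<alpha> us)"
proof -
  have \<alpha>': "set \<alpha> = {1..k}" "distinct \<alpha>" "length \<alpha> = k"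
    using \<alpha> distinct_card[of \<alpha>] by (auto simp: permutations_of_set_def)
  note arr = length_arrange[OF \<alpha> us] nth_arrange[OF \<alpha> us]
  have rng: "\<alpha> ! i \<in> {1..k}" if "i < k" for i using that \<alpha>' nth_mem by blast
  show ?thesis
  proof
    assume *: "same_relative_order (map \<pi> us) \<alpha>"
    show "sorted_wrt (\<lambda>a b. \<pi> a < \<pi> b) (arrange \<alpha> us)"
      unfolding sorted_wrt_iff_nth_less arr(1)
    proof (intro allI impI)
      fix p q assume pq: "p < q" "q < k"
      then have "Suc p \<in> set \<alpha>" "Suc q \<in> set \<alpha>" using \<alpha>' by auto
      then obtain i j where ij: "i < k" "j < k" "\<alpha> ! i = Suc p" "\<alpha> ! j = Suc q"
        using \<alpha>' by (metis in_set_conv_nth)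
      then show "\<pi> (arrange \<alpha> us ! p) < \<pi> (arrange \<alpha> us ! q)"
        using * arr(2)[of i] arr(2)[of j] pq us by (auto simp: same_relative_order_def)
    qed
  next
    assume *: "sorted_wrt (\<lambda>a b. \<pi> a < \<pi> b) (arrange \<alpha> us)"
    have less: "\<pi> (us ! i) < \<pi> (us ! j)" if "i < k" "j < k" "\<alpha> ! i < \<alpha> ! j" for i j
      using sorted_wrt_nth_less[OF *, of "\<alpha> ! i - 1" "\<alpha> ! j - 1"] that rng[of i] rng[of j] arr by auto
    show "same_relative_order (map \<pi> us) \<alpha>"
      unfolding same_relative_order_def
    proof (intro conjI allI impI)
      fix i j assume "i < length (map \<pi> us)" "j < length (map \<pi> us)"
      then have ij: "i < k" "j < k" using us by auto
      have "\<alpha> ! i = \<alpha> ! j \<longleftrightarrow> i = j" using ij \<alpha>' by (simp add: nth_eq_iff_index_eq)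
      then show "(map \<pi> us ! i < map \<pi> us ! j) = (\<alpha> ! i < \<alpha> ! j)"
        using less[of i j] less[of j i] ij us by (cases "\<alpha> ! i" "\<alpha> ! j" rule: linorder_cases) auto
    qed (use us \<alpha>' in auto)
  qed
qed

text \<open>Makes the pattern an event about a restricted order of the balls, the form in which
  independence and the pivot formula are stated.\<close>

lemma same_relative_order_iff_filter:
  assumes \<alpha>: "\<alpha> \<in> permutations_of_set {1..k}" and us: "length us = k" "distinct us" "set us \<subseteq> balls T"
    and \<pi>: "\<pi> \<in> labellings T"
  shows "same_relative_order (map \<pi> us) \<alpha>
    \<longleftrightarrow> filter (\<lambda>x. x \<in> set us) (sort_key \<pi> [0..<length T]) = arrange \<alpha> us"
proof -
  let ?zs = "sort_key \<pi> [0..<length T]"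
  have "bij_betw \<pi> (balls T) {1..length T}" using \<pi> by (auto simp: labellings_def)
  then have "distinct (map \<pi> ?zs)"
    by (simp add: distinct_map bij_betw_def atLeast0LessThan)
  then have "sorted_wrt (<) (map \<pi> ?zs)" by (simp add: strict_sorted_iff)
  then have zs: "sorted_wrt (\<lambda>a b. \<pi> a < \<pi> b) (filter (\<lambda>x. x \<in> set us) ?zs)"
    unfolding sorted_wrt_map by (rule sorted_wrt_filter)
  have set: "set (filter (\<lambda>x. x \<in> set us) ?zs) = set (arrange \<alpha> us)"
    using us by (auto simp: set_arrange[OF \<alpha> us(1,2)])
  show ?thesis
    unfolding same_relative_order_iff_sorted[OF \<alpha> us(1,2)]
    using sorted_wrt_key_unique[OF zs _ set] zs by auto
qed

lemma expectation_prod_same_relative_order: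
  assumes \<alpha>: "\<alpha> \<in> permutations_of_set {1..k}" and S: "finite S"
    and us: "\<And>i. i \<in> S \<Longrightarrow> length (f i) = k \<and> distinct (f i) \<and> set (f i) \<subseteq> balls T"
  shows "measure_pmf.expectation (pmf_of_set (labellings T))
      (\<lambda>\<pi>. \<Prod>i\<in>S. of_bool (same_relative_order (map \<pi> (f i)) \<alpha>))
    = order_prob (balls T) (\<lambda>zs. \<forall>i\<in>S. filter (\<lambda>x. x \<in> set (f i)) zs = arrange \<alpha> (f i))"
proof -
  let ?\<Phi> = "\<lambda>zs. \<forall>i\<in>S. filter (\<lambda>x. x \<in> set (f i)) zs = arrange \<alpha> (f i)"
  have "measure_pmf.expectation (pmf_of_set (labellings T))
      (\<lambda>\<pi>. \<Prod>i\<in>S. of_bool (same_relative_order (map \<pi> (f i)) \<alpha>) :: real)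
    = measure_pmf.expectation (pmf_of_set (labellings T))
      (indicator {\<pi>. ?\<Phi> (sort_key \<pi> [0..<length T])})"
  proof (rule integral_cong_AE)
    show "AE \<pi> in measure_pmf (pmf_of_set (labellings T)).
      (\<Prod>i\<in>S. of_bool (same_relative_order (map \<pi> (f i)) \<alpha>) :: real)
        = indicator {\<pi>. ?\<Phi> (sort_key \<pi> [0..<length T])} \<pi>"
    proof (rule AE_pmfI)
      fix \<pi> assume "\<pi> \<in> set_pmf (pmf_of_set (labellings T))"
      then have \<pi>: "\<pi> \<in> labellings T" by (simp add: labellings_nonempty finite_labellings)
      have iff: "same_relative_order (map \<pi> (f i)) \<alpha>
          \<longleftrightarrow> filter (\<lambda>x. x \<in> set (f i)) (sort_key \<pi> [0..<length T]) = arrange \<alpha> (f i)" if "i \<in> S" for i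
        using us[OF that] by (intro same_relative_order_iff_filter[OF \<alpha> _ _ _ \<pi>]) auto
      show "(\<Prod>i\<in>S. of_bool (same_relative_order (map \<pi> (f i)) \<alpha>) :: real)
        = indicator {\<pi>. ?\<Phi> (sort_key \<pi> [0..<length T])} \<pi>"
        using S iff by (auto simp: indicator_def intro!: prod.neutral)
    qed
  qed auto
  also have "\<dots> = order_prob (balls T) ?\<Phi>"
    using prob_labellings[of T ?\<Phi>] by simp
  finally show ?thesis .
qed

text \<open>The common head has rank \<open>\<alpha> ! 0\<close> in every chain, so it is a pivot
  with \<open>\<alpha> ! 0 - 1\<close> balls of each chain before it and
  \<open>k - \<alpha> ! 0\<close> after it.\<close>

lemma order_prob_common_head:
  assumes \<alpha>: "\<alpha> \<in> permutations_of_set {1..k}" and k: "1 \<le> k" and S: "finite S" "S \<noteq> {}" and V: "finite V"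
    and us: "\<And>i. i \<in> S \<Longrightarrow> length (f i) = k \<and> distinct (f i) \<and> set (f i) \<subseteq> V \<and> hd (f i) = u"
    and disj: "\<And>i j. i \<in> S \<Longrightarrow> j \<in> S \<Longrightarrow> i \<noteq> j \<Longrightarrow> set (f i) \<inter> set (f j) = {u}"
  shows "order_prob V (\<lambda>zs. \<forall>i\<in>S. filter (\<lambda>x. x \<in> set (f i)) zs = arrange \<alpha> (f i)) = a_coeff k (card S) \<alpha>"
proof -
  have \<alpha>': "set \<alpha> = {1..k}" "length \<alpha> = k"
    using \<alpha> distinct_card[of \<alpha>] by (auto simp: permutations_of_set_def)
  have a: "\<alpha> ! 0 \<in> {1..k}" using nth_mem[of 0 \<alpha>] \<alpha>' k by auto
  define p where "p = \<alpha> ! 0 - 1"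
  define lo where "lo i = take p (arrange \<alpha> (f i))" for i
  define hi where "hi i = drop (Suc p) (arrange \<alpha> (f i))" for i
  have pk: "p < k" using a by (auto simp: p_def)
  have arr: "arrange \<alpha> (f i) = lo i @ u # hi i" if i: "i \<in> S" for i
  proof -
    have "f i \<noteq> []" using us[OF i] k by auto
    then have "arrange \<alpha> (f i) ! p = u"
      using nth_arrange[OF \<alpha>, of "f i" 0] us[OF i] k by (simp add: p_def hd_conv_nth)
    then show ?thesis
      using id_take_nth_drop[of p "arrange \<alpha> (f i)"] length_arrange[OF \<alpha>, of "f i"] us[OF i] pk
      by (simp add: lo_def hi_def)
  qed
  have set: "set (lo i @ u # hi i) = set (f i)" if i: "i \<in> S" for i
    using arr[OF i] set_arrange[OF \<alpha>, of "f i"] us[OF i] by auto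
  have sub: "insert u (\<Union>i\<in>S. set (lo i @ u # hi i)) \<subseteq> V"
  proof -
    obtain i where "i \<in> S" using S(2) by blast
    moreover have "set (lo i @ u # hi i) \<subseteq> V" if "i \<in> S" for i
      using us[OF that] set[OF that] by simp
    ultimately show ?thesis by (auto simp del: set_append) auto
  qed
  let ?P = "\<lambda>zs. \<forall>i\<in>S. filter (\<lambda>x. x \<in> set (lo i @ u # hi i)) zs = lo i @ u # hi i"
  let ?W = "insert u (\<Union>i\<in>S. set (lo i @ u # hi i))"
  have "filter (\<lambda>x. x \<in> set (lo i @ u # hi i)) (filter (\<lambda>x. x \<in> ?W) zs) = filter (\<lambda>x. x \<in> set (lo i @ u # hi i)) zs" if "i \<in> S" for i zs
    using that by (intro filter_filter_subset) blast
  then have "order_prob V (\<lambda>zs. \<forall>i\<in>S. filter (\<lambda>x. x \<in> set (f i)) zs = arrange \<alpha> (f i))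
      = order_prob V (\<lambda>zs. ?P (filter (\<lambda>x. x \<in> ?W) zs))"
    using set arr by (intro order_prob_cong refl) (simp del: filter_filter set_append)
  also have "\<dots> = order_prob ?W ?P"
    by (rule order_prob_restrict[OF V sub])
  also have "\<dots> = fact (p * card S) * fact ((k - Suc p) * card S)
      / ((fact p * fact (k - Suc p)) ^ card S * fact ((p + (k - Suc p)) * card S + 1))"
  proof (rule order_prob_pivot[OF S(1)])
    fix i assume i: "i \<in> S"
    show "distinct (lo i @ u # hi i)"
      using arr[OF i] distinct_arrange[OF \<alpha>, of "f i"] us[OF i] by simp
    show "length (lo i) = p" "length (hi i) = k - Suc p"
      using length_arrange[OF \<alpha>, of "f i"] us[OF i] pk by (auto simp: lo_def hi_def)
  next
    fix i j assume "i \<in> S" "j \<in> S" "i \<noteq> j"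
    then show "set (lo i @ u # hi i) \<inter> set (lo j @ u # hi j) = {u}"
      using disj set by simp
  qed
  also have "\<dots> = a_coeff k (card S) \<alpha>"
    using a unfolding a_coeff_def p_def by (simp add: algebra_simps)
  finally show ?thesis .
qed

subsection \<open>Chains in split trees\<close>

lemma remove_nonempty: "2 \<le> card I \<Longrightarrow> I - {i} \<noteq> {}"
  using card_mono[of "{i}" I] by auto

lemma chainsD:
  assumes "us \<in> chains T k"
  shows "length us = k" "set us \<subseteq> balls T" "sorted_wrt (\<lambda>a b. length (T ! a) < length (T ! b)) us" "distinct us"
proof -
  show "length us = k" "set us \<subseteq> balls T" using assms by (auto simp: chains_def)
  show *: "sorted_wrt (\<lambda>a b. length (T ! a) < length (T ! b)) us"
    using assms unfolding chains_def
    by (auto simp: ball_less_def prefix_length_less elim: sorted_wrt_mono_rel[rotated])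
  have "sorted_wrt (<) (map (\<lambda>a. length (T ! a)) us)"
    using * by (simp add: sorted_wrt_map)
  then have "distinct (map (\<lambda>a. length (T ! a)) us)"
    using strict_sorted_iff by blast
  then show "distinct us" by (simp add: distinct_map)
qed

lemma finite_chains: "finite (chains T k)"
  by (rule finite_subset[OF _ finite_lists_length_eq[of "balls T" k]]) (auto simp: chains_def)

text \<open>Depths increase strictly along a chain, so it can be recovered from its set; counting
  chains becomes counting sets.\<close>

lemma chains_eqI: "us \<in> chains T k \<Longrightarrow> us' \<in> chains T k \<Longrightarrow> set us = set us' \<Longrightarrow> us = us'"
  using sorted_wrt_key_unique[of "\<lambda>a. length (T ! a)"] chainsD(3) by blast

lemma chain_less:
  assumes "us \<in> chains T k" "p < q" "q < k"
  shows "ball_less T (us ! p) (us ! q)"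
  using assms sorted_wrt_nth_less[of "ball_less T" us p q] by (auto simp: chains_def)

lemma chain_le_last:
  assumes us: "us \<in> chains T k" and x: "x \<in> set us"
  shows "x = last us \<or> ball_less T x (last us)"
proof -
  obtain p where p: "p < k" "x = us ! p"
    using x chainsD(1)[OF us] by (auto simp: in_set_conv_nth)
  then have l: "last us = us ! (k - 1)"
    using chainsD(1)[OF us] by (subst last_conv_nth) auto
  show ?thesis
  proof (cases "p = k - 1")
    case False
    then show ?thesis using chain_less[OF us, of p "k - 1"] p l by auto
  qed (use p l in auto)
qed

lemma chain_hd_le:
  assumes us: "us \<in> chains T k" and x: "x \<in> set us"
  shows "x = hd us \<or> ball_less T (hd us) x"
proof -
  obtain p where p: "p < k" "x = us ! p"
    using x chainsD(1)[OF us] by (auto simp: in_set_conv_nth)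
  then have h: "hd us = us ! 0"
    using chainsD(1)[OF us] by (subst hd_conv_nth) auto
  show ?thesis
  proof (cases "p = 0")
    case False
    then show ?thesis using chain_less[OF us, of 0 p] p h by auto
  qed (use p h in auto)
qed

lemma ball_le_prefix: "ball_le T x y \<Longrightarrow> prefix (T ! x) (T ! y)"
  by (auto simp: ball_less_def)

lemma chain_prefix_last: "us \<in> chains T k \<Longrightarrow> x \<in> set us \<Longrightarrow> prefix (T ! x) (T ! last us)"
  using chain_le_last ball_le_prefix by blast

lemma chain_hd_prefix: "us \<in> chains T k \<Longrightarrow> x \<in> set us \<Longrightarrow> prefix (T ! hd us) (T ! x)"
  using chain_hd_le ball_le_prefix by blast

text \<open>Comparison is by node and not by \<open>ball_less\<close>, so other balls in the node of
  \<open>v i\<close> may belong to the set. This makes it closed towards the root, and it depends on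
  the last balls only, so that tuples can be counted with these fixed.\<close>

definition shared :: "split_tree \<Rightarrow> 'i set \<Rightarrow> ('i \<Rightarrow> nat) \<Rightarrow> 'i \<Rightarrow> nat set" where
  "shared T I v i = {w \<in> balls T. prefix (T ! w) (T ! v i) \<and> (\<exists>j\<in>I - {i}. prefix (T ! w) (T ! v j))}"

lemma finite_shared: "finite (shared T I v i)"
  by (simp add: shared_def)

lemma shared_prefix_closed: "w \<in> shared T I v i \<Longrightarrow> x \<in> balls T \<Longrightarrow> prefix (T ! x) (T ! w) \<Longrightarrow> x \<in> shared T I v i"
  unfolding shared_def using prefix_order.trans by blast

lemma common_ball_shared:
  assumes f: "f i \<in> chains T k" "f j \<in> chains T k" and ij: "j \<in> I" "i \<noteq> j"
    and x: "x \<in> set (f i)" "x \<in> set (f j)"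
  shows "x \<in> shared T I (\<lambda>i. last (f i)) i"
  using chain_prefix_last[OF f(1) x(1)] chain_prefix_last[OF f(2) x(2)] chainsD(2)[OF f(1)] x ij
  by (auto simp: shared_def)

text \<open>Shared balls lie above another last ball whether or not they belong to its chain. So
  this implies, but is not implied by, that the chains meet pairwise in \<open>u\<close>
  alone.\<close>

definition single_overlap :: "split_tree \<Rightarrow> 'i set \<Rightarrow> ('i \<Rightarrow> nat list) \<Rightarrow> bool" where
  "single_overlap T I f \<longleftrightarrow> (\<exists>u. \<forall>i\<in>I. hd (f i) = u \<and> set (f i) \<inter> shared T I (\<lambda>i. last (f i)) i = {u})"

definition large_overlap :: "split_tree \<Rightarrow> 'i set \<Rightarrow> ('i \<Rightarrow> nat list) \<Rightarrow> bool" where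
  "large_overlap T I f \<longleftrightarrow> (\<forall>i\<in>I. 1 \<le> card (set (f i) \<inter> shared T I (\<lambda>i. last (f i)) i))
    \<and> (\<exists>i\<in>I. 2 \<le> card (set (f i) \<inter> shared T I (\<lambda>i. last (f i)) i))"

lemma not_single_and_large_overlap: "single_overlap T I f \<Longrightarrow> \<not> large_overlap T I f"
  by (auto simp: single_overlap_def large_overlap_def)

text \<open>As a function of \<open>B\<close>, the mixed moment of the pattern indicators of the
  chains \<open>f i\<close>.\<close>

definition pattern_prob :: "split_tree \<Rightarrow> nat list \<Rightarrow> ('i \<Rightarrow> nat list) \<Rightarrow> 'i set \<Rightarrow> real" where
  "pattern_prob T \<alpha> f B =
     order_prob (balls T) (\<lambda>zs. \<forall>i\<in>B. filter (\<lambda>x. x \<in> set (f i)) zs = arrange \<alpha> (f i))"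

lemma pattern_prob_empty: "pattern_prob T \<alpha> f {} = 1"
  by (simp add: pattern_prob_def order_prob_True)

lemma pattern_prob_cong: "(\<And>i. i \<in> B \<Longrightarrow> f i = g i) \<Longrightarrow> pattern_prob T \<alpha> f B = pattern_prob T \<alpha> g B"
  by (simp add: pattern_prob_def)

lemma abs_pattern_prob_le: "\<bar>pattern_prob T \<alpha> f B\<bar> \<le> 1"
proof -
  let ?Z = "{zs \<in> permutations_of_set (balls T). \<forall>i\<in>B. filter (\<lambda>x. x \<in> set (f i)) zs = arrange \<alpha> (f i)}"
  have "card ?Z \<le> card (permutations_of_set (balls T))"
    by (intro card_mono) auto
  also have "\<dots> = fact (card (balls T))" by (rule card_permutations_of_set) simp
  finally have "real (card ?Z) \<le> real (fact (card (balls T)))"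
    by (simp only: of_nat_le_iff)
  then have "real (card ?Z) \<le> fact (card (balls T))" by (simp only: of_nat_fact)
  then have "real (card ?Z) / fact (card (balls T)) \<le> 1"
    by (simp only: divide_le_eq_1 fact_gt_zero simp_thms)
  moreover have "0 \<le> real (card ?Z) / fact (card (balls T))" by simp
  ultimately show ?thesis
    unfolding pattern_prob_def order_prob_def by linarith
qed

lemma cumulant_R:
  assumes \<alpha>: "\<alpha> \<in> permutations_of_set {1..k}" and r: "1 \<le> r"
  shows "cumulant r (measure_pmf (pmf_of_set (labellings T))) (R \<alpha> T)
    = (\<Sum>f\<in>{1..r} \<rightarrow>\<^sub>E chains T k. joint_cumulant (pattern_prob T \<alpha> f) {1..r})"
proof -
  let ?p = "pmf_of_set (labellings T)"
  have len: "length \<alpha> = k"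
    using \<alpha> distinct_card[of \<alpha>] by (auto simp: permutations_of_set_def)
  have fin: "finite (set_pmf ?p)" by (simp add: finite_labellings labellings_nonempty)
  have "measure_pmf.expectation ?p (\<lambda>\<pi>. R \<alpha> T \<pi> ^ card B) = (\<Sum>f\<in>B \<rightarrow>\<^sub>E chains T k. pattern_prob T \<alpha> f B)"
    if B: "B \<subseteq> {1..r}" for B
  proof -
    have finB: "finite B" using B finite_subset by blast
    have "R \<alpha> T \<pi> ^ card B = (\<Sum>f\<in>B \<rightarrow>\<^sub>E chains T k. \<Prod>i\<in>B. of_bool (same_relative_order (map \<pi> (f i)) \<alpha>))" for \<pi>
      unfolding R_def len prod_constant[symmetric] by (intro prod_sum_PiE finB finite_chains)
    then have "measure_pmf.expectation ?p (\<lambda>\<pi>. R \<alpha> T \<pi> ^ card B)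
      = (\<Sum>f\<in>B \<rightarrow>\<^sub>E chains T k. measure_pmf.expectation ?p (\<lambda>\<pi>. \<Prod>i\<in>B. of_bool (same_relative_order (map \<pi> (f i)) \<alpha>)))"
      using fin by (simp add: Bochner_Integration.integral_sum integrable_measure_pmf_finite)
    also have "\<dots> = (\<Sum>f\<in>B \<rightarrow>\<^sub>E chains T k. pattern_prob T \<alpha> f B)"
    proof (rule sum.cong[OF refl])
      fix f assume f: "f \<in> B \<rightarrow>\<^sub>E chains T k"
      show "measure_pmf.expectation ?p (\<lambda>\<pi>. \<Prod>i\<in>B. of_bool (same_relative_order (map \<pi> (f i)) \<alpha>)) = pattern_prob T \<alpha> f B"
        unfolding pattern_prob_def
      proof (rule expectation_prod_same_relative_order[OF \<alpha> finB])
        fix i assume "i \<in> B"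
        then have "f i \<in> chains T k" using f by auto
        then show "length (f i) = k \<and> distinct (f i) \<and> set (f i) \<subseteq> balls T"
          using chainsD by blast
      qed
    qed
    finally show ?thesis .
  qed
  then have "cumulant r (measure_pmf ?p) (R \<alpha> T)
      = joint_cumulant (\<lambda>B. \<Sum>f\<in>B \<rightarrow>\<^sub>E chains T k. pattern_prob T \<alpha> f B) {1..r}"
    unfolding cumulant_eq_joint_cumulant[OF fin r] by (intro joint_cumulant_cong)
  also have "\<dots> = (\<Sum>f\<in>{1..r} \<rightarrow>\<^sub>E chains T k. joint_cumulant (pattern_prob T \<alpha> f) {1..r})"
    using r by (intro joint_cumulant_sum finite_chains pattern_prob_empty pattern_prob_cong) auto
  finally show ?thesis .
qed

text \<open>A ball common to two chains is shared for both, hence equal to \<open>u\<close>. So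
  every mixed moment is \<open>a_coeff\<close> of the number of chains, and \<open>D_coeff\<close>
  has the form of a joint cumulant of these moments.\<close>

lemma joint_cumulant_single_overlap:
  assumes \<alpha>: "\<alpha> \<in> permutations_of_set {1..k}" and k: "1 \<le> k"
    and f: "\<And>i. i \<in> {1..r} \<Longrightarrow> f i \<in> chains T k" and single: "single_overlap T {1..r} f"
  shows "joint_cumulant (pattern_prob T \<alpha> f) {1..r} = D_coeff k \<alpha> r"
proof -
  obtain u where u: "\<And>i. i \<in> {1..r} \<Longrightarrow> hd (f i) = u"
    "\<And>i. i \<in> {1..r} \<Longrightarrow> set (f i) \<inter> shared T {1..r} (\<lambda>i. last (f i)) i = {u}"
    using single by (auto simp: single_overlap_def)
  have "pattern_prob T \<alpha> f B = a_coeff k (card B) \<alpha>" if B: "B \<subseteq> {1..r}" "B \<noteq> {}" for B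
    unfolding pattern_prob_def
  proof (rule order_prob_common_head[OF \<alpha> k _ B(2)])
    show "finite B" using B finite_subset by blast
    fix i assume i: "i \<in> B"
    then have "i \<in> {1..r}" using B by blast
    then show "length (f i) = k \<and> distinct (f i) \<and> set (f i) \<subseteq> balls T \<and> hd (f i) = u"
      using chainsD[OF f] u by blast
    fix j assume j: "j \<in> B" "i \<noteq> j"
    show "set (f i) \<inter> set (f j) = {u}"
      using common_ball_shared[of f i T k j "{1..r}"] u(2)[of i] u(2)[of j] f i j B by blast
  qed simp
  then have "joint_cumulant (pattern_prob T \<alpha> f) {1..r} = joint_cumulant (\<lambda>B. a_coeff k (card B) \<alpha>) {1..r}"
    by (intro joint_cumulant_cong)
  then show ?thesis by (simp add: joint_cumulant_def D_coeff_def)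
qed

lemma joint_cumulant_disjoint_split:
  assumes I: "finite I" "S \<inter> I \<noteq> {}" "I - S \<noteq> {}" and f: "\<And>i. i \<in> I \<Longrightarrow> f i \<in> chains T k"
    and disj: "\<And>i j. i \<in> I \<inter> S \<Longrightarrow> j \<in> I - S \<Longrightarrow> set (f i) \<inter> set (f j) = {}"
  shows "joint_cumulant (pattern_prob T \<alpha> f) I = 0"
proof (rule joint_cumulant_indep[where ?S1.0 = S])
  fix B assume B: "B \<subseteq> I"
  have "B = (B \<inter> S) \<union> (B - S)" by auto
  then have "pattern_prob T \<alpha> f B = pattern_prob T \<alpha> f ((B \<inter> S) \<union> (B - S))" by simp
  also have "\<dots> = pattern_prob T \<alpha> f (B \<inter> S) * pattern_prob T \<alpha> f (B - S)"
    unfolding pattern_prob_def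
  proof (rule order_prob_family_mult)
    fix i assume "i \<in> (B \<inter> S) \<union> (B - S)"
    then show "set (f i) \<subseteq> balls T" using f B chainsD(2) by blast
  next
    fix i j assume "i \<in> B \<inter> S" "j \<in> B - S"
    then show "set (f i) \<inter> set (f j) = {}" using disj B by blast
  qed simp
  finally show "pattern_prob T \<alpha> f B = pattern_prob T \<alpha> f (B \<inter> S) * pattern_prob T \<alpha> f (B - S)" .
qed (use I pattern_prob_empty in auto)

text \<open>Either some chain contains no shared ball and is therefore disjoint from the others, or
  each contains exactly one. In the second case closure towards the root makes that ball the head.
  Chains with different heads are then disjoint, and the heads do differ because the overlap is not
  single. In both cases the tuple splits into two independent groups.\<close>

lemma joint_cumulant_no_overlap:
  assumes I: "finite I" "2 \<le> card I" and k: "1 \<le> k" and f: "\<And>i. i \<in> I \<Longrightarrow> f i \<in> chains T k"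
    and no: "\<not> single_overlap T I f" "\<not> large_overlap T I f"
  shows "joint_cumulant (pattern_prob T \<alpha> f) I = 0"
proof -
  define Sh where "Sh = shared T I (\<lambda>i. last (f i))"
  have cSh: "x \<in> Sh i" if "i \<in> I" "j \<in> I" "i \<noteq> j" "x \<in> set (f i)" "x \<in> set (f j)" for i j x
    unfolding Sh_def using that f common_ball_shared[of f i T k j I x] by blast
  have fin: "finite (set (f i) \<inter> Sh i)" for i by simp
  show ?thesis
  proof (cases "\<exists>i\<in>I. set (f i) \<inter> Sh i = {}")
    case True
    then obtain i where i: "i \<in> I" "set (f i) \<inter> Sh i = {}" by blast
    have "I - {i} \<noteq> {}" using I by (intro remove_nonempty)
    then show ?thesis
      using i f cSh by (intro joint_cumulant_disjoint_split[OF I(1), where S = "{i}"]) auto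
  next
    case False
    then have ge1: "1 \<le> card (set (f i) \<inter> Sh i)" if "i \<in> I" for i
      using that fin by (simp add: Suc_le_eq card_gt_0_iff)
    then have "\<not> 2 \<le> card (set (f i) \<inter> Sh i)" if "i \<in> I" for i
      using that no(2) unfolding large_overlap_def Sh_def by blast
    then have "card (set (f i) \<inter> Sh i) = 1" if "i \<in> I" for i
      using that ge1[OF that] by (simp add: not_less_eq_eq le_antisym numeral_2_eq_2)
    then have single: "\<exists>x. set (f i) \<inter> Sh i = {x}" if "i \<in> I" for i
      using that card_1_singletonE by metis
    have hd: "set (f i) \<inter> Sh i = {hd (f i)}" if i: "i \<in> I" for i
    proof -
      obtain x where x: "set (f i) \<inter> Sh i = {x}" using single[OF i] by blast
      then have x': "x \<in> set (f i)" "x \<in> Sh i" by auto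
      have h: "hd (f i) \<in> set (f i)"
        using chainsD(1)[OF f[OF i]] k by (intro hd_in_set) auto
      have "hd (f i) \<in> Sh i"
        using x'(2) unfolding Sh_def
        by (rule shared_prefix_closed) (use h chainsD(2)[OF f[OF i]] chain_hd_prefix[OF f[OF i] x'(1)] in auto)
      then show ?thesis using x h by auto
    qed
    obtain i0 where i0: "i0 \<in> I" using I by fastforce
    let ?S = "{i. hd (f i) = hd (f i0)}"
    have "I - ?S \<noteq> {}"
    proof
      assume "I - ?S = {}"
      then have "\<forall>i\<in>I. hd (f i) = hd (f i0) \<and> set (f i) \<inter> Sh i = {hd (f i0)}"
        using hd by auto
      then show False using no(1) unfolding single_overlap_def Sh_def by blast
    qed
    moreover have "set (f i) \<inter> set (f j) = {}" if ij: "i \<in> I \<inter> ?S" "j \<in> I - ?S" for i j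
    proof (rule ccontr)
      assume "set (f i) \<inter> set (f j) \<noteq> {}"
      then obtain x where x: "x \<in> set (f i)" "x \<in> set (f j)" by blast
      then have "x \<in> Sh i" "x \<in> Sh j" using cSh[of i j x] cSh[of j i x] ij by auto
      then have "x = hd (f i)" "x = hd (f j)" using hd[of i] hd[of j] x ij by blast+
      then show False using ij by auto
    qed
    ultimately show ?thesis
      using i0 f by (intro joint_cumulant_disjoint_split[OF I(1), where S = ?S]) auto
  qed
qed

lemma cumulant_approx:
  assumes \<alpha>: "\<alpha> \<in> permutations_of_set {1..k}" and k: "1 \<le> k" and r: "2 \<le> r"
  shows "\<bar>cumulant r (measure_pmf (pmf_of_set (labellings T))) (R \<alpha> T)
      - D_coeff k \<alpha> r * real (card {f \<in> {1..r} \<rightarrow>\<^sub>E chains T k. single_overlap T {1..r} f})\<bar>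
    \<le> (\<Sum>\<tau> | partition_on {1..r} \<tau>. fact (card \<tau> - 1))
      * real (card {f \<in> {1..r} \<rightarrow>\<^sub>E chains T k. large_overlap T {1..r} f})"
proof -
  let ?F = "{1..r} \<rightarrow>\<^sub>E chains T k" and ?jc = "\<lambda>f. joint_cumulant (pattern_prob T \<alpha> f) {1..r}"
  let ?G = "{f \<in> ?F. single_overlap T {1..r} f}" and ?B = "{f \<in> ?F. large_overlap T {1..r} f}"
  have fin: "finite ?F" by (intro finite_PiE finite_chains) auto
  have "(\<Sum>f\<in>?F. ?jc f) = (\<Sum>f\<in>?G \<union> ?B. ?jc f)"
  proof (rule sum.mono_neutral_right[OF fin])
    show "\<forall>f\<in>?F - (?G \<union> ?B). ?jc f = 0"
      using r k by (intro ballI joint_cumulant_no_overlap) auto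
  qed auto
  also have "\<dots> = (\<Sum>f\<in>?G. ?jc f) + (\<Sum>f\<in>?B. ?jc f)"
    using fin not_single_and_large_overlap by (intro sum.union_disjoint) auto
  also have "(\<Sum>f\<in>?G. ?jc f) = D_coeff k \<alpha> r * real (card ?G)"
  proof -
    have "?jc f = D_coeff k \<alpha> r" if "f \<in> ?G" for f
      using that by (intro joint_cumulant_single_overlap[OF \<alpha> k]) auto
    then have "(\<Sum>f\<in>?G. ?jc f) = (\<Sum>f\<in>?G. D_coeff k \<alpha> r)" by (rule sum.cong[OF refl])
    then show ?thesis by (simp only: sum_constant mult.commute)
  qed
  finally have "cumulant r (measure_pmf (pmf_of_set (labellings T))) (R \<alpha> T) - D_coeff k \<alpha> r * real (card ?G)
      = (\<Sum>f\<in>?B. ?jc f)"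
    using r by (subst cumulant_R[OF \<alpha>]) auto
  also have "\<bar>\<dots>\<bar> \<le> (\<Sum>f\<in>?B. \<bar>?jc f\<bar>)" by (rule sum_abs)
  also have "\<dots> \<le> (\<Sum>f\<in>?B. (\<Sum>\<tau> | partition_on {1..r} \<tau>. fact (card \<tau> - 1)))"
    by (intro sum_mono abs_joint_cumulant_le abs_pattern_prob_le)
  finally show ?thesis by (simp add: mult.commute)
qed

subsection \<open>Counting chains and tuples of chains\<close>

lemma card_subsets_le:
  assumes "finite D"
  shows "card {A. A \<subseteq> D \<and> card A = j} \<le> card D ^ j"
proof (cases "j \<le> card D")
  case True
  then show ?thesis using n_subsets[OF assms] binomial_le_pow by simp
next
  case False
  then have "{A. A \<subseteq> D \<and> card A = j} = {}"
    using card_mono[OF assms] by auto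
  then show ?thesis by (simp only: card.empty)
qed

lemma finite_subsets: "finite D \<Longrightarrow> finite {A. A \<subseteq> D \<and> P A}"
  by (rule finite_subset[of _ "Pow D"]) auto

text \<open>Choose \<open>t\<close> elements in \<open>N\<close>, then the others in
  \<open>D\<close>; a set with more than \<open>t\<close> elements in \<open>N\<close> arises in
  several ways.\<close>

lemma card_subsets_meeting_le:
  assumes D: "finite D" "finite N" and t: "t \<le> m"
  shows "card {A. A \<subseteq> D \<and> card A = m \<and> t \<le> card (A \<inter> N)} \<le> card N ^ t * card D ^ (m - t)"
proof -
  let ?P = "{B. B \<subseteq> N \<and> card B = t} \<times> {C. C \<subseteq> D \<and> card C = m - t}"
  have "{A. A \<subseteq> D \<and> card A = m \<and> t \<le> card (A \<inter> N)} \<subseteq> (\<lambda>(B, C). B \<union> C) ` ?P"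
  proof
    fix A assume A: "A \<in> {A. A \<subseteq> D \<and> card A = m \<and> t \<le> card (A \<inter> N)}"
    then have fA: "finite A" using D finite_subset by blast
    obtain B where B: "B \<subseteq> A \<inter> N" "card B = t" "finite B"
      using obtain_subset_with_card_n[of t "A \<inter> N"] A by blast
    then have "card (A - B) = m - t" using A fA by (subst card_Diff_subset) auto
    then have "(B, A - B) \<in> ?P" using A B by auto
    moreover have "A = B \<union> (A - B)" using B by auto
    ultimately show "A \<in> (\<lambda>(B, C). B \<union> C) ` ?P" by (metis (mono_tags, lifting) case_prod_conv image_eqI)
  qed
  then have "card {A. A \<subseteq> D \<and> card A = m \<and> t \<le> card (A \<inter> N)} \<le> card ((\<lambda>(B, C). B \<union> C) ` ?P)"
    using D by (intro card_mono finite_imageI finite_cartesian_product finite_subsets)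
  also have "\<dots> \<le> card ?P"
    using D by (intro card_image_le finite_cartesian_product finite_subsets)
  also have "\<dots> \<le> card N ^ t * card D ^ (m - t)"
    unfolding card_cartesian_product using D by (intro mult_mono card_subsets_le) auto
  finally show ?thesis .
qed

definition ancestors :: "split_tree \<Rightarrow> nat \<Rightarrow> nat set" where
  "ancestors T v = {u \<in> balls T. ball_less T u v}"

lemma finite_ancestors: "finite (ancestors T v)" and card_ancestors: "card (ancestors T v) = ball_depth T v"
  by (simp_all add: ancestors_def ball_depth_def)

lemma not_ball_less_self: "\<not> ball_less T v v"
  by (simp add: ball_less_def)

lemma chain_butlast:
  assumes us: "us \<in> chains T k" and k: "1 \<le> k"
  shows "set (butlast us) \<subseteq> ancestors T (last us)" "card (set (butlast us)) = k - 1"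
    "set us = insert (last us) (set (butlast us))"
proof -
  have ne: "us \<noteq> []" using chainsD(1)[OF us] k by auto
  then have eq: "us = butlast us @ [last us]" by simp
  show s: "set us = insert (last us) (set (butlast us))" by (subst eq) simp
  have d: "distinct (butlast us @ [last us])" using chainsD(4)[OF us] ne by simp
  then show "card (set (butlast us)) = k - 1"
    using chainsD(1)[OF us] distinct_card[of "butlast us"] by simp
  show "set (butlast us) \<subseteq> ancestors T (last us)"
  proof
    fix x assume x: "x \<in> set (butlast us)"
    then have "x \<noteq> last us" "x \<in> set us" using d s by auto
    then show "x \<in> ancestors T (last us)"
      using chain_le_last[OF us] chainsD(2)[OF us] by (auto simp: ancestors_def)
  qed
qed

text \<open>The chain is determined by its \<open>k - 1\<close> balls before \<open>v\<close>, a set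
  of ancestors of \<open>v\<close>. Keeping \<open>v\<close> out of \<open>N\<close> places the
  \<open>t\<close> marked balls among them.\<close>

lemma card_chains_last_le:
  assumes k: "1 \<le> k" and N: "finite N" and t: "t = 0 \<or> v \<notin> N"
  shows "card {us \<in> chains T k. last us = v \<and> t \<le> card (set us \<inter> N)}
    \<le> (if t \<le> k - 1 then card N ^ t * ball_depth T v ^ (k - 1 - t) else 0)"
proof -
  let ?C = "{us \<in> chains T k. last us = v \<and> t \<le> card (set us \<inter> N)}"
  let ?A = "{A. A \<subseteq> ancestors T v \<and> card A = k - 1 \<and> t \<le> card (A \<inter> N)}"
  have sub: "(\<lambda>us. set (butlast us)) ` ?C \<subseteq> ?A"
  proof
    fix A assume "A \<in> (\<lambda>us. set (butlast us)) ` ?C"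
    then obtain us where us: "us \<in> chains T k" "last us = v" "t \<le> card (set us \<inter> N)" "A = set (butlast us)" by auto
    have "t \<le> card (A \<inter> N)"
    proof (cases "t = 0")
      case False
      then have "set us \<inter> N = A \<inter> N" using t chain_butlast(3)[OF us(1) k] us by auto
      then show ?thesis using us by simp
    qed simp
    then show "A \<in> ?A" using chain_butlast[OF us(1) k] us by auto
  qed
  have inj: "inj_on (\<lambda>us. set (butlast us)) ?C"
  proof (rule inj_onI)
    fix us us' assume *: "us \<in> ?C" "us' \<in> ?C" "set (butlast us) = set (butlast us')"
    then show "us = us'"
      using chain_butlast(3)[of us T k] chain_butlast(3)[of us' T k] k by (intro chains_eqI[of us T k]) auto
  qed
  have fA: "finite ?A" by (intro finite_subsets finite_ancestors)
  have "card ?C = card ((\<lambda>us. set (butlast us)) ` ?C)" using inj by (simp add: card_image)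
  also have "\<dots> \<le> card ?A" by (rule card_mono[OF fA sub])
  also have "\<dots> \<le> (if t \<le> k - 1 then card N ^ t * ball_depth T v ^ (k - 1 - t) else 0)"
  proof (cases "t \<le> k - 1")
    case True
    then show ?thesis
      using card_subsets_meeting_le[OF finite_ancestors N True, of T v] by (simp add: card_ancestors)
  next
    case False
    have "card (A \<inter> N) \<le> k - 1" if "A \<subseteq> ancestors T v" "card A = k - 1" for A
      using that finite_ancestors finite_subset by (metis card_mono Int_lower1)
    then have "?A = {}" using False by (auto dest: order.trans)
    then show ?thesis using False by (simp only: card.empty if_False)
  qed
  finally show ?thesis .
qed

text \<open>The quotient stands in for \<open>\<Delta> ^ (k - 1 - t)\<close> so that one formula
  covers all \<open>t\<close>: for \<open>t > k - 1\<close> there are no such chains and the right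
  side is still nonnegative.\<close>

lemma real_card_chains_last_le:
  assumes k: "1 \<le> k" and N: "finite N" "real (card N) \<le> X" and t: "t = 0 \<or> v \<notin> N"
    and \<Delta>: "1 \<le> \<Delta>" "real (ball_depth T v) \<le> \<Delta>"
  shows "real (card {us \<in> chains T k. last us = v \<and> t \<le> card (set us \<inter> N)}) \<le> X ^ t * (\<Delta> ^ (k - 1) / \<Delta> ^ t)"
proof (cases "t \<le> k - 1")
  case True
  have "real (card {us \<in> chains T k. last us = v \<and> t \<le> card (set us \<inter> N)})
      \<le> real (card N ^ t * ball_depth T v ^ (k - 1 - t))"
    using card_chains_last_le[OF k N(1) t, of T] True by (simp only: of_nat_le_iff if_True)
  also have "\<dots> = real (card N) ^ t * real (ball_depth T v) ^ (k - 1 - t)" by simp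
  also have "\<dots> \<le> X ^ t * \<Delta> ^ (k - 1 - t)"
    using N \<Delta> by (intro mult_mono power_mono) auto
  also have "\<Delta> ^ (k - 1 - t) = \<Delta> ^ (k - 1) / \<Delta> ^ t"
    using \<Delta> True by (intro power_diff) auto
  finally show ?thesis .
next
  case False
  then have "real (card {us \<in> chains T k. last us = v \<and> t \<le> card (set us \<inter> N)}) = 0"
    using card_chains_last_le[OF k N(1) t, of T] by simp
  moreover have "0 \<le> X ^ t * (\<Delta> ^ (k - 1) / \<Delta> ^ t)"
  proof -
    have "0 \<le> X" using N of_nat_0_le_iff order.trans by blast
    then show ?thesis using \<Delta> by simp
  qed
  ultimately show ?thesis by linarith
qed

section \<open>Configurations behind Upsilon and tuples with a single overlap\<close>

definition common :: "split_tree \<Rightarrow> 'i set \<Rightarrow> ('i \<Rightarrow> nat) \<Rightarrow> nat set" where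
  "common T I v = {u \<in> balls T. \<forall>i\<in>I. ball_le T u (v i)}"

text \<open>Any \<open>k - 2\<close> ancestors are allowed, even two in one node, which no chain
  contains; \<open>regular\<close> excludes those.\<close>

definition middles :: "split_tree \<Rightarrow> nat \<Rightarrow> nat \<Rightarrow> nat set set" where
  "middles T k x = {A. A \<subseteq> ancestors T x \<and> card A = k - 2}"

text \<open>The configurations counted by \<open>Upsilon\<close> for a fixed tuple of balls.\<close>

definition ups_confs :: "split_tree \<Rightarrow> nat \<Rightarrow> 'i set \<Rightarrow> ('i \<Rightarrow> nat) \<Rightarrow> (nat \<times> ('i \<Rightarrow> nat set)) set" where
  "ups_confs T k I v = common T I v \<times> (\<Pi>\<^sub>E i\<in>I. middles T k (v i))"

text \<open>Suffices for sorting \<open>u\<close>, \<open>A i\<close> and \<open>v i\<close> into a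
  chain that starts at \<open>u\<close> and contains no other shared ball. Injectivity enters
  because balls of one node are incomparable.\<close>

definition regular :: "split_tree \<Rightarrow> 'i set \<Rightarrow> ('i \<Rightarrow> nat) \<Rightarrow> ('i \<Rightarrow> nat set) \<Rightarrow> bool" where
  "regular T I v A \<longleftrightarrow> (\<forall>i\<in>I. v i \<notin> shared T I v i \<and> A i \<inter> shared T I v i = {}
    \<and> inj_on (\<lambda>x. T ! x) (A i))"

definition fiber :: "split_tree \<Rightarrow> nat \<Rightarrow> 'i set \<Rightarrow> ('i \<Rightarrow> nat) \<Rightarrow> ('i \<Rightarrow> nat list) set" where
  "fiber T k I v = {f \<in> I \<rightarrow>\<^sub>E chains T k. \<forall>i\<in>I. last (f i) = v i}"

lemma finite_middles: "finite (middles T k x)"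
  unfolding middles_def by (intro finite_subsets finite_ancestors)

lemma finite_ups_confs: "finite I \<Longrightarrow> finite (ups_confs T k I v)"
  unfolding ups_confs_def by (intro finite_cartesian_product finite_PiE finite_middles) (auto simp: common_def)

lemma finite_fiber: "finite I \<Longrightarrow> finite (fiber T k I v)"
  unfolding fiber_def by (rule finite_subset[of _ "I \<rightarrow>\<^sub>E chains T k"]) (auto intro!: finite_PiE finite_chains)

lemma shared_cong: "(\<And>i. i \<in> I \<Longrightarrow> v i = w i) \<Longrightarrow> i \<in> I \<Longrightarrow> shared T I v i = shared T I w i"
  by (auto simp: shared_def)

lemma shared_last: "f \<in> fiber T k I v \<Longrightarrow> i \<in> I \<Longrightarrow> shared T I (\<lambda>i. last (f i)) i = shared T I v i"
  by (intro shared_cong) (auto simp: fiber_def)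

lemma common_subset_shared: "finite I \<Longrightarrow> 2 \<le> card I \<Longrightarrow> i \<in> I \<Longrightarrow> common T I v \<subseteq> shared T I v i"
proof
  fix u assume I: "finite I" "2 \<le> card I" "i \<in> I" and u: "u \<in> common T I v"
  have "I - {i} \<noteq> {}" using I by (intro remove_nonempty)
  then show "u \<in> shared T I v i"
    using u I ball_le_prefix unfolding common_def shared_def by blast
qed

text \<open>A tuple is encoded by its common head and the balls of each chain strictly between head
  and last ball. Chains are determined by their sets, so the encoding is injective.\<close>

lemma card_single_overlap_le:
  assumes I: "finite I" "2 \<le> card I" and k: "2 \<le> k"
  shows "card {f \<in> fiber T k I v. single_overlap T I f} \<le> card (ups_confs T k I v)"
proof -
  let ?G = "{f \<in> fiber T k I v. single_overlap T I f}"
  obtain i0 where i0: "i0 \<in> I" using I by fastforce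
  define \<phi> where "\<phi> f = (hd (f i0), \<lambda>i\<in>I. set (f i) - {hd (f i0), v i})" for f
  have G: "hd (f i) = hd (f i0)" "f i \<in> chains T k" "last (f i) = v i" "hd (f i0) \<in> set (f i)" "v i \<in> set (f i)"
    "hd (f i0) \<noteq> v i"
    if f: "f \<in> ?G" and i: "i \<in> I" for f i
  proof -
    show 1: "hd (f i) = hd (f i0)" using f i i0 by (auto simp: single_overlap_def)
    show 2: "f i \<in> chains T k" and 3: "last (f i) = v i" using f i by (auto simp: fiber_def)
    have len: "length (f i) = k" "distinct (f i)" using chainsD[OF 2] by auto
    then have ne: "f i \<noteq> []" using k by auto
    then show "hd (f i0) \<in> set (f i)" "v i \<in> set (f i)"
      using 1 3 hd_in_set[OF ne] last_in_set[OF ne] by auto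
    have "f i ! 0 \<noteq> f i ! (k - 1)" using len k by (subst nth_eq_iff_index_eq) auto
    then show "hd (f i0) \<noteq> v i"
      using 1 3 ne len by (simp add: hd_conv_nth last_conv_nth)
  qed
  have "inj_on \<phi> ?G"
  proof (rule inj_onI)
    fix f g assume fg: "f \<in> ?G" "g \<in> ?G" "\<phi> f = \<phi> g"
    have h: "hd (f i0) = hd (g i0)" using fg(3) by (simp add: \<phi>_def)
    have "f i = g i" if i: "i \<in> I" for i
    proof (rule chains_eqI)
      have "(\<lambda>i\<in>I. set (f i) - {hd (f i0), v i}) i = (\<lambda>i\<in>I. set (g i) - {hd (g i0), v i}) i"
        using arg_cong[OF fg(3), of "\<lambda>p. snd p i"] unfolding \<phi>_def snd_conv .
      then have "set (f i) - {hd (f i0), v i} = set (g i) - {hd (f i0), v i}" using i h by simp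
      then show "set (f i) = set (g i)"
        using G(4,5)[OF fg(1) i] G(4,5)[OF fg(2) i] h by auto
    qed (use G fg i in auto)
    then show "f = g"
      using fg by (intro PiE_ext[of f I "\<lambda>_. chains T k" g]) (auto simp: fiber_def)
  qed
  moreover have "\<phi> ` ?G \<subseteq> ups_confs T k I v"
  proof
    fix p assume "p \<in> \<phi> ` ?G"
    then obtain f where f: "f \<in> ?G" "p = \<phi> f" by auto
    have "hd (f i0) \<in> common T I v"
      unfolding common_def
    proof (intro CollectI conjI ballI)
      show "hd (f i0) \<in> balls T" using G(2,4)[OF f(1) i0] chainsD(2) by blast
      show "ball_le T (hd (f i0)) (v i)" if "i \<in> I" for i
        using chain_le_last[OF G(2)[OF f(1) that] G(4)[OF f(1) that]] G(3)[OF f(1) that] by simp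
    qed
    moreover have "set (f i) - {hd (f i0), v i} \<in> middles T k (v i)" if i: "i \<in> I" for i
    proof -
      note G' = G[OF f(1) i]
      have "set (f i) - {hd (f i0), v i} \<subseteq> ancestors T (v i)"
        using chain_le_last[OF G'(2)] chainsD(2)[OF G'(2)] G'(3) by (auto simp: ancestors_def)
      moreover have "card (set (f i) - {hd (f i0), v i}) = k - 2"
        using G' chainsD[OF G'(2)] distinct_card[of "f i"] by (subst card_Diff_subset) auto
      ultimately show ?thesis by (simp add: middles_def)
    qed
    ultimately show "p \<in> ups_confs T k I v"
      using f by (auto simp: \<phi>_def ups_confs_def)
  qed
  ultimately show ?thesis
    using card_image[of \<phi> ?G] card_mono[OF finite_ups_confs[OF I(1), of T k v], of "\<phi> ` ?G"] by simp
qed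

text \<open>Prefixes of one node \<open>w\<close> are nested, so sorting by depth gives a chain as
  soon as the nodes are distinct.\<close>

lemma sorted_chain:
  assumes A: "finite A" "A \<subseteq> balls T" and inj: "inj_on (\<lambda>x. T ! x) A"
    and pre: "\<And>x. x \<in> A \<Longrightarrow> prefix (T ! x) w"
  defines "us \<equiv> sort_key (\<lambda>x. length (T ! x)) (sorted_list_of_set A)"
  shows "us \<in> chains T (card A)" "set us = A"
proof -
  show set: "set us = A" using A by (simp add: us_def)
  have d: "distinct us" by (simp add: us_def)
  have "sorted_wrt (ball_less T) us"
    unfolding sorted_wrt_iff_nth_less
  proof (intro allI impI)
    fix p q assume pq: "p < q" "q < length us"
    then have mem: "us ! p \<in> A" "us ! q \<in> A" using set nth_mem[of p us] nth_mem[of q us] by auto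
    have "us ! p \<noteq> us ! q" using d pq by (simp add: nth_eq_iff_index_eq)
    then have ne: "T ! (us ! p) \<noteq> T ! (us ! q)" using inj mem by (auto dest: inj_onD)
    have "sorted (map (\<lambda>x. length (T ! x)) us)" by (simp add: us_def)
    then have "map (\<lambda>x. length (T ! x)) us ! p \<le> map (\<lambda>x. length (T ! x)) us ! q"
      using pq by (intro sorted_nth_mono) auto
    then have "length (T ! (us ! p)) \<le> length (T ! (us ! q))"
      using pq by simp
    then have "prefix (T ! (us ! p)) (T ! (us ! q))"
      using pre mem prefix_length_prefix by blast
    then show "ball_less T (us ! p) (us ! q)"
      using ne by (simp add: ball_less_def strict_prefix_def)
  qed
  moreover have "length us = card A" using set distinct_card[OF d] by simp
  ultimately show "us \<in> chains T (card A)" using set A by (auto simp: chains_def)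
qed

text \<open>Reverses the encoding of \<open>card_single_overlap_le\<close>: the balls are sorted by
  depth, and regularity forces \<open>u\<close> to be the head and the only shared ball.\<close>

lemma card_regular_le:
  assumes I: "finite I" "2 \<le> card I" and k: "2 \<le> k" and v: "\<And>i. i \<in> I \<Longrightarrow> v i \<in> balls T"
  shows "card {(u, A) \<in> ups_confs T k I v. regular T I v A} \<le> card {f \<in> fiber T k I v. single_overlap T I f}"
proof -
  let ?N = "{(u, A) \<in> ups_confs T k I v. regular T I v A}"
  let ?G = "{f \<in> fiber T k I v. single_overlap T I f}"
  define B where "B u A i = insert u (insert (v i) (A i))" for u :: nat and A :: "'a \<Rightarrow> nat set" and i
  define \<psi> where "\<psi> = (\<lambda>(u, A). \<lambda>i\<in>I. sort_key (\<lambda>x. length (T ! x)) (sorted_list_of_set (B u A i)))"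
  obtain i0 where i0: "i0 \<in> I" using I by fastforce
  have N: "\<psi> (u, A) i \<in> chains T k" "set (\<psi> (u, A) i) = B u A i" "last (\<psi> (u, A) i) = v i"
    "hd (\<psi> (u, A) i) = u" "B u A i \<inter> shared T I v i = {u}" "u \<notin> A i" "v i \<notin> A i"
    if uA: "(u, A) \<in> ?N" and i: "i \<in> I" for u A i
  proof -
    have u: "u \<in> common T I v" and A: "A i \<subseteq> ancestors T (v i)" "card (A i) = k - 2"
      using uA i by (auto simp: ups_confs_def middles_def PiE_iff)
    have finA: "finite (A i)" using A finite_ancestors finite_subset by blast
    have reg: "v i \<notin> shared T I v i" "A i \<inter> shared T I v i = {}" "inj_on (\<lambda>x. T ! x) (A i)"
      using uA i by (auto simp: regular_def)
    have uS: "u \<in> shared T I v i" using common_subset_shared[OF I i] u by blast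
    have uv: "ball_less T u (v i)" using u i reg uS by (auto simp: common_def)
    show uA': "u \<notin> A i" using uS reg by blast
    show vA': "v i \<notin> A i" using A not_ball_less_self by (auto simp: ancestors_def)
    show BS: "B u A i \<inter> shared T I v i = {u}" using reg uS by (auto simp: B_def)
    \<comment> \<open>Otherwise \<open>x\<close> would lie in the node of the shared ball
      \<open>u\<close> or above it, and be shared itself, against regularity.\<close>
    have no: "\<not> prefix (T ! x) (T ! u)" if "x \<in> insert (v i) (A i)" for x
    proof
      assume "prefix (T ! x) (T ! u)"
      moreover have "x \<in> balls T" using that A v[OF i] by (auto simp: ancestors_def)
      ultimately have "x \<in> shared T I v i" using uS shared_prefix_closed by metis
      then show False using that reg by blast
    qed
    have Bb: "B u A i \<subseteq> balls T"
      using A v[OF i] u by (auto simp: B_def ancestors_def common_def)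
    have Bp: "prefix (T ! x) (T ! v i)" if "x \<in> B u A i" for x
      using that A uv by (auto simp: B_def ancestors_def ball_less_def)
    have inj: "inj_on (\<lambda>x. T ! x) (B u A i)"
    proof -
      have "T ! v i \<notin> (\<lambda>x. T ! x) ` A i"
        using A by (auto simp: ancestors_def ball_less_def)
      moreover have "T ! u \<notin> (\<lambda>x. T ! x) ` insert (v i) (A i)" using no by force
      ultimately show ?thesis
        unfolding B_def using reg(3) by (simp add: inj_on_insert del: image_insert) auto
    qed
    have uv': "u \<noteq> v i" using uv not_ball_less_self by blast
    have card: "card (B u A i) = k"
      using uA' vA' finA A k uv' by (simp add: B_def)
    have finB: "finite (B u A i)" using finA by (simp add: B_def)
    note sc = sorted_chain[OF finB Bb inj Bp]
    have \<psi>: "\<psi> (u, A) i = sort_key (\<lambda>x. length (T ! x)) (sorted_list_of_set (B u A i))"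
      using i by (simp add: \<psi>_def)
    show ch: "\<psi> (u, A) i \<in> chains T k" and set: "set (\<psi> (u, A) i) = B u A i"
      using sc card unfolding \<psi> by auto
    have ne: "\<psi> (u, A) i \<noteq> []" using set by (auto simp: B_def)
    show "last (\<psi> (u, A) i) = v i"
    proof (rule ccontr)
      assume "last (\<psi> (u, A) i) \<noteq> v i"
      moreover have "v i \<in> set (\<psi> (u, A) i)" unfolding set by (simp add: B_def)
      ultimately have "ball_less T (v i) (last (\<psi> (u, A) i))"
        using chain_le_last[OF ch] by metis
      moreover have "last (\<psi> (u, A) i) \<in> B u A i" using ne set last_in_set by blast
      ultimately show False
        using Bp unfolding ball_less_def by (meson prefix_order.less_le_not_le)
    qed
    show "hd (\<psi> (u, A) i) = u"
    proof (rule ccontr)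
      assume ne': "hd (\<psi> (u, A) i) \<noteq> u"
      moreover have "u \<in> set (\<psi> (u, A) i)" unfolding set by (simp add: B_def)
      ultimately have "prefix (T ! hd (\<psi> (u, A) i)) (T ! u)"
        using chain_hd_prefix[OF ch] by metis
      moreover have "hd (\<psi> (u, A) i) \<in> insert (v i) (A i)"
        using ne set hd_in_set[OF ne] ne' by (auto simp: B_def)
      ultimately show False using no by blast
    qed
  qed
  have "inj_on \<psi> ?N"
  proof (rule inj_onI)
    fix p q assume pq: "p \<in> ?N" "q \<in> ?N" "\<psi> p = \<psi> q"
    obtain u A u' A' where p: "p = (u, A)" and q: "q = (u', A')" by fastforce
    have u: "u = u'"
      using N(4)[of u A i0] N(4)[of u' A' i0] pq p q i0 by simp
    have "A i = A' i" if i: "i \<in> I" for i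
    proof -
      have "B u A i = B u' A' i"
        using N(2)[of u A i] N(2)[of u' A' i] pq p q i by simp
      moreover have "u \<notin> A i" "v i \<notin> A i" "u \<notin> A' i" "v i \<notin> A' i"
        using N(6,7)[OF _ i, of u A] N(6,7)[OF _ i, of u' A'] pq p q u by simp_all
      then have "A i = B u A i - {u, v i}" "A' i = B u A' i - {u, v i}"
        unfolding B_def by auto
      ultimately show ?thesis using u by simp
    qed
    moreover have "A \<in> (\<Pi>\<^sub>E i\<in>I. middles T k (v i))" "A' \<in> (\<Pi>\<^sub>E i\<in>I. middles T k (v i))"
      using pq p q by (auto simp: ups_confs_def)
    ultimately have "A = A'" by (intro PiE_ext) auto
    then show "p = q" using u p q by simp
  qed
  moreover have "\<psi> ` ?N \<subseteq> ?G"
  proof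
    fix f assume "f \<in> \<psi> ` ?N"
    then obtain u A where uA: "(u, A) \<in> ?N" "f = \<psi> (u, A)" by auto
    have "f \<in> extensional I" unfolding uA \<psi>_def by simp
    then have fib: "f \<in> fiber T k I v"
      using N(1,3)[OF uA(1)] uA(2) by (auto simp: fiber_def PiE_def)
    moreover have "single_overlap T I f"
      unfolding single_overlap_def
      using N(2,4,5)[OF uA(1)] uA(2) shared_last[OF fib] by (intro exI[of _ u] ballI) auto
    ultimately show "f \<in> ?G" by blast
  qed
  moreover have "finite ?G" using finite_fiber[OF I(1)] by auto
  ultimately show ?thesis
    using card_image[of \<psi> ?N] card_mono[of ?G "\<psi> ` ?N"] by simp
qed

text \<open>One more than the length of the longest common prefix of the two nodes, because the root
  counts.\<close>

definition prefix_count :: "split_tree \<Rightarrow> nat \<Rightarrow> nat \<Rightarrow> nat" where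
  "prefix_count T v w = card {u. prefix u (T ! v) \<and> prefix u (T ! w)}"

lemma finite_prefixes: "finite {u. prefix u w}"
  using finite_set[of "prefixes w"] by (simp add: set_prefixes_eq)

lemma card_node_le:
  assumes "\<And>u. count_list T u \<le> s"
  shows "card {w \<in> balls T. T ! w = u} \<le> s"
proof -
  have "count_list T u = card {w. w < length T \<and> T ! w = u}"
    by (simp add: count_list_eq_length_filter length_filter_conv_card eq_commute)
  then show ?thesis using assms[of u] by simp
qed

lemma card_shared_le:
  assumes I: "finite I" and s: "\<And>u. count_list T u \<le> s"
  shows "card (shared T I v i) \<le> s * (\<Sum>j\<in>I - {i}. prefix_count T (v i) (v j))"
proof -
  let ?P = "\<lambda>j. {u. prefix u (T ! v i) \<and> prefix u (T ! v j)}"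
  have finP: "finite (?P j)" for j
    by (rule finite_subset[OF _ finite_prefixes[of "T ! v i"]]) auto
  have "shared T I v i \<subseteq> (\<Union>j\<in>I - {i}. \<Union>u\<in>?P j. {w \<in> balls T. T ! w = u})"
    by (auto simp: shared_def)
  then have "card (shared T I v i) \<le> card (\<Union>j\<in>I - {i}. \<Union>u\<in>?P j. {w \<in> balls T. T ! w = u})"
    using I finP by (intro card_mono) auto
  also have "\<dots> \<le> (\<Sum>j\<in>I - {i}. card (\<Union>u\<in>?P j. {w \<in> balls T. T ! w = u}))"
    using I by (intro card_UN_le) auto
  also have "\<dots> \<le> (\<Sum>j\<in>I - {i}. \<Sum>u\<in>?P j. card {w \<in> balls T. T ! w = u})"
    using finP by (intro sum_mono card_UN_le)
  also have "\<dots> \<le> (\<Sum>j\<in>I - {i}. \<Sum>u\<in>?P j. s)"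
    using s by (intro sum_mono card_node_le)
  finally show ?thesis by (simp add: prefix_count_def sum_distrib_left mult.commute)
qed

lemma prefix_count_ge1: "1 \<le> prefix_count T v w"
proof -
  have "finite {u. prefix u (T ! v) \<and> prefix u (T ! w)}"
    by (rule finite_subset[OF _ finite_prefixes[of "T ! v"]]) auto
  then have "card {[]::node} \<le> prefix_count T v w"
    unfolding prefix_count_def by (intro card_mono) auto
  then show ?thesis by simp
qed

text \<open>The sum runs over all ordered pairs so that one number bounds the shared balls for every
  \<open>i\<close>, and is at least \<open>s\<close> if there are two indices.\<close>

definition overlap :: "split_tree \<Rightarrow> nat \<Rightarrow> 'i set \<Rightarrow> ('i \<Rightarrow> nat) \<Rightarrow> real" where
  "overlap T s I v = real s * (\<Sum>(i, j)\<in>Sigma I (\<lambda>i. I - {i}). real (prefix_count T (v i) (v j)))"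

text \<open>Some last ball then lies at or above another one and may itself be the shared ball of
  its chain, so that a shared ball no longer uses up one of the \<open>k - 1\<close> free ancestors.
  Such tuples are rare enough for the trivial bound on chains.\<close>

definition degenerate :: "split_tree \<Rightarrow> 'i set \<Rightarrow> ('i \<Rightarrow> nat) \<Rightarrow> bool" where
  "degenerate T I v \<longleftrightarrow> (\<exists>i\<in>I. v i \<in> shared T I v i)"

text \<open>
  For the tuples of chains ending in \<open>v\<close>, this bounds both the number of those with a large overlap
  and (up to a factor 2) the difference between \<open>ups_confs\<close> and those with a single overlap.
\<close>

definition err :: "split_tree \<Rightarrow> nat \<Rightarrow> nat \<Rightarrow> real \<Rightarrow> 'i set \<Rightarrow> ('i \<Rightarrow> nat) \<Rightarrow> real" where
  "err T s k \<Delta> I v = of_bool (degenerate T I v) * (\<Delta> * \<Delta> ^ (k - 2)) ^ card I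
    + real (card I) * (overlap T s I v * \<Delta> ^ (k - 2)) ^ card I * (overlap T s I v / \<Delta>)"

lemma overlap_eq:
  assumes "finite I"
  shows "overlap T s I v = (\<Sum>i\<in>I. real s * (\<Sum>j\<in>I - {i}. real (prefix_count T (v i) (v j))))"
  unfolding overlap_def sum_distrib_left[symmetric] using assms by (subst sum.Sigma) auto

lemma shared_le_overlap:
  assumes I: "finite I" "i \<in> I" and s: "\<And>u. count_list T u \<le> s"
  shows "real (card (shared T I v i)) \<le> overlap T s I v"
proof -
  have "real (card (shared T I v i)) \<le> real (s * (\<Sum>j\<in>I - {i}. prefix_count T (v i) (v j)))"
    using card_shared_le[OF I(1) s, of v i] by (simp only: of_nat_le_iff)
  also have "\<dots> \<le> overlap T s I v"
    unfolding overlap_eq[OF I(1)] using I by (subst sum.remove[OF I]) (auto intro!: sum_nonneg mult_nonneg_nonneg)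
  finally show ?thesis .
qed

lemma overlap_ge:
  assumes I: "finite I" "2 \<le> card I"
  shows "real s \<le> overlap T s I v"
proof -
  obtain i where i: "i \<in> I" using I by fastforce
  have "I - {i} \<noteq> {}" using I by (intro remove_nonempty)
  then obtain j where j: "j \<in> I - {i}" by blast
  have "1 \<le> real (prefix_count T (v i) (v j))" using prefix_count_ge1[of T "v i" "v j"] by linarith
  also have "\<dots> \<le> (\<Sum>j\<in>I - {i}. real (prefix_count T (v i) (v j)))"
    using I j by (intro member_le_sum) auto
  finally have "real s * 1 \<le> real s * (\<Sum>j\<in>I - {i}. real (prefix_count T (v i) (v j)))"
    by (rule mult_left_mono) simp
  also have "\<dots> \<le> overlap T s I v"
    unfolding overlap_eq[OF I(1)] using i I by (intro member_le_sum) (auto intro!: sum_nonneg mult_nonneg_nonneg)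
  finally show ?thesis by simp
qed

lemma card_PiE_le:
  assumes "finite I" and "\<And>i. i \<in> I \<Longrightarrow> real (card (F i)) \<le> b i"
  shows "real (card (Pi\<^sub>E I F)) \<le> (\<Prod>i\<in>I. b i)"
proof -
  have "real (card (Pi\<^sub>E I F)) = (\<Prod>i\<in>I. real (card (F i)))"
    using assms(1) by (simp add: card_PiE)
  also have "\<dots> \<le> (\<Prod>i\<in>I. b i)" using assms(2) by (intro prod_mono) auto
  finally show ?thesis .
qed

lemma prod_one_factor:
  fixes c d :: real
  assumes "finite I" "i0 \<in> I"
  shows "(\<Prod>i\<in>I. if i = i0 then c * d else c) = c ^ card I * d"
proof -
  have "(\<Prod>i\<in>I. if i = i0 then c * d else c) = (\<Prod>i\<in>I. c * (if i = i0 then d else 1))"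
    by (intro prod.cong) auto
  also have "\<dots> = c ^ card I * d" using assms by (simp add: prod.distrib prod.delta)
  finally show ?thesis .
qed

text \<open>Choose an element, then one of the at most \<open>s\<close> balls of its node, then the
  remaining \<open>m - 2\<close> elements.\<close>

lemma card_same_node_subsets_le:
  assumes D: "finite D" "D \<subseteq> balls T" and s: "\<And>u. count_list T u \<le> s"
  shows "card {A. A \<subseteq> D \<and> card A = m \<and> \<not> inj_on (\<lambda>x. T ! x) A} \<le> (if 2 \<le> m then card D * s * card D ^ (m - 2) else 0)"
proof -
  let ?S = "{A. A \<subseteq> D \<and> card A = m \<and> \<not> inj_on (\<lambda>x. T ! x) A}"
  let ?C = "{C. C \<subseteq> D \<and> card C = m - 2}"
  have two: "\<exists>x y. x \<in> A \<and> y \<in> A \<and> x \<noteq> y \<and> T ! x = T ! y" if "A \<in> ?S" for A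
    using that by (auto simp: inj_on_def)
  show ?thesis
  proof (cases "2 \<le> m")
    case True
    have "?S \<subseteq> (\<Union>x\<in>D. \<Union>y\<in>{y \<in> balls T. T ! y = T ! x}. (\<lambda>C. insert x (insert y C)) ` ?C)"
    proof
      fix A assume A: "A \<in> ?S"
      then obtain x y where xy: "x \<in> A" "y \<in> A" "x \<noteq> y" "T ! x = T ! y" using two by blast
      have "A - {x, y} \<in> ?C" using A xy D by (auto simp: card_Diff_subset)
      moreover have "A = insert x (insert y (A - {x, y}))" using xy by auto
      moreover have "x \<in> D" "y \<in> {y \<in> balls T. T ! y = T ! x}" using A xy D by auto
      ultimately show "A \<in> (\<Union>x\<in>D. \<Union>y\<in>{y \<in> balls T. T ! y = T ! x}. (\<lambda>C. insert x (insert y C)) ` ?C)"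
        by blast
    qed
    then have "card ?S \<le> card (\<Union>x\<in>D. \<Union>y\<in>{y \<in> balls T. T ! y = T ! x}. (\<lambda>C. insert x (insert y C)) ` ?C)"
      using D finite_subsets[OF D(1)] by (intro card_mono) auto
    also have "\<dots> \<le> (\<Sum>x\<in>D. card (\<Union>y\<in>{y \<in> balls T. T ! y = T ! x}. (\<lambda>C. insert x (insert y C)) ` ?C))"
      using D by (intro card_UN_le)
    also have "\<dots> \<le> (\<Sum>x\<in>D. s * card D ^ (m - 2))"
    proof (rule sum_mono)
      fix x assume "x \<in> D"
      have "card (\<Union>y\<in>{y \<in> balls T. T ! y = T ! x}. (\<lambda>C. insert x (insert y C)) ` ?C)
        \<le> (\<Sum>y\<in>{y \<in> balls T. T ! y = T ! x}. card ((\<lambda>C. insert x (insert y C)) ` ?C))"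
        by (intro card_UN_le) auto
      also have "\<dots> \<le> (\<Sum>y\<in>{y \<in> balls T. T ! y = T ! x}. card D ^ (m - 2))"
        by (intro sum_mono order.trans[OF card_image_le card_subsets_le] finite_subsets D)
      also have "\<dots> \<le> s * card D ^ (m - 2)"
        using card_node_le[OF s] by simp
      finally show "card (\<Union>y\<in>{y \<in> balls T. T ! y = T ! x}. (\<lambda>C. insert x (insert y C)) ` ?C) \<le> s * card D ^ (m - 2)" .
    qed
    finally show ?thesis using True by simp
  next
    case False
    have "?S = {}"
    proof (rule equals0I)
      fix A assume A: "A \<in> ?S"
      then obtain x y where xy: "x \<in> A" "y \<in> A" "x \<noteq> y" using two by blast
      have "finite A" using A D finite_subset by blast
      then have "card {x, y} \<le> card A" using xy by (intro card_mono) auto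
      then show False using A False xy by simp
    qed
    then show ?thesis using False by (simp only: card.empty if_False)
  qed
qed

section \<open>Error bounds for fixed last balls\<close>

context
  fixes T :: split_tree and s k :: nat and \<Delta> :: real and I :: "'i set"
  assumes s: "1 \<le> s" "\<And>u. count_list T u \<le> s" and k: "2 \<le> k"
    and \<Delta>: "1 \<le> \<Delta>" "\<And>v. v \<in> balls T \<Longrightarrow> real (ball_depth T v) \<le> \<Delta>"
    and I: "finite I" "2 \<le> card I"
begin

private lemma overlap1: "1 \<le> overlap T s I v" and overlap_s: "real s \<le> overlap T s I v"
  using overlap_ge[OF I, of s T v] s(1) by auto

private lemma power_Delta: "\<Delta> ^ (k - 1) = \<Delta> * \<Delta> ^ (k - 2)"
  using k by (metis Suc_1 Suc_diff_le Suc_leD diff_Suc_Suc plus_1_eq_Suc power_Suc diff_Suc_1 le_add_diff_inverse numeral_2_eq_2)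

text \<open>Outside the degenerate case each chain has a shared ball, with at most
  \<open>overlap\<close> choices, and \<open>k - 2\<close> free ancestors. A second shared ball in
  chain \<open>i0\<close> trades a factor \<open>\<Delta>\<close> for \<open>overlap\<close>, and
  \<open>card I\<close> counts the choices of \<open>i0\<close>.\<close>

lemma large_overlap_le:
  assumes v: "v \<in> I \<rightarrow> balls T"
  shows "real (card {f \<in> fiber T k I v. large_overlap T I f}) \<le> err T s k \<Delta> I v"
proof -
  let ?B = "{f \<in> fiber T k I v. large_overlap T I f}"
  let ?Y = "\<Delta> ^ (k - 2)" and ?X = "overlap T s I v"
  define CS where "CS t i = {us \<in> chains T k. last us = v i \<and> t \<le> card (set us \<inter> shared T I v i)}" for t i
  have finCS: "finite (CS t i)" for t i unfolding CS_def using finite_chains by auto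
  have CS: "real (card (CS t i)) \<le> ?X ^ t * (\<Delta> * ?Y / \<Delta> ^ t)"
    if "i \<in> I" "t = 0 \<or> v i \<notin> shared T I v i" for t i
    unfolding CS_def power_Delta[symmetric] using that v k \<Delta> s I
    by (intro real_card_chains_last_le finite_shared shared_le_overlap) auto
  have B: "f i \<in> CS 1 i" "\<exists>i\<in>I. f i \<in> CS 2 i" if f: "f \<in> ?B" and i: "i \<in> I" for f i
  proof -
    have fib: "f \<in> fiber T k I v" and lo: "large_overlap T I f" using f by auto
    have *: "f i \<in> chains T k" "last (f i) = v i" if "i \<in> I" for i
      using fib that by (auto simp: fiber_def)
    show "f i \<in> CS 1 i" "\<exists>i\<in>I. f i \<in> CS 2 i"
      using lo * shared_last[OF fib] i unfolding large_overlap_def CS_def by auto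
  qed
  have ext: "f \<in> extensional I" if "f \<in> ?B" for f using that by (auto simp: fiber_def PiE_def)
  show ?thesis
  proof (cases "degenerate T I v")
    case True
    have "?B \<subseteq> (\<Pi>\<^sub>E i\<in>I. CS 0 i)"
    proof
      fix f assume f: "f \<in> ?B"
      have "f i \<in> CS 0 i" if "i \<in> I" for i
        using B(1)[OF f that] by (auto simp: CS_def)
      then show "f \<in> (\<Pi>\<^sub>E i\<in>I. CS 0 i)" using ext[OF f] by (auto simp: PiE_def)
    qed
    then have "real (card ?B) \<le> real (card (\<Pi>\<^sub>E i\<in>I. CS 0 i))"
      using I finCS by (simp add: card_mono finite_PiE)
    also have "\<dots> \<le> (\<Prod>i\<in>I. \<Delta> * ?Y)"
      using CS[of _ 0] by (intro card_PiE_le[OF I(1)]) auto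
    also have "\<dots> = (\<Delta> * ?Y) ^ card I" by simp
    also have "\<dots> \<le> err T s k \<Delta> I v"
      using True overlap1[of v] \<Delta> by (simp add: err_def)
    finally show ?thesis .
  next
    case False
    then have nd: "v i \<notin> shared T I v i" if "i \<in> I" for i using that by (auto simp: degenerate_def)
    let ?P = "\<lambda>i0. \<Pi>\<^sub>E i\<in>I. CS (if i = i0 then 2 else 1) i"
    have "?B \<subseteq> (\<Union>i0\<in>I. ?P i0)"
    proof
      fix f assume f: "f \<in> ?B"
      obtain i where "i \<in> I" using I by fastforce
      then obtain i0 where i0: "i0 \<in> I" "f i0 \<in> CS 2 i0" using B(2)[OF f] by blast
      have "f i \<in> CS (if i = i0 then 2 else 1) i" if "i \<in> I" for i
        using B(1)[OF f that] i0 by auto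
      then have "f \<in> ?P i0" using ext[OF f] by (auto simp: PiE_def)
      then show "f \<in> (\<Union>i0\<in>I. ?P i0)" using i0 by blast
    qed
    then have "card ?B \<le> card (\<Union>i0\<in>I. ?P i0)"
      using I finCS by (intro card_mono) (auto intro!: finite_PiE)
    also have "\<dots> \<le> (\<Sum>i0\<in>I. card (?P i0))" by (rule card_UN_le[OF I(1)])
    finally have "real (card ?B) \<le> real (\<Sum>i0\<in>I. card (?P i0))" by (rule of_nat_mono)
    also have "\<dots> = (\<Sum>i0\<in>I. real (card (?P i0)))" by (rule of_nat_sum)
    also have "\<dots> \<le> (\<Sum>i0\<in>I. (?X * ?Y) ^ card I * (?X / \<Delta>))"
    proof (rule sum_mono)
      fix i0 assume i0: "i0 \<in> I"
      have "real (card (?P i0)) \<le> (\<Prod>i\<in>I. if i = i0 then ?X * ?Y * (?X / \<Delta>) else ?X * ?Y)"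
      proof (rule card_PiE_le[OF I(1)])
        fix i assume i: "i \<in> I"
        show "real (card (CS (if i = i0 then 2 else 1) i)) \<le> (if i = i0 then ?X * ?Y * (?X / \<Delta>) else ?X * ?Y)"
        proof (cases "i = i0")
          case True
          have "?X ^ 2 * (\<Delta> * ?Y / \<Delta> ^ 2) = ?X * ?Y * (?X / \<Delta>)"
            using \<Delta>(1) by (simp add: power2_eq_square)
          then show ?thesis using CS[OF i, of 2] nd[OF i] True by simp
        next
          case False
          have "?X ^ 1 * (\<Delta> * ?Y / \<Delta> ^ 1) = ?X * ?Y" using \<Delta>(1) by simp
          then show ?thesis using CS[OF i, of 1] nd[OF i] False by (simp only: if_False simp_thms)
        qed
      qed
      also have "\<dots> = (?X * ?Y) ^ card I * (?X / \<Delta>)" by (rule prod_one_factor[OF I(1) i0])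
      finally show "real (card (?P i0)) \<le> (?X * ?Y) ^ card I * (?X / \<Delta>)" .
    qed
    also have "\<dots> = err T s k \<Delta> I v" using False by (simp add: err_def)
    finally show ?thesis .
  qed
qed

text \<open>What has to be bounded are the configurations that are not regular. Outside the
  degenerate case some \<open>A i0\<close> contains a shared ball or two balls of one node. Either
  event trades a factor \<open>\<Delta>\<close> for at most \<open>overlap\<close>; the two together
  give the 2.\<close>

lemma ups_confs_le:
  assumes v: "v \<in> I \<rightarrow> balls T"
  shows "real (card (ups_confs T k I v))
    \<le> real (card {f \<in> fiber T k I v. single_overlap T I f}) + 2 * err T s k \<Delta> I v"
proof -
  let ?U = "ups_confs T k I v"
  let ?N = "{(u, A) \<in> ?U. regular T I v A}"
  let ?Y = "\<Delta> ^ (k - 2)" and ?X = "overlap T s I v"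
  have finU: "finite ?U" by (rule finite_ups_confs[OF I(1)])
  have depth: "real (ball_depth T (v i)) \<le> \<Delta>" if "i \<in> I" for i using \<Delta>(2) v that by auto
  have mid: "real (card (middles T k (v i))) \<le> ?Y" if "i \<in> I" for i
  proof -
    have "real (card (middles T k (v i))) \<le> real (ball_depth T (v i) ^ (k - 2))"
      using card_subsets_le[OF finite_ancestors, of T "v i" "k - 2"]
      unfolding middles_def card_ancestors by (simp only: of_nat_le_iff)
    also have "\<dots> \<le> ?Y" using depth[OF that] by (simp add: power_mono)
    finally show ?thesis .
  qed
  have X1: "1 \<le> ?X" by (rule overlap1)
  have "real (card (?U - ?N)) \<le> 2 * err T s k \<Delta> I v"
  proof (cases "degenerate T I v")
    case True
    obtain i where i: "i \<in> I" using I by fastforce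
    \<comment> \<open>Common ancestors may include \<open>v i\<close> itself; this one extra ball is
      why the bound below is \<open>2 * \<Delta>\<close>.\<close>
    have "common T I v \<subseteq> insert (v i) (ancestors T (v i))"
      using i by (auto simp: common_def ancestors_def)
    then have "card (common T I v) \<le> card (insert (v i) (ancestors T (v i)))"
      using finite_ancestors by (intro card_mono) auto
    also have "\<dots> \<le> Suc (ball_depth T (v i))"
      using card_insert_le_m1[of "Suc (ball_depth T (v i))"] by (simp add: card_ancestors finite_ancestors card_insert_if)
    finally have "real (card (common T I v)) \<le> 2 * \<Delta>"
      using depth[OF i] \<Delta>(1) by linarith
    moreover have "real (card (\<Pi>\<^sub>E i\<in>I. middles T k (v i))) \<le> ?Y ^ card I"
      using card_PiE_le[OF I(1), of "\<lambda>i. middles T k (v i)" "\<lambda>_. ?Y"] mid by simp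
    ultimately have "real (card ?U) \<le> 2 * \<Delta> * ?Y ^ card I"
      unfolding ups_confs_def card_cartesian_product of_nat_mult using \<Delta> by (intro mult_mono) auto
    also have "\<dots> \<le> 2 * \<Delta> ^ card I * ?Y ^ card I"
    proof -
      have "\<Delta> ^ 1 \<le> \<Delta> ^ card I" using \<Delta>(1) I by (intro power_increasing) auto
      then show ?thesis using \<Delta> by (intro mult_right_mono) auto
    qed
    also have "\<dots> \<le> 2 * err T s k \<Delta> I v"
      using True X1 \<Delta> by (simp add: err_def power_mult_distrib)
    finally have "real (card ?U) \<le> 2 * err T s k \<Delta> I v" .
    moreover have "card (?U - ?N) \<le> card ?U" using finU by (intro card_mono) auto
    ultimately show ?thesis by linarith
  next
    case False
    then have nd: "v i \<notin> shared T I v i" if "i \<in> I" for i using that by (auto simp: degenerate_def)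
    define E where "E i = {A. A \<subseteq> ancestors T (v i) \<and> card A = k - 2 \<and> 1 \<le> card (A \<inter> shared T I v i)}
      \<union> {A. A \<subseteq> ancestors T (v i) \<and> card A = k - 2 \<and> \<not> inj_on (\<lambda>x. T ! x) A}" for i
    have finE: "finite (E i)" for i
      unfolding E_def using finite_subsets[OF finite_ancestors] by auto
    have E: "real (card (E i)) \<le> ?Y * (2 * ?X / \<Delta>)" if i: "i \<in> I" for i
    proof -
      let ?d = "ball_depth T (v i)" and ?m = "k - 2"
      have "card (E i) \<le> card {A. A \<subseteq> ancestors T (v i) \<and> card A = ?m \<and> 1 \<le> card (A \<inter> shared T I v i)}
        + card {A. A \<subseteq> ancestors T (v i) \<and> card A = ?m \<and> \<not> inj_on (\<lambda>x. T ! x) A}"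
        unfolding E_def by (rule card_Un_le)
      moreover have "real (card {A. A \<subseteq> ancestors T (v i) \<and> card A = ?m \<and> 1 \<le> card (A \<inter> shared T I v i)}) \<le> ?X * ?Y / \<Delta>"
      proof (cases "1 \<le> ?m")
        case True
        have "real (card {A. A \<subseteq> ancestors T (v i) \<and> card A = ?m \<and> 1 \<le> card (A \<inter> shared T I v i)})
            \<le> real (card (shared T I v i) ^ 1 * ?d ^ (?m - 1))"
          using card_subsets_meeting_le[OF finite_ancestors finite_shared True, of T "v i" T I v i]
          unfolding card_ancestors by (simp only: of_nat_le_iff)
        also have "\<dots> = real (card (shared T I v i)) * real ?d ^ (?m - 1)" by simp
        also have "\<dots> \<le> ?X * \<Delta> ^ (?m - 1)"
          using depth[OF i] shared_le_overlap[OF I(1) i s(2), of v] X1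
          by (intro mult_mono power_mono) auto
        also have "\<Delta> ^ (?m - 1) = ?Y / \<Delta>" using power_diff[of \<Delta> 1 ?m] True \<Delta> by simp
        finally show ?thesis by simp
      next
        case F: False
        have "A \<inter> shared T I v i = {}" if "A \<subseteq> ancestors T (v i)" "card A = ?m" for A
          using that F finite_subset[OF that(1) finite_ancestors] by simp
        then have "{A. A \<subseteq> ancestors T (v i) \<and> card A = ?m \<and> 1 \<le> card (A \<inter> shared T I v i)} = {}" by auto
        then show ?thesis using X1 \<Delta> by (simp only: card.empty) simp
      qed
      moreover have "real (card {A. A \<subseteq> ancestors T (v i) \<and> card A = ?m \<and> \<not> inj_on (\<lambda>x. T ! x) A}) \<le> ?X * ?Y / \<Delta>"
      proof -
        have sub: "ancestors T (v i) \<subseteq> balls T" by (auto simp: ancestors_def)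
        note le = card_same_node_subsets_le[OF finite_ancestors sub s(2), of ?m]
        show ?thesis
        proof (cases "2 \<le> ?m")
          case True
          have "real (card {A. A \<subseteq> ancestors T (v i) \<and> card A = ?m \<and> \<not> inj_on (\<lambda>x. T ! x) A})
            \<le> real (?d * s * ?d ^ (?m - 2))"
            using le True unfolding card_ancestors by (simp only: of_nat_le_iff if_True)
          also have "\<dots> = real s * real ?d ^ (?m - 1)"
          proof -
            have "?m - 1 = Suc (?m - 2)" using True by simp
            then show ?thesis by simp
          qed
          also have "\<dots> \<le> ?X * \<Delta> ^ (?m - 1)"
            using depth[OF i] overlap_s[of v] X1 by (intro mult_mono power_mono) auto
          also have "\<Delta> ^ (?m - 1) = ?Y / \<Delta>" using power_diff[of \<Delta> 1 ?m] True \<Delta> by simp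
          finally show ?thesis by simp
        next
          case F: False
          then have "real (card {A. A \<subseteq> ancestors T (v i) \<and> card A = ?m \<and> \<not> inj_on (\<lambda>x. T ! x) A}) = 0"
            using le by simp
          then show ?thesis using X1 \<Delta> by simp
        qed
      qed
      ultimately show ?thesis by (simp add: field_simps)
    qed
    let ?P = "\<lambda>i0. \<Pi>\<^sub>E i\<in>I. if i = i0 then E i else middles T k (v i)"
    have "?U - ?N \<subseteq> common T I v \<times> (\<Union>i0\<in>I. ?P i0)"
    proof
      fix p assume p: "p \<in> ?U - ?N"
      obtain u A where uA: "p = (u, A)" by force
      have u: "u \<in> common T I v" and A: "A \<in> (\<Pi>\<^sub>E i\<in>I. middles T k (v i))"
        using p uA by (auto simp: ups_confs_def)
      have "\<not> regular T I v A" using p uA by auto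
      then obtain i0 where i0: "i0 \<in> I" "A i0 \<inter> shared T I v i0 \<noteq> {} \<or> \<not> inj_on (\<lambda>x. T ! x) (A i0)"
        using nd by (auto simp: regular_def)
      have "A i0 \<in> E i0"
      proof -
        have "A i0 \<subseteq> ancestors T (v i0)" "card (A i0) = k - 2"
          using A i0(1) by (auto simp: middles_def PiE_iff)
        moreover have "1 \<le> card (A i0 \<inter> shared T I v i0)" if "A i0 \<inter> shared T I v i0 \<noteq> {}"
        proof -
          have "finite (A i0 \<inter> shared T I v i0)" by (intro finite_Int disjI2 finite_shared)
          then show ?thesis using that by (simp add: Suc_le_eq card_gt_0_iff)
        qed
        ultimately show ?thesis using i0(2) by (auto simp: E_def)
      qed
      then have "A \<in> ?P i0" using A by (auto simp: PiE_iff)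
      then show "p \<in> common T I v \<times> (\<Union>i0\<in>I. ?P i0)" using u uA i0 by blast
    qed
    then have "card (?U - ?N) \<le> card (common T I v \<times> (\<Union>i0\<in>I. ?P i0))"
      using I finE finite_middles
      by (intro card_mono finite_cartesian_product finite_UN_I finite_PiE) (auto simp: common_def)
    also have "\<dots> = card (common T I v) * card (\<Union>i0\<in>I. ?P i0)" by (rule card_cartesian_product)
    also have "\<dots> \<le> card (common T I v) * (\<Sum>i0\<in>I. card (?P i0))"
      by (intro mult_left_mono card_UN_le[OF I(1)]) auto
    finally have "real (card (?U - ?N)) \<le> real (card (common T I v) * (\<Sum>i0\<in>I. card (?P i0)))"
      by (rule of_nat_mono)
    also have "\<dots> = real (card (common T I v)) * (\<Sum>i0\<in>I. real (card (?P i0)))"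
      by (simp only: of_nat_mult of_nat_sum)
    also have "\<dots> \<le> ?X * (\<Sum>i0\<in>I. ?Y ^ card I * (2 * ?X / \<Delta>))"
    proof (intro mult_mono sum_mono)
      obtain i where i: "i \<in> I" using I by fastforce
      have "card (common T I v) \<le> card (shared T I v i)"
        by (intro card_mono finite_shared common_subset_shared[OF I i])
      then show "real (card (common T I v)) \<le> ?X"
        using shared_le_overlap[OF I(1) i s(2), of v] by linarith
      fix i0 assume i0: "i0 \<in> I"
      have "real (card (?P i0)) \<le> (\<Prod>i\<in>I. if i = i0 then ?Y * (2 * ?X / \<Delta>) else ?Y)"
        using E mid by (intro card_PiE_le[OF I(1)]) auto
      also have "\<dots> = ?Y ^ card I * (2 * ?X / \<Delta>)" by (rule prod_one_factor[OF I(1) i0])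
      finally show "real (card (?P i0)) \<le> ?Y ^ card I * (2 * ?X / \<Delta>)" .
    qed (use X1 in \<open>auto intro!: sum_nonneg\<close>)
    also have "\<dots> = 2 * (real (card I) * (?X ^ 1 * ?Y ^ card I) * (?X / \<Delta>))" by simp
    \<comment> \<open>The common ancestors account for a single factor \<open>overlap\<close>. As it
      is at least 1, it may be raised to the power \<open>card I\<close> to match
      \<open>err\<close>.\<close>
    also have "\<dots> \<le> 2 * (real (card I) * (?X ^ card I * ?Y ^ card I) * (?X / \<Delta>))"
    proof -
      have "?X ^ 1 \<le> ?X ^ card I" using X1 I by (intro power_increasing) auto
      then show ?thesis using X1 \<Delta> by (intro mult_left_mono mult_right_mono) auto
    qed
    also have "\<dots> = 2 * err T s k \<Delta> I v" using False by (simp add: err_def power_mult_distrib)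
    finally show ?thesis .
  qed
  moreover have "real (card ?N) \<le> real (card {f \<in> fiber T k I v. single_overlap T I f})"
    using card_regular_le[OF I k, of v T] v by (simp only: of_nat_le_iff) auto
  moreover have "card ?U = card ?N + card (?U - ?N)"
  proof -
    have "?N \<subseteq> ?U" by auto
    then show ?thesis using finU finite_subset[of ?N ?U] card_mono[of ?U ?N] by (simp add: card_Diff_subset)
  qed
  ultimately show ?thesis by linarith
qed

end


text \<open>Lists of balls are re-indexed by \<open>{1..r}\<close>, the set whose partitions occur
  in \<open>D_coeff\<close>; hence the shift by one.\<close>

lemma Upsilon_eq_sum_confs:
  "Upsilon r k T = (\<Sum>v\<in>{1..r} \<rightarrow>\<^sub>E balls T. real (card (ups_confs T k {1..r} v)))"
  unfolding Upsilon_def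
proof (rule sum.reindex_bij_witness[where j = "\<lambda>vs. \<lambda>i\<in>{1..r}. vs ! (i - 1)" and i = "\<lambda>v. map v [1..<Suc r]"], goal_cases)
  case (1 vs)
  then show ?case by (auto intro!: nth_equalityI simp: nth_append simp del: upt_Suc)
next
  case (2 vs)
  then show ?case by (auto simp: subset_iff)
next
  case (3 v)
  then show ?case
    by (auto simp: fun_eq_iff PiE_iff extensional_def simp del: upt_Suc)
next
  case (4 v)
  then show ?case by (auto simp: PiE_iff simp del: upt_Suc)
next
  case (5 vs)
  let ?v = "\<lambda>i\<in>{1..r}. vs ! (i - 1)"
  have len: "length vs = r" using 5 by auto
  have set: "(\<forall>v\<in>set vs. P v) \<longleftrightarrow> (\<forall>i\<in>{1..r}. P (?v i))" for P
  proof
    assume *: "\<forall>i\<in>{1..r}. P (?v i)"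
    show "\<forall>v\<in>set vs. P v"
    proof
      fix v assume "v \<in> set vs"
      then obtain p where p: "p < r" "v = vs ! p" using len by (auto simp: in_set_conv_nth)
      then show "P v" using *[rule_format, of "Suc p"] by simp
    qed
  next
    assume *: "\<forall>v\<in>set vs. P v"
    show "\<forall>i\<in>{1..r}. P (?v i)"
    proof
      fix i assume "i \<in> {1..r}"
      then show "P (?v i)" using * len nth_mem[of "i - 1" vs] by auto
    qed
  qed
  have "common T {1..r} ?v = {u \<in> balls T. \<forall>v\<in>set vs. ball_le T u v}"
    unfolding common_def set ..
  then have "card (common T {1..r} ?v) = common_ancestors T vs"
    by (simp add: common_ancestors_def)
  moreover have "(\<Prod>i\<in>{1..r}. card (middles T k (?v i))) = (\<Prod>i<r. ball_depth T (vs ! i) choose (k - 2))"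
  proof (rule prod.reindex_bij_witness[where i = Suc and j = "\<lambda>i. i - 1"], goal_cases)
    case (5 i)
    then show ?case
      using n_subsets[OF finite_ancestors, of T _ "k - 2"] by (auto simp: middles_def card_ancestors)
  qed auto
  ultimately show ?case
    by (simp add: ups_confs_def card_cartesian_product card_PiE flip: of_nat_prod)
qed

section \<open>Summing the error over the last balls\<close>

lemma sum_two_coordinates:
  fixes h :: "'c \<Rightarrow> 'c \<Rightarrow> real"
  assumes I: "finite I" and ij: "i \<in> I" "j \<in> I" "i \<noteq> j"
  shows "(\<Sum>v\<in>I \<rightarrow>\<^sub>E C. h (v i) (v j)) = real (card C) ^ (card I - 2) * (\<Sum>x\<in>C. \<Sum>y\<in>C. h x y)"
proof -
  have "(\<Sum>v\<in>I \<rightarrow>\<^sub>E C. h (v i) (v j)) = (\<Sum>v\<in>I \<rightarrow>\<^sub>E C. (\<lambda>f1 f2. h (f1 i) (f1 j)) (restrict v {i, j}) (restrict v (I - {i, j})))"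
    by simp
  also have "\<dots> = (\<Sum>f1\<in>{i, j} \<rightarrow>\<^sub>E C. \<Sum>f2\<in>(I - {i, j}) \<rightarrow>\<^sub>E C. h (f1 i) (f1 j))"
    using ij by (intro sum_PiE_split[OF I]) auto
  also have "\<dots> = (\<Sum>f1\<in>{i, j} \<rightarrow>\<^sub>E C. real (card C) ^ (card I - 2) * h (f1 i) (f1 j))"
  proof -
    have "card (I - {i, j}) = card I - 2" using ij by (subst card_Diff_subset) auto
    then show ?thesis using I by (simp add: card_PiE)
  qed
  also have "\<dots> = real (card C) ^ (card I - 2) * (\<Sum>f1\<in>{i, j} \<rightarrow>\<^sub>E C. h (f1 i) (f1 j))"
    by (simp add: sum_distrib_left)
  also have "(\<Sum>f1\<in>{i, j} \<rightarrow>\<^sub>E C. h (f1 i) (f1 j)) = (\<Sum>(x, y)\<in>C \<times> C. h x y)"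
    by (rule sum.reindex_bij_witness[where j = "\<lambda>f. (f i, f j)" and i = "\<lambda>(x, y). \<lambda>l\<in>{i, j}. if l = i then x else y"])
       (use ij in \<open>auto simp: fun_eq_iff PiE_iff extensional_def split: prod.splits\<close>)
  finally show ?thesis by (simp add: sum.cartesian_product)
qed

text \<open>The sum is at most \<open>card P\<close> times its largest term, whose power is among
  the summands on the right.\<close>

lemma power_sum_le:
  fixes a :: "'a \<Rightarrow> real"
  assumes P: "finite P" "P \<noteq> {}" and a: "\<And>p. p \<in> P \<Longrightarrow> 0 \<le> a p"
  shows "(\<Sum>p\<in>P. a p) ^ m \<le> real (card P) ^ m * (\<Sum>p\<in>P. a p ^ m)"
proof -
  have "\<exists>q\<in>P. \<forall>p\<in>P. a p \<le> a q"
  proof -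
    have "Max (a ` P) \<in> a ` P" using P by (intro Max_in) auto
    then obtain q where q: "q \<in> P" "Max (a ` P) = a q" by auto
    have "a p \<le> a q" if "p \<in> P" for p
      using Max_ge[of "a ` P" "a p"] P that q by auto
    then show ?thesis using q by blast
  qed
  then obtain q where q: "q \<in> P" "\<And>p. p \<in> P \<Longrightarrow> a p \<le> a q" by blast
  have "(\<Sum>p\<in>P. a p) \<le> real (card P) * a q"
    using sum_bounded_above[of P a "a q"] q by simp
  then have "(\<Sum>p\<in>P. a p) ^ m \<le> (real (card P) * a q) ^ m"
    using a by (intro power_mono sum_nonneg)
  also have "\<dots> = real (card P) ^ m * a q ^ m" by (simp add: power_mult_distrib)
  also have "\<dots> \<le> real (card P) ^ m * (\<Sum>p\<in>P. a p ^ m)"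
    using P q a by (intro mult_left_mono member_le_sum) auto
  finally show ?thesis .
qed

text \<open>Pairs with \<open>x = y\<close> are included, since a tuple of last balls may repeat a
  ball.\<close>

definition prefix_pairs :: "split_tree \<Rightarrow> real" where
  "prefix_pairs T = (\<Sum>x\<in>balls T. \<Sum>y\<in>balls T. of_bool (prefix (T ! x) (T ! y)))"

definition prefix_moment :: "nat \<Rightarrow> split_tree \<Rightarrow> real" where
  "prefix_moment m T = (\<Sum>x\<in>balls T. \<Sum>y\<in>balls T. real (prefix_count T x y) ^ m)"

text \<open>After \<open>power_sum_le\<close> every summand of the error involves two coordinates of
  \<open>v\<close>; the free ones give \<open>n ^ (r - 2)\<close>, and r^2 bounds the number of
  ordered pairs of coordinates. The order r + 1 of the moment comes from r factors
  \<open>overlap\<close> and the one in \<open>overlap / \<Delta>\<close>.\<close>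

lemma sum_err_le:
  fixes I :: "'i set" and T :: split_tree
  assumes I: "finite I" "2 \<le> card I" and \<Delta>: "1 \<le> \<Delta>"
  defines "r \<equiv> card I" and "n \<equiv> real (length T)"
  shows "(\<Sum>v\<in>I \<rightarrow>\<^sub>E balls T. err T s k \<Delta> I v)
    \<le> real (r\<^sup>2) * n ^ (r - 2) * prefix_pairs T * (\<Delta> * \<Delta> ^ (k - 2)) ^ r
      + real r * (real s * real (r\<^sup>2)) ^ (r + 1) * real (r\<^sup>2) * n ^ (r - 2) * prefix_moment (r + 1) T * (\<Delta> ^ (k - 2)) ^ r / \<Delta>"
proof -
  let ?V = "I \<rightarrow>\<^sub>E balls T" and ?P = "Sigma I (\<lambda>i. I - {i})"
  have finP: "finite ?P" using I by auto
  have cP: "card ?P \<le> r\<^sup>2"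
  proof -
    have "card ?P \<le> card (I \<times> I)" using I by (intro card_mono) auto
    then show ?thesis by (simp add: r_def card_cartesian_product power2_eq_square)
  qed
  have pairs: "(\<Sum>v\<in>?V. \<Sum>(i, j)\<in>?P. h (v i) (v j)) \<le> real (r\<^sup>2) * (n ^ (r - 2) * (\<Sum>x\<in>balls T. \<Sum>y\<in>balls T. h x y))"
    if h: "\<And>x y. 0 \<le> h x y" for h :: "nat \<Rightarrow> nat \<Rightarrow> real"
  proof -
    have "(\<Sum>v\<in>?V. \<Sum>(i, j)\<in>?P. h (v i) (v j)) = (\<Sum>(i, j)\<in>?P. \<Sum>v\<in>?V. h (v i) (v j))"
      by (subst sum.swap) (auto intro!: sum.cong)
    also have "\<dots> = (\<Sum>(i, j)\<in>?P. n ^ (r - 2) * (\<Sum>x\<in>balls T. \<Sum>y\<in>balls T. h x y))"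
    proof (rule sum.cong[OF refl])
      fix p assume "p \<in> ?P"
      then obtain i j where "p = (i, j)" "i \<in> I" "j \<in> I" "i \<noteq> j" by auto
      then show "(case p of (i, j) \<Rightarrow> \<Sum>v\<in>?V. h (v i) (v j))
          = (case p of (i, j) \<Rightarrow> n ^ (r - 2) * (\<Sum>x\<in>balls T. \<Sum>y\<in>balls T. h x y))"
        using sum_two_coordinates[OF I(1), of i j h "balls T"] by (simp add: n_def r_def)
    qed
    also have "\<dots> = real (card ?P) * (n ^ (r - 2) * (\<Sum>x\<in>balls T. \<Sum>y\<in>balls T. h x y))"
      by (simp add: case_prod_beta)
    also have "\<dots> \<le> real (r\<^sup>2) * (n ^ (r - 2) * (\<Sum>x\<in>balls T. \<Sum>y\<in>balls T. h x y))"
      using cP by (intro mult_right_mono mult_nonneg_nonneg sum_nonneg h) (auto simp: n_def simp flip: of_nat_power)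
    finally show ?thesis .
  qed
  have "(\<Sum>v\<in>?V. of_bool (degenerate T I v)) \<le> (\<Sum>v\<in>?V. \<Sum>(i, j)\<in>?P. of_bool (prefix (T ! v i) (T ! v j)) :: real)"
  proof (rule sum_mono)
    fix v assume "v \<in> ?V"
    show "of_bool (degenerate T I v) \<le> (\<Sum>(i, j)\<in>?P. of_bool (prefix (T ! v i) (T ! v j)) :: real)"
    proof (cases "degenerate T I v")
      case True
      then obtain i j where ij: "(i, j) \<in> ?P" "prefix (T ! v i) (T ! v j)"
        by (auto simp: degenerate_def shared_def)
      have "(\<lambda>(i, j). of_bool (prefix (T ! v i) (T ! v j)) :: real) (i, j) \<le> (\<Sum>(i, j)\<in>?P. of_bool (prefix (T ! v i) (T ! v j)))"
        by (rule member_le_sum[OF ij(1) _ finP]) auto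
      then show ?thesis using True ij by simp
    qed (auto intro!: sum_nonneg)
  qed
  also have "\<dots> \<le> real (r\<^sup>2) * (n ^ (r - 2) * prefix_pairs T)"
    unfolding prefix_pairs_def by (rule pairs) simp
  finally have Z: "(\<Sum>v\<in>?V. of_bool (degenerate T I v)) \<le> real (r\<^sup>2) * (n ^ (r - 2) * prefix_pairs T)" .
  have "(\<Sum>v\<in>?V. overlap T s I v ^ (r + 1))
      \<le> (\<Sum>v\<in>?V. (real s * real (r\<^sup>2)) ^ (r + 1) * (\<Sum>(i, j)\<in>?P. real (prefix_count T (v i) (v j)) ^ (r + 1)))"
  proof (rule sum_mono)
    fix v assume "v \<in> ?V"
    have ne: "?P \<noteq> {}"
    proof -
      obtain i where i: "i \<in> I" using I by fastforce
      moreover have "I - {i} \<noteq> {}" using I by (intro remove_nonempty)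
      ultimately show ?thesis by blast
    qed
    have "(\<Sum>p\<in>?P. real (prefix_count T (v (fst p)) (v (snd p)))) ^ (r + 1)
      \<le> real (card ?P) ^ (r + 1) * (\<Sum>p\<in>?P. real (prefix_count T (v (fst p)) (v (snd p))) ^ (r + 1))"
      by (rule power_sum_le[OF finP ne]) simp
    also have "\<dots> \<le> real (r\<^sup>2) ^ (r + 1) * (\<Sum>p\<in>?P. real (prefix_count T (v (fst p)) (v (snd p))) ^ (r + 1))"
      using cP by (intro mult_right_mono power_mono sum_nonneg) (auto simp flip: of_nat_power)
    finally have "real s ^ (r + 1) * (\<Sum>p\<in>?P. real (prefix_count T (v (fst p)) (v (snd p)))) ^ (r + 1)
      \<le> real s ^ (r + 1) * (real (r\<^sup>2) ^ (r + 1) * (\<Sum>p\<in>?P. real (prefix_count T (v (fst p)) (v (snd p))) ^ (r + 1)))"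
      by (rule mult_left_mono) simp
    then show "overlap T s I v ^ (r + 1)
      \<le> (real s * real (r\<^sup>2)) ^ (r + 1) * (\<Sum>(i, j)\<in>?P. real (prefix_count T (v i) (v j)) ^ (r + 1))"
      unfolding overlap_def case_prod_beta power_mult_distrib by (simp only: mult.assoc)
  qed
  also have "\<dots> = (real s * real (r\<^sup>2)) ^ (r + 1) * (\<Sum>v\<in>?V. \<Sum>(i, j)\<in>?P. real (prefix_count T (v i) (v j)) ^ (r + 1))"
    by (rule sum_distrib_left[symmetric])
  also have "\<dots> \<le> (real s * real (r\<^sup>2)) ^ (r + 1) * (real (r\<^sup>2) * (n ^ (r - 2) * prefix_moment (r + 1) T))"
    unfolding prefix_moment_def
    by (intro mult_left_mono pairs[of "\<lambda>x y. real (prefix_count T x y) ^ (r + 1)"]) simp_all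
  finally have X: "(\<Sum>v\<in>?V. overlap T s I v ^ (r + 1))
      \<le> (real s * real (r\<^sup>2)) ^ (r + 1) * (real (r\<^sup>2) * (n ^ (r - 2) * prefix_moment (r + 1) T))" .
  have "(\<Sum>v\<in>?V. err T s k \<Delta> I v) = (\<Delta> * \<Delta> ^ (k - 2)) ^ r * (\<Sum>v\<in>?V. of_bool (degenerate T I v))
      + real r * (\<Delta> ^ (k - 2)) ^ r / \<Delta> * (\<Sum>v\<in>?V. overlap T s I v ^ (r + 1))"
    unfolding err_def r_def[symmetric] sum.distrib sum_distrib_left
    by (intro arg_cong2[where f = "(+)"] sum.cong refl) (simp_all add: power_mult_distrib)
  also have "\<dots> \<le> (\<Delta> * \<Delta> ^ (k - 2)) ^ r * (real (r\<^sup>2) * (n ^ (r - 2) * prefix_pairs T))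
      + real r * (\<Delta> ^ (k - 2)) ^ r / \<Delta> * ((real s * real (r\<^sup>2)) ^ (r + 1) * (real (r\<^sup>2) * (n ^ (r - 2) * prefix_moment (r + 1) T)))"
    using \<Delta> by (intro add_mono mult_left_mono Z X) auto
  also have "\<dots> = real (r\<^sup>2) * n ^ (r - 2) * prefix_pairs T * (\<Delta> * \<Delta> ^ (k - 2)) ^ r
      + real r * (real s * real (r\<^sup>2)) ^ (r + 1) * real (r\<^sup>2) * n ^ (r - 2) * prefix_moment (r + 1) T * (\<Delta> ^ (k - 2)) ^ r / \<Delta>"
    by (simp add: mult_ac)
  finally show ?thesis .
qed

lemma card_eq_sum_fiber:
  fixes I :: "'i set"
  assumes I: "finite I" and k: "1 \<le> k"
  shows "card {f \<in> I \<rightarrow>\<^sub>E chains T k. P f} = (\<Sum>v\<in>I \<rightarrow>\<^sub>E balls T. card {f \<in> fiber T k I v. P f})"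
proof -
  let ?F = "{f \<in> I \<rightarrow>\<^sub>E chains T k. P f}" and ?V = "I \<rightarrow>\<^sub>E balls T"
  let ?l = "\<lambda>f :: 'i \<Rightarrow> nat list. \<lambda>i\<in>I. last (f i)"
  have "finite (I \<rightarrow>\<^sub>E chains T k)" by (intro finite_PiE I finite_chains)
  then have fin: "finite ?F" "finite ?V" using I by (auto intro!: finite_PiE)
  have "?l f \<in> ?V" if "f \<in> ?F" for f
  proof -
    have "last (f i) \<in> balls T" if i: "i \<in> I" for i
    proof -
      have "f i \<in> chains T k" using \<open>f \<in> ?F\<close> i by auto
      then show ?thesis
        using chainsD(1,2)[of "f i" T k] k last_in_set[of "f i"] by fastforce
    qed
    then show ?thesis by auto
  qed
  then have "?l ` ?F \<subseteq> ?V" by blast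
  then have "(\<Sum>v\<in>?V. \<Sum>f | f \<in> ?F \<and> ?l f = v. 1) = (\<Sum>f\<in>?F. 1::nat)"
    by (rule sum.group[OF fin])
  moreover have "{f. f \<in> ?F \<and> ?l f = v} = {f \<in> fiber T k I v. P f}" if "v \<in> ?V" for v
    using that by (auto simp: fiber_def fun_eq_iff PiE_iff extensional_def)
  ultimately show ?thesis by simp
qed

text \<open>The tree is fixed here; its randomness enters later, through \<open>\<Delta>\<close> and
  the size of the error sum. The first constant bounds the joint cumulants of tuples with a large
  overlap, and the second pays for replacing the number of single overlaps by
  \<open>Upsilon\<close>.\<close>

theorem cumulant_Upsilon_approx:
  assumes \<alpha>: "\<alpha> \<in> permutations_of_set {1..k}" and k: "2 \<le> k" and r: "2 \<le> r"
    and s: "1 \<le> s" "\<And>u. count_list T u \<le> s"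
    and \<Delta>: "1 \<le> \<Delta>" "\<And>v. v \<in> balls T \<Longrightarrow> real (ball_depth T v) \<le> \<Delta>"
  shows "\<bar>cumulant r (measure_pmf (pmf_of_set (labellings T))) (R \<alpha> T) - D_coeff k \<alpha> r * Upsilon r k T\<bar>
    \<le> ((\<Sum>\<tau> | partition_on {1..r} \<tau>. fact (card \<tau> - 1)) + 2 * \<bar>D_coeff k \<alpha> r\<bar>)
      * (\<Sum>v\<in>{1..r} \<rightarrow>\<^sub>E balls T. err T s k \<Delta> {1..r} v)"
proof -
  let ?I = "{1..r}" and ?V = "{1..r} \<rightarrow>\<^sub>E balls T" and ?D = "D_coeff k \<alpha> r"
  let ?E = "\<Sum>v\<in>?V. err T s k \<Delta> ?I v" and ?K = "\<Sum>\<tau> | partition_on {1..r} \<tau>. fact (card \<tau> - 1) :: real"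
  have I: "finite ?I" "2 \<le> card ?I" using r by auto
  let ?G = "real (card {f \<in> ?I \<rightarrow>\<^sub>E chains T k. single_overlap T ?I f})"
  let ?B = "real (card {f \<in> ?I \<rightarrow>\<^sub>E chains T k. large_overlap T ?I f})"
  have G: "?G = (\<Sum>v\<in>?V. real (card {f \<in> fiber T k ?I v. single_overlap T ?I f}))"
    using k by (subst card_eq_sum_fiber) auto
  have "?B = (\<Sum>v\<in>?V. real (card {f \<in> fiber T k ?I v. large_overlap T ?I f}))"
    using k by (subst card_eq_sum_fiber) auto
  also have "\<dots> \<le> ?E"
    by (intro sum_mono large_overlap_le[OF s k \<Delta> I]) auto
  finally have B: "?B \<le> ?E" .
  have 1: "?G \<le> Upsilon r k T"
    unfolding G Upsilon_eq_sum_confs using card_single_overlap_le[OF I k] by (intro sum_mono) simp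
  have "Upsilon r k T \<le> (\<Sum>v\<in>?V. real (card {f \<in> fiber T k ?I v. single_overlap T ?I f}) + 2 * err T s k \<Delta> ?I v)"
    unfolding Upsilon_eq_sum_confs by (intro sum_mono ups_confs_le[OF s k \<Delta> I]) auto
  then have 2: "Upsilon r k T \<le> ?G + 2 * ?E"
    unfolding sum.distrib G[symmetric] sum_distrib_left[symmetric] .
  have "\<bar>?D * ?G - ?D * Upsilon r k T\<bar> = \<bar>?D\<bar> * \<bar>?G - Upsilon r k T\<bar>"
    by (simp add: abs_mult flip: right_diff_distrib)
  also have "\<dots> \<le> \<bar>?D\<bar> * (2 * ?E)"
    using 1 2 by (intro mult_left_mono) auto
  finally have 3: "\<bar>?D * ?G - ?D * Upsilon r k T\<bar> \<le> \<bar>?D\<bar> * (2 * ?E)" .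
  have "\<bar>cumulant r (measure_pmf (pmf_of_set (labellings T))) (R \<alpha> T) - ?D * ?G\<bar> \<le> ?K * ?B"
    using k r by (intro cumulant_approx[OF \<alpha>]) auto
  also have "\<dots> \<le> ?K * ?E" by (intro mult_left_mono B sum_nonneg) simp
  finally have 4: "\<bar>cumulant r (measure_pmf (pmf_of_set (labellings T))) (R \<alpha> T) - ?D * ?G\<bar> \<le> ?K * ?E" .
  have "\<bar>cumulant r (measure_pmf (pmf_of_set (labellings T))) (R \<alpha> T) - ?D * Upsilon r k T\<bar>
      \<le> ?K * ?E + \<bar>?D\<bar> * (2 * ?E)"
    using 3 4 by linarith
  then show ?thesis by (simp add: algebra_simps)
qed

subsection \<open>The insertion process\<close>

definition subtree_size :: "split_tree \<Rightarrow> node \<Rightarrow> nat" where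
  "subtree_size T u = size {#w \<in># mset T. prefix u w#}"

text \<open>The invariants of insertion. The clauses on internal nodes provide a ball in every
  proper ancestor of an occupied node and make the excess of such nodes positive.\<close>

definition regular_tree :: "nat \<Rightarrow> nat \<Rightarrow> split_tree \<Rightarrow> bool" where
  "regular_tree b s T \<longleftrightarrow> (\<forall>w\<in>set T. set w \<subseteq> {..<b}) \<and> (\<forall>u. count_list T u \<le> s)
    \<and> (\<forall>u. internal T u \<longrightarrow> 1 \<le> count_list T u \<and> s < subtree_size T u)"

text \<open>
  A new subtree starts with at most \<open>s\<close> balls, and afterwards it only grows when a ball descends
  through its root.  So this counts at most the balls that descended through \<open>u\<close>.
\<close>

definition excess :: "nat \<Rightarrow> split_tree \<Rightarrow> node \<Rightarrow> nat" where
  "excess s T u = subtree_size T u - s"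

text \<open>Uses \<open>child_pmf\<close> and not \<open>V\<close> itself, so that the factors are
  probabilities for invalid vectors, too.\<close>

fun path_prob :: "nat \<Rightarrow> (node \<Rightarrow> nat \<Rightarrow> real) \<Rightarrow> node \<Rightarrow> node \<Rightarrow> real" where
  "path_prob b V u [] = 1"
| "path_prob b V u (i # h) = pmf (child_pmf b (V u)) i * path_prob b V (u @ [i]) h"

lemma path_prob_nonneg: "0 \<le> path_prob b V u h"
  by (induction h arbitrary: u) auto

lemma set_pmf_child_pmf: "1 \<le> b \<Longrightarrow> set_pmf (child_pmf b v) \<subseteq> {..<b}"
  by (auto simp: set_pmf_iff pmf_child_pmf split: if_splits)

lemma set_pmf_descend:
  assumes "w \<in> set_pmf (descend b V T u)"
  shows "prefix u w \<and> \<not> internal T w \<and> (\<forall>x. prefix u x \<longrightarrow> strict_prefix x w \<longrightarrow> internal T x)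
    \<and> (1 \<le> b \<longrightarrow> set u \<subseteq> {..<b} \<longrightarrow> set w \<subseteq> {..<b})"
  using assms
proof (induction b V T u arbitrary: w rule: descend.induct)
  case (1 b V T u)
  show ?case
  proof (cases "internal T u")
    case True
    then obtain i where i: "i \<in> set_pmf (child_pmf b (V u))" "w \<in> set_pmf (descend b V T (u @ [i]))"
      using "1.prems" by (subst (asm) descend.simps) auto
    note IH = "1.IH"[OF True i]
    have "internal T x" if x: "prefix u x" "strict_prefix x w" for x
    proof (cases "x = u")
      case False
      have "prefix (u @ [i]) x"
        using x False IH
        by (metis append_Nil2 append_eq_appendI prefix_same_cases prefix_snocD prefix_order.antisym
            prefix_order.dual_order.strict_implies_order prefix_order.dual_order.trans prefix_snoc strict_prefixI')
      then show ?thesis using IH x by blast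
    qed (use True in simp)
    moreover have "prefix u w" using IH append_prefixD by blast
    moreover have "i < b" if "1 \<le> b" using set_pmf_child_pmf[OF that] i(1) by blast
    ultimately show ?thesis using IH by auto
  next
    case False
    then have "w = u" using "1.prems" by (subst (asm) descend.simps) auto
    then show ?thesis using False prefix_order.less_le_not_le by blast
  qed
qed

text \<open>An inequality, because the walk may stop before it reaches \<open>u @ h\<close>.\<close>

lemma emeasure_descend_le:
  "emeasure (measure_pmf (descend b V T u)) {w. prefix (u @ h) w} \<le> ennreal (path_prob b V u h)"
proof (induction h arbitrary: u)
  case Nil
  then show ?case by (simp add: measure_pmf.emeasure_le_1)
next
  case (Cons i h)
  show ?case
  proof (cases "internal T u")
    case True
    have "emeasure (measure_pmf (descend b V T u)) {w. prefix (u @ i # h) w}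
      = (\<integral>\<^sup>+j. emeasure (measure_pmf (descend b V T (u @ [j]))) {w. prefix (u @ i # h) w} \<partial>measure_pmf (child_pmf b (V u)))"
      using True by (subst descend.simps) simp
    also have "\<dots> \<le> (\<integral>\<^sup>+j. ennreal (path_prob b V (u @ [i]) h) * indicator {i} j \<partial>measure_pmf (child_pmf b (V u)))"
    proof (rule nn_integral_mono)
      fix j
      show "emeasure (measure_pmf (descend b V T (u @ [j]))) {w. prefix (u @ i # h) w}
          \<le> ennreal (path_prob b V (u @ [i]) h) * indicator {i} j"
      proof (cases "j = i")
        case True
        then show ?thesis using Cons.IH[of "u @ [i]"] by simp
      next
        case False
        \<comment> \<open>A walk through another child \<open>j\<close> disagrees with
          \<open>u @ i # h\<close> at position \<open>length u\<close>.\<close>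
        have "\<not> prefix (u @ i # h) w" if "w \<in> set_pmf (descend b V T (u @ [j]))" for w
        proof
          assume "prefix (u @ i # h) w"
          then have 1: "w ! length u = i" by (auto simp: prefix_def nth_append)
          have "prefix (u @ [j]) w" using set_pmf_descend[OF that] by blast
          then have 2: "w ! length u = j" by (auto simp: prefix_def nth_append)
          show False using 1 2 False by simp
        qed
        then have "emeasure (measure_pmf (descend b V T (u @ [j]))) {w. prefix (u @ i # h) w} = 0"
          by (simp add: measure_pmf.emeasure_eq_measure measure_pmf_zero_iff disjoint_iff)
        then show ?thesis by simp
      qed
    qed
    also have "\<dots> = ennreal (path_prob b V (u @ [i]) h) * emeasure (measure_pmf (child_pmf b (V u))) {i}"
      by (subst nn_integral_cmult_indicator) auto
    also have "\<dots> = ennreal (path_prob b V u (i # h))"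
      by (simp add: emeasure_pmf_single mult.commute ennreal_mult path_prob_nonneg)
    finally show ?thesis .
  next
    case False
    have "\<not> prefix (u @ i # h) u" by (auto simp: prefix_def)
    then show ?thesis using False by (subst descend.simps) simp
  qed
qed

section \<open>Effect of a split on the invariants\<close>

lemma filter_replicate_mset: "filter_mset P (replicate_mset n x) = (if P x then replicate_mset n x else {#})"
  by (induction n) auto

text \<open>The invariants and the excess depend only on the multiset of occupied nodes, so the
  identity of the moved balls can be forgotten.\<close>

lemma mset_relocate:
  assumes js: "distinct js" "set js = {j. j < length T \<and> T ! j = w}" and len: "length dest = length js"
  shows "mset (map (\<lambda>j. case map_of (zip js dest) j of None \<Rightarrow> T ! j | Some x \<Rightarrow> x) [0..<length T])
    = {#x \<in># mset T. x \<noteq> w#} + mset dest"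
proof -
  let ?f = "\<lambda>j. case map_of (zip js dest) j of None \<Rightarrow> T ! j | Some x \<Rightarrow> x"
  let ?J = "{j. j < length T \<and> T ! j = w}" and ?K = "{j. j < length T \<and> T ! j \<noteq> w}"
  have mT: "mset T = image_mset ((!) T) (mset_set {..<length T})"
  proof -
    have "mset T = mset (map ((!) T) [0..<length T])" by (simp add: map_nth)
    also have "\<dots> = image_mset ((!) T) (mset_set {..<length T})"
      by (simp only: mset_map mset_upt atLeast0LessThan)
    finally show ?thesis .
  qed
  have "mset (map ?f [0..<length T]) = image_mset ?f (mset_set {..<length T})"
    by (simp only: mset_map mset_upt atLeast0LessThan)
  also have "mset_set {..<length T} = mset_set ?K + mset_set ?J"
  proof -
    have "{..<length T} = ?K \<union> ?J" by auto
    then show ?thesis by (simp only:) (subst mset_set_Union, auto)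
  qed
  also have "image_mset ?f (mset_set ?K + mset_set ?J) = image_mset ((!) T) (mset_set ?K) + image_mset ?f (mset_set ?J)"
  proof -
    have "?f j = T ! j" if "j \<in> ?K" for j
    proof -
      have "map_of (zip js dest) j = None"
        using that js len by (simp add: map_of_zip_is_None)
      then show ?thesis by simp
    qed
    then have "image_mset ?f (mset_set ?K) = image_mset ((!) T) (mset_set ?K)"
      by (intro image_mset_cong) auto
    then show ?thesis by simp
  qed
  also have "image_mset ((!) T) (mset_set ?K) = {#x \<in># mset T. x \<noteq> w#}"
    unfolding mT filter_mset_image_mset
    by (rule arg_cong[where f = "image_mset ((!) T)"]) (simp add: filter_mset_mset_set)
  also have "image_mset ?f (mset_set ?J) = mset dest"
  proof -
    have "mset_set ?J = mset js" using mset_set_set[OF js(1)] js(2) by simp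
    moreover have "map ?f js = dest"
      using js(1) len by (intro nth_equalityI) (auto simp: map_of_zip_nth)
    then have "image_mset ?f (mset js) = mset dest" by (metis mset_map)
    ultimately show ?thesis by simp
  qed
  finally show ?thesis .
qed

lemma set_pmf_split_node:
  assumes b: "1 \<le> b" and bs: "b * s\<^sub>1 \<le> s + 1 - s\<^sub>0" and s: "s\<^sub>0 \<le> s" and cnt: "count_list T w = Suc s"
    and T': "T' \<in> set_pmf (split_node b s\<^sub>0 s\<^sub>1 V w T)"
  obtains M where "mset T' = {#x \<in># mset T. x \<noteq> w#} + replicate_mset s\<^sub>0 w + M"
    "size M = s + 1 - s\<^sub>0" "\<And>x. x \<in># M \<Longrightarrow> \<exists>i<b. x = w @ [i]"
proof -
  let ?J = "{j. j < length T \<and> T ! j = w}"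
  have "card ?J = Suc s"
    using cnt by (simp add: count_list_eq_length_filter length_filter_conv_card eq_commute)
  obtain js "is" where js: "js \<in> permutations_of_set ?J"
    and "is": "is \<in> set_pmf (replicate_pmf (length js - s\<^sub>0 - b * s\<^sub>1) (child_pmf b (V w)))"
    and T'_eq: "T' = map (\<lambda>j. case map_of (zip js (replicate s\<^sub>0 w @ concat (map (\<lambda>i. replicate s\<^sub>1 (w @ [i])) [0..<b])
                  @ map (\<lambda>i. w @ [i]) is)) j of None \<Rightarrow> T ! j | Some x \<Rightarrow> x) [0..<length T]"
    using T' unfolding split_node_def Let_def by auto
  have js': "distinct js" "set js = ?J" "length js = Suc s"
    using js \<open>card ?J = Suc s\<close> distinct_card[of js] by (auto simp: permutations_of_set_def)
  have "is \<in> {xs \<in> lists (set_pmf (child_pmf b (V w))). length xs = Suc s - s\<^sub>0 - b * s\<^sub>1}"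
    using "is" unfolding js'(3) set_replicate_pmf .
  then have is': "length is = Suc s - s\<^sub>0 - b * s\<^sub>1" "\<And>i. i \<in> set is \<Longrightarrow> i < b"
    using set_pmf_child_pmf[OF b, of "V w"] by auto
  define rest where "rest = concat (map (\<lambda>i. replicate s\<^sub>1 (w @ [i])) [0..<b]) @ map (\<lambda>i. w @ [i]) is"
  have "length (concat (map (\<lambda>i. replicate s\<^sub>1 (w @ [i])) [0..<b])) = b * s\<^sub>1"
    by (simp add: length_concat comp_def sum_list_triv)
  then have lr: "length rest = s + 1 - s\<^sub>0"
    using is' bs by (simp add: rest_def)
  have "mset T' = {#x \<in># mset T. x \<noteq> w#} + mset (replicate s\<^sub>0 w @ rest)"
    unfolding T'_eq rest_def[symmetric]
    by (rule mset_relocate[OF js'(1,2)]) (use js'(3) lr s in simp)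
  then have "mset T' = {#x \<in># mset T. x \<noteq> w#} + replicate_mset s\<^sub>0 w + mset rest"
    by (simp add: add.assoc)
  moreover have "\<exists>i<b. x = w @ [i]" if "x \<in># mset rest" for x
    using that is' by (auto simp: rest_def)
  ultimately show ?thesis using that lr by simp
qed

text \<open>All proper prefixes of \<open>w\<close> are internal already, so no node becomes
  internal.\<close>

lemma regular_tree_append:
  assumes reg: "regular_tree b s T" and cnt: "count_list T w < s"
    and w: "set w \<subseteq> {..<b}" "\<not> internal T w" "\<And>x. strict_prefix x w \<Longrightarrow> internal T x"
  shows "regular_tree b s (T @ [w])" "excess s (T @ [w]) g \<le> excess s T g + of_bool (prefix g w)"
proof -
  have int: "internal (T @ [w]) u \<longleftrightarrow> internal T u" for u
    using w(3) by (auto simp: internal_def)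
  have size: "subtree_size (T @ [w]) u = subtree_size T u + of_bool (prefix u w)" for u
    by (simp add: subtree_size_def)
  have "count_list (T @ [w]) u \<le> s" for u
    using reg cnt by (auto simp: regular_tree_def)
  then show "regular_tree b s (T @ [w])"
    using reg w(1) unfolding regular_tree_def int size by (auto simp: trans_less_add1)
  show "excess s (T @ [w]) g \<le> excess s T g + of_bool (prefix g w)"
    by (simp add: excess_def size)
qed

text \<open>\<open>T\<close> is the tree before the arrival of the ball that overfills
  \<open>w\<close>, so the net effect is one more ball at or below \<open>w\<close>, and
  \<open>w\<close> is the only node that becomes internal. Its children receive at most
  \<open>s + 1 - s\<^sub>0 \<le> s\<close> balls in all, which keeps them within capacity and their
  excess zero.\<close>

lemma regular_tree_split:
  assumes reg: "regular_tree b s T" and s: "1 \<le> s\<^sub>0" "s\<^sub>0 \<le> s" and cnt: "count_list T w = s"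
    and w: "set w \<subseteq> {..<b}" "\<not> internal T w" "\<And>x. strict_prefix x w \<Longrightarrow> internal T x"
    and T': "mset T' = {#x \<in># mset (T @ [w]). x \<noteq> w#} + replicate_mset s\<^sub>0 w + M"
      "size M = s + 1 - s\<^sub>0" "\<And>x. x \<in># M \<Longrightarrow> \<exists>i<b. x = w @ [i]"
  shows "regular_tree b s T'" "length T' = Suc (length T)"
    "excess s T' g \<le> excess s T g + of_bool (prefix g w)"
proof -
  define N where "N = {#x \<in># mset T. x \<noteq> w#}"
  have mT': "mset T' = N + replicate_mset s\<^sub>0 w + M" using T'(1) by (simp add: N_def)
  have mT: "mset T = N + replicate_mset s w"
  proof -
    have "mset T = N + {#x \<in># mset T. \<not> x \<noteq> w#}" unfolding N_def by (rule multiset_partition)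
    also have "{#x \<in># mset T. \<not> x \<noteq> w#} = replicate_mset (count (mset T) w) w"
      using filter_eq_replicate_mset[of w "mset T"] by (simp add: eq_commute)
    also have "count (mset T) w = s" unfolding count_mset by (rule cnt)
    finally show ?thesis .
  qed
  have N: "\<not> strict_prefix w x" "x \<noteq> w" if "x \<in># N" for x
    using that w(2) by (auto simp: N_def internal_def)
  show "length T' = Suc (length T)"
  proof -
    have "size (mset T') = Suc (size (mset T))" unfolding mT mT' using T'(2) s by simp
    then show ?thesis by simp
  qed
  have pM: "prefix w x" "strict_prefix w x" if "x \<in># M" for x using T'(3)[OF that] by (auto simp: strict_prefix_def)
  have cntN: "count N x = 0" if "prefix w x" for x
  proof (rule ccontr)
    assume "count N x \<noteq> 0"
    then have "x \<in># N" by (simp add: count_eq_zero_iff)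
    then show False using N[of x] that by (auto simp: strict_prefix_def)
  qed
  have cntM: "count M x \<le> s" for x
    using count_le_size[of M x] T'(2) s by linarith
  have cntM0: "count M x = 0" if "\<not> strict_prefix w x" for x
    using that pM by (metis count_eq_zero_iff)
  have cntT': "count_list T' x = count N x + (if x = w then s\<^sub>0 else 0) + count M x" for x
  proof -
    have "count_list T' x = count (mset T') x" by (rule count_mset[symmetric])
    also have "\<dots> = count N x + (if x = w then s\<^sub>0 else 0) + count M x" unfolding mT' by simp
    finally show ?thesis .
  qed
  have cntT: "count_list T x = count N x + (if x = w then s else 0)" for x
  proof -
    have "count_list T x = count (mset T) x" by (rule count_mset[symmetric])
    also have "\<dots> = count N x + (if x = w then s else 0)" unfolding mT by simp
    finally show ?thesis .
  qed
  have sizeM: "size {#x \<in># M. prefix u x#} = s + 1 - s\<^sub>0" if "prefix u w" for u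
  proof -
    have "{#x \<in># M. prefix u x#} = {#x \<in># M. True#}"
      by (intro filter_mset_cong refl) (use that pM prefix_order.trans in blast)
    then show ?thesis using T'(2) by simp
  qed
  have sizeT': "subtree_size T' u = size {#x \<in># N. prefix u x#} + (if prefix u w then s\<^sub>0 else 0) + size {#x \<in># M. prefix u x#}" for u
    unfolding subtree_size_def mT' by (simp add: filter_replicate_mset)
  have sizeT: "subtree_size T u = size {#x \<in># N. prefix u x#} + (if prefix u w then s else 0)" for u
    unfolding subtree_size_def mT by (simp add: filter_replicate_mset)
  have size_ge: "subtree_size T u \<le> subtree_size T' u" for u
    using sizeM[of u] s by (simp add: sizeT sizeT')
  have setT': "set T' = set_mset N \<union> {w} \<union> set_mset M"
  proof -
    have "set T' = set_mset (mset T')" by simp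
    then show ?thesis unfolding mT' using s by (auto split: if_splits)
  qed
  have setN: "x \<in> set T" if "x \<in># N" for x using that by (simp add: N_def)
  have int: "internal T u \<or> u = w" if u: "internal T' u" for u
  proof -
    obtain y where y: "y \<in> set T'" "strict_prefix u y" using u by (auto simp: internal_def)
    consider "y \<in># N" | "y = w" | "y \<in># M" using y setT' by auto
    then show ?thesis
    proof cases
      case 1
      then show ?thesis using y setN by (auto simp: internal_def)
    next
      case 2
      then show ?thesis using w(3) y by auto
    next
      case 3
      then obtain i where "y = w @ [i]" using T'(3) by blast
      then have "prefix u w" using y(2) by (auto simp: strict_prefix_def)
      then show ?thesis using w(3) by (auto simp: strict_prefix_def)
    qed
  qed
  show "regular_tree b s T'"
    unfolding regular_tree_def
  proof (intro conjI ballI allI impI)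
    fix x assume "x \<in> set T'"
    then show "set x \<subseteq> {..<b}"
      using setT' setN reg w(1) T'(3) by (fastforce simp: regular_tree_def)
  next
    fix u
    have "count N u \<le> s" using cntT[of u] reg by (metis le_add1 order.trans regular_tree_def)
    show "count_list T' u \<le> s"
    proof (cases "strict_prefix w u")
      case True
      then show ?thesis using cntN[of u] cntM[of u] cntT'[of u] by (auto simp: strict_prefix_def)
    next
      case False
      then show ?thesis using cntM0[OF False] cntT'[of u] cntN[of u] s \<open>count N u \<le> s\<close> by auto
    qed
  next
    fix u assume u: "internal T' u"
    show "1 \<le> count_list T' u"
    proof (cases "u = w")
      case False
      then have "1 \<le> count_list T u" using int[OF u] reg by (auto simp: regular_tree_def)
      then have "1 \<le> count N u" unfolding cntT using False by (simp only: if_False add_0_right)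
      then show ?thesis unfolding cntT' by linarith
    qed (use cntT'[of w] s in simp)
    show "s < subtree_size T' u"
    proof (cases "u = w")
      case False
      then have "s < subtree_size T u" using int[OF u] reg by (auto simp: regular_tree_def)
      then show ?thesis using size_ge[of u] by simp
    next
      case True
      then show ?thesis using sizeT'[of w] sizeM[of w] s by simp
    qed
  qed
  show "excess s T' g \<le> excess s T g + of_bool (prefix g w)"
  proof (cases "prefix g w")
    case True
    then show ?thesis using sizeM[OF True] s by (simp add: excess_def sizeT sizeT')
  next
    case False
    show ?thesis
    proof (cases "\<exists>x. x \<in># M \<and> prefix g x")
      case True
      then obtain i where "prefix g (w @ [i])" using T'(3) by blast
      then have g: "g = w @ [i]" using False by simp
      have "\<not> prefix g x" if "x \<in># N" for x
        using N(1)[OF that] g by (metis prefix_order.less_le_trans strict_prefixI' append_prefixD prefix_snocD)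
      then have e: "{#x \<in># N. prefix g x#} = {#}" by simp
      have "size {#x \<in># M. prefix g x#} \<le> s"
        using size_filter_mset_lesseq[of "prefix g" M] T'(2) s by linarith
      then have "subtree_size T' g \<le> s" unfolding sizeT' e using False by simp
      then show ?thesis by (simp add: excess_def)
    next
      case False': False
      then have e: "{#x \<in># M. prefix g x#} = {#}" by auto
      show ?thesis unfolding excess_def sizeT sizeT' e using False by simp
    qed
  qed
qed

lemma split_overfull_regular:
  assumes "\<And>u. count_list T u \<le> s"
  shows "split_overfull m b s s\<^sub>0 s\<^sub>1 V T = return_pmf T"
proof (cases m)
  case (Suc m)
  have "\<not> (\<exists>u. s < count_list T u)" using assms by (auto simp: not_less)
  then show ?thesis using Suc by (simp only: split_overfull.simps if_False)
qed simp

text \<open>Only \<open>w\<close> can be overfull, so \<open>SOME\<close> picks it, and after one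
  split no node is: \<open>1 \<le> s\<^sub>0\<close> leaves at most \<open>s\<close> balls for the
  children. The successor in \<open>Suc m\<close> pays for this split.\<close>

lemma insert_ball:
  assumes reg: "regular_tree b s T" and b: "1 \<le> b" and s: "1 \<le> s\<^sub>0" "s\<^sub>0 \<le> s" and bs: "b * s\<^sub>1 \<le> s + 1 - s\<^sub>0"
    and w: "w \<in> set_pmf (descend b V T [])"
    and T': "T' \<in> set_pmf (split_overfull (Suc m) b s s\<^sub>0 s\<^sub>1 V (T @ [w]))"
  shows "regular_tree b s T' \<and> length T' = Suc (length T) \<and> excess s T' g \<le> excess s T g + of_bool (prefix g w)"
proof -
  have w': "set w \<subseteq> {..<b}" "\<not> internal T w" "\<And>x. strict_prefix x w \<Longrightarrow> internal T x"
    using set_pmf_descend[OF w] b by auto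
  show ?thesis
  proof (cases "count_list T w < s")
    case True
    note app = regular_tree_append[OF reg True w']
    have "split_overfull (Suc m) b s s\<^sub>0 s\<^sub>1 V (T @ [w]) = return_pmf (T @ [w])"
      using app(1) by (intro split_overfull_regular) (auto simp: regular_tree_def)
    then have "T' = T @ [w]" using T' by (simp only: set_return_pmf singletonD)
    then show ?thesis using app by auto
  next
    case False
    have le: "count_list T u \<le> s" for u using reg by (auto simp: regular_tree_def)
    then have cnt: "count_list T w = s" using False by (simp add: not_less le_antisym)
    have over: "s < count_list (T @ [w]) u \<longleftrightarrow> u = w" for u
      using le[of u] cnt by auto
    have "split_overfull (Suc m) b s s\<^sub>0 s\<^sub>1 V (T @ [w])
      = bind_pmf (split_node b s\<^sub>0 s\<^sub>1 V w (T @ [w])) (split_overfull m b s s\<^sub>0 s\<^sub>1 V)"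
      unfolding split_overfull.simps over by simp
    then obtain T1 where T1: "T1 \<in> set_pmf (split_node b s\<^sub>0 s\<^sub>1 V w (T @ [w]))"
      "T' \<in> set_pmf (split_overfull m b s s\<^sub>0 s\<^sub>1 V T1)"
      using T' by auto
    have cnt1: "count_list (T @ [w]) w = Suc s" using cnt by simp
    obtain M where M: "mset T1 = {#x \<in># mset (T @ [w]). x \<noteq> w#} + replicate_mset s\<^sub>0 w + M"
      "size M = s + 1 - s\<^sub>0" "\<And>x. x \<in># M \<Longrightarrow> \<exists>i<b. x = w @ [i]"
      by (rule set_pmf_split_node[OF b bs s(2) cnt1 T1(1)]) blast
    note spl = regular_tree_split[OF reg s cnt w' M]
    have "split_overfull m b s s\<^sub>0 s\<^sub>1 V T1 = return_pmf T1"
      using spl(1) by (intro split_overfull_regular) (auto simp: regular_tree_def)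
    then have "T' = T1" using T1(2) by (simp only: set_return_pmf singletonD)
    then show ?thesis using spl by auto
  qed
qed

section \<open>Moments of the excess for given split vectors\<close>

context
  fixes b s s\<^sub>0 s\<^sub>1 :: nat
  assumes b: "1 \<le> b" and s: "1 \<le> s\<^sub>0" "s\<^sub>0 \<le> s" and bs: "b * s\<^sub>1 \<le> s + 1 - s\<^sub>0"
begin

lemma set_pmf_split_tree_given:
  "T \<in> set_pmf (split_tree_given b s s\<^sub>0 s\<^sub>1 V n) \<Longrightarrow> regular_tree b s T \<and> length T = n"
proof (induction n arbitrary: T)
  case 0
  then show ?case by (simp add: regular_tree_def internal_def)
next
  case (Suc n)
  then obtain T0 w where T0: "T0 \<in> set_pmf (split_tree_given b s s\<^sub>0 s\<^sub>1 V n)" "w \<in> set_pmf (descend b V T0 [])"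
    "T \<in> set_pmf (split_overfull (Suc n) b s s\<^sub>0 s\<^sub>1 V (T0 @ [w]))"
    by (auto simp del: split_overfull.simps)
  then show ?case
    using insert_ball[OF _ b s bs T0(2,3)] Suc.IH[OF T0(1)] by auto
qed

text \<open>The excess at \<open>g\<close> grows by at most one, and only if the new ball descends
  through \<open>g\<close>, which has probability at most \<open>path_prob\<close>. Monotonicity of
  \<open>\<phi>\<close> makes the truncated difference exact.\<close>

lemma nn_integral_split_tree_given_Suc_le:
  assumes \<phi>: "mono \<phi>"
  shows "(\<integral>\<^sup>+T. of_nat (\<phi> (excess s T g)) \<partial>measure_pmf (split_tree_given b s s\<^sub>0 s\<^sub>1 V (Suc n)))
    \<le> (\<integral>\<^sup>+T. of_nat (\<phi> (excess s T g)) + of_nat (\<phi> (Suc (excess s T g)) - \<phi> (excess s T g)) * ennreal (path_prob b V [] g)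
        \<partial>measure_pmf (split_tree_given b s s\<^sub>0 s\<^sub>1 V n))"
  unfolding split_tree_given.simps nn_integral_bind_pmf
proof (rule nn_integral_mono_AE, unfold AE_measure_pmf_iff, intro ballI)
  fix T assume T: "T \<in> set_pmf (split_tree_given b s s\<^sub>0 s\<^sub>1 V n)"
  then have reg: "regular_tree b s T" using set_pmf_split_tree_given by blast
  let ?y = "excess s T g"
  have "(\<integral>\<^sup>+w. \<integral>\<^sup>+T'. of_nat (\<phi> (excess s T' g)) \<partial>measure_pmf (split_overfull (Suc n) b s s\<^sub>0 s\<^sub>1 V (T @ [w]))
        \<partial>measure_pmf (descend b V T []))
    \<le> (\<integral>\<^sup>+w. of_nat (\<phi> ?y) + of_nat (\<phi> (Suc ?y) - \<phi> ?y) * indicator {w. prefix ([] @ g) w} w \<partial>measure_pmf (descend b V T []))"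
  proof (rule nn_integral_mono_AE, unfold AE_measure_pmf_iff, intro ballI)
    fix w assume w: "w \<in> set_pmf (descend b V T [])"
    have "(\<integral>\<^sup>+T'. of_nat (\<phi> (excess s T' g)) \<partial>measure_pmf (split_overfull (Suc n) b s s\<^sub>0 s\<^sub>1 V (T @ [w])))
      \<le> (\<integral>\<^sup>+T'. of_nat (\<phi> (?y + of_bool (prefix g w))) \<partial>measure_pmf (split_overfull (Suc n) b s s\<^sub>0 s\<^sub>1 V (T @ [w])))"
    proof (rule nn_integral_mono_AE, unfold AE_measure_pmf_iff, intro ballI)
      fix T' assume "T' \<in> set_pmf (split_overfull (Suc n) b s s\<^sub>0 s\<^sub>1 V (T @ [w]))"
      then have "excess s T' g \<le> ?y + of_bool (prefix g w)"
        using insert_ball[OF reg b s bs w] by blast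
      then show "of_nat (\<phi> (excess s T' g)) \<le> (of_nat (\<phi> (?y + of_bool (prefix g w))) :: ennreal)"
        using \<phi> by (simp add: monoD)
    qed
    also have "\<dots> = of_nat (\<phi> (?y + of_bool (prefix g w)))"
      by (simp add: measure_pmf.emeasure_space_1)
    also have "\<dots> = of_nat (\<phi> ?y) + of_nat (\<phi> (Suc ?y) - \<phi> ?y) * indicator {w. prefix ([] @ g) w} w"
    proof -
      have "\<phi> ?y \<le> \<phi> (Suc ?y)" using \<phi> by (simp add: monoD)
      then have "\<phi> (Suc ?y) = \<phi> ?y + (\<phi> (Suc ?y) - \<phi> ?y)" by simp
      then have "(of_nat (\<phi> (Suc ?y)) :: ennreal) = of_nat (\<phi> ?y) + of_nat (\<phi> (Suc ?y) - \<phi> ?y)"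
        by (metis of_nat_add)
      then show ?thesis by (auto simp: indicator_def)
    qed
    finally show "(\<integral>\<^sup>+T'. of_nat (\<phi> (excess s T' g)) \<partial>measure_pmf (split_overfull (Suc n) b s s\<^sub>0 s\<^sub>1 V (T @ [w])))
      \<le> of_nat (\<phi> ?y) + of_nat (\<phi> (Suc ?y) - \<phi> ?y) * indicator {w. prefix ([] @ g) w} w" .
  qed
  also have "\<dots> = of_nat (\<phi> ?y) + of_nat (\<phi> (Suc ?y) - \<phi> ?y) * emeasure (measure_pmf (descend b V T [])) {w. prefix ([] @ g) w}"
    by (subst nn_integral_add) (auto simp: nn_integral_cmult_indicator measure_pmf.emeasure_space_1)
  also have "\<dots> \<le> of_nat (\<phi> ?y) + of_nat (\<phi> (Suc ?y) - \<phi> ?y) * ennreal (path_prob b V [] g)"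
    by (intro add_left_mono mult_left_mono emeasure_descend_le) auto
  finally show "(\<integral>\<^sup>+w. \<integral>\<^sup>+T'. of_nat (\<phi> (excess s T' g)) \<partial>measure_pmf (split_overfull (Suc n) b s s\<^sub>0 s\<^sub>1 V (T @ [w]))
        \<partial>measure_pmf (descend b V T []))
    \<le> of_nat (\<phi> ?y) + of_nat (\<phi> (Suc ?y) - \<phi> ?y) * ennreal (path_prob b V [] g)" .
qed

lemma nn_integral_excess_le:
  "(\<integral>\<^sup>+T. of_nat (excess s T g) \<partial>measure_pmf (split_tree_given b s s\<^sub>0 s\<^sub>1 V n))
    \<le> of_nat n * ennreal (path_prob b V [] g)"
proof (induction n)
  case 0
  then show ?case by (simp add: excess_def subtree_size_def)
next
  case (Suc n)
  have "(\<integral>\<^sup>+T. of_nat (excess s T g) \<partial>measure_pmf (split_tree_given b s s\<^sub>0 s\<^sub>1 V (Suc n)))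
    \<le> (\<integral>\<^sup>+T. of_nat (excess s T g) + of_nat (Suc (excess s T g) - excess s T g) * ennreal (path_prob b V [] g)
        \<partial>measure_pmf (split_tree_given b s s\<^sub>0 s\<^sub>1 V n))"
    by (rule nn_integral_split_tree_given_Suc_le[of "\<lambda>y. y"]) (simp add: mono_def)
  also have "\<dots> = (\<integral>\<^sup>+T. of_nat (excess s T g) \<partial>measure_pmf (split_tree_given b s s\<^sub>0 s\<^sub>1 V n)) + ennreal (path_prob b V [] g)"
    by (simp add: nn_integral_add measure_pmf.emeasure_space_1 Suc_diff_le)
  also have "\<dots> \<le> of_nat n * ennreal (path_prob b V [] g) + ennreal (path_prob b V [] g)"
    using Suc by (rule add_right_mono)
  also have "\<dots> = of_nat (Suc n) * ennreal (path_prob b V [] g)"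
    by (simp add: algebra_simps)
  finally show ?case .
qed

text \<open>The increment of y (y - 1) is 2 y, so the first moment closes the recursion, and n^2 + 2
  n is at most (n + 1)^2.\<close>

lemma nn_integral_excess_pairs_le:
  "(\<integral>\<^sup>+T. of_nat (excess s T g * (excess s T g - 1)) \<partial>measure_pmf (split_tree_given b s s\<^sub>0 s\<^sub>1 V n))
    \<le> of_nat (n * n) * (ennreal (path_prob b V [] g))\<^sup>2"
proof (induction n)
  case 0
  then show ?case by (simp add: excess_def subtree_size_def)
next
  case (Suc n)
  let ?L = "ennreal (path_prob b V [] g)" and ?M = "measure_pmf (split_tree_given b s s\<^sub>0 s\<^sub>1 V n)"
  have mono: "mono (\<lambda>y. y * (y - 1) :: nat)" by (auto simp: mono_def intro!: mult_le_mono)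
  have diff: "Suc y * (Suc y - 1) - y * (y - 1) = 2 * y" for y :: nat
    by (cases y) (auto simp: algebra_simps)
  have "(\<integral>\<^sup>+T. of_nat (excess s T g * (excess s T g - 1)) \<partial>measure_pmf (split_tree_given b s s\<^sub>0 s\<^sub>1 V (Suc n)))
    \<le> (\<integral>\<^sup>+T. of_nat (excess s T g * (excess s T g - 1)) + of_nat (2 * excess s T g) * ?L \<partial>?M)"
    using nn_integral_split_tree_given_Suc_le[OF mono, where g = g and V = V and n = n] unfolding diff .
  also have "\<dots> = (\<integral>\<^sup>+T. of_nat (excess s T g * (excess s T g - 1)) \<partial>?M) + (\<integral>\<^sup>+T. (2 * ?L) * of_nat (excess s T g) \<partial>?M)"
    by (subst nn_integral_add) (auto simp: mult_ac)
  also have "(\<integral>\<^sup>+T. (2 * ?L) * of_nat (excess s T g) \<partial>?M) = 2 * ?L * (\<integral>\<^sup>+T. of_nat (excess s T g) \<partial>?M)"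
    by (intro nn_integral_cmult) auto
  also have "(\<integral>\<^sup>+T. of_nat (excess s T g * (excess s T g - 1)) \<partial>?M) + 2 * ?L * (\<integral>\<^sup>+T. of_nat (excess s T g) \<partial>?M)
      \<le> of_nat (n * n) * ?L\<^sup>2 + 2 * ?L * (of_nat n * ?L)"
    by (intro add_mono mult_left_mono Suc nn_integral_excess_le) auto
  also have "\<dots> = of_nat (n * n + 2 * n) * ?L\<^sup>2"
    by (simp add: power2_eq_square algebra_simps)
  also have "\<dots> \<le> of_nat (Suc n * Suc n) * ?L\<^sup>2"
    by (intro mult_right_mono of_nat_mono) auto
  finally show ?case .
qed

end

subsection \<open>Averaging over the split vectors\<close>

definition excess_pairs :: "nat \<Rightarrow> nat \<Rightarrow> nat \<Rightarrow> split_tree \<Rightarrow> real" where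
  "excess_pairs b s j T = (\<Sum>g | set g \<subseteq> {..<b} \<and> length g = j. real (excess s T g * (excess s T g - 1)))"

text \<open>A generating function in the level. The range covers all occupied levels of a regular
  tree, whose depths are less than the number of balls.\<close>

definition weighted_excess :: "nat \<Rightarrow> nat \<Rightarrow> real \<Rightarrow> split_tree \<Rightarrow> real" where
  "weighted_excess b s x T = (\<Sum>j\<le>length T. x ^ j * excess_pairs b s j T)"

lemma inj_on_take: "inj_on (\<lambda>i. take i xs) {..<length xs}"
proof (rule inj_onI)
  fix i j assume ij: "i \<in> {..<length xs}" "j \<in> {..<length xs}" "take i xs = take j xs"
  then have "length (take i xs) = length (take j xs)" by (simp only:)
  then show "i = j" using ij(1,2) by simp
qed

lemma path_prob_eq_prod:
  "path_prob b V u h = (\<Prod>i<length h. pmf (child_pmf b (V (u @ take i h))) (h ! i))"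
proof (induction h arbitrary: u)
  case (Cons i h)
  have "(\<Prod>j<length (i # h). pmf (child_pmf b (V (u @ take j (i # h)))) ((i # h) ! j))
      = pmf (child_pmf b (V u)) i * (\<Prod>j<length h. pmf (child_pmf b (V ((u @ [i]) @ take j h))) (h ! j))"
    by (simp only: list.size(4) prod.lessThan_Suc_shift take_0 append_Nil2 nth_Cons_0 take_Suc_Cons nth_Cons_Suc append_Cons append_assoc append_Nil Suc_eq_plus1[symmetric] add_0_right add_Suc_right One_nat_def)
  then show ?case using Cons.IH[of "u @ [i]"] by simp
qed simp

context
  fixes \<nu> :: "(nat \<Rightarrow> real) measure" and b :: nat
  assumes prob: "prob_space \<nu>" and sets_\<nu>: "sets \<nu> = sets (PiM {..<b} (\<lambda>_. borel))"
begin

interpretation P: product_prob_space "\<lambda>_::node. \<nu>" UNIV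
  using prob by (intro product_prob_spaceI) auto

lemma measurable_child_pmf_single: "(\<lambda>v. pmf (child_pmf b v) i) \<in> borel_measurable \<nu>"
proof -
  have comp: "(\<lambda>v. v i) \<in> borel_measurable \<nu>" if "i < b" for i
    using that measurable_component_singleton[of i "{..<b}" "\<lambda>_. borel"]
    by (simp add: measurable_cong_sets[OF sets_\<nu> refl])
  have "Measurable.pred \<nu> (\<lambda>v. \<forall>i\<in>{..<b}. 0 \<le> v i)"
  proof (rule pred_intros_finite(3))
    fix i assume "i \<in> {..<b}"
    then show "Measurable.pred \<nu> (\<lambda>v. 0 \<le> v i)"
      unfolding pred_def by (intro borel_measurable_le borel_measurable_const comp) simp
  qed simp
  moreover have "Measurable.pred \<nu> (\<lambda>v. (\<Sum>i<b. v i) = 1)"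
    unfolding pred_def by (intro borel_measurable_eq borel_measurable_sum borel_measurable_const comp) simp
  ultimately have "Measurable.pred \<nu> (\<lambda>v. (\<forall>i\<in>{..<b}. 0 \<le> v i) \<and> (\<Sum>i<b. v i) = 1)"
    by (rule pred_intros_logic(3))
  moreover have "(\<lambda>v. if i < b then v i else 0) \<in> borel_measurable \<nu>"
    by (cases "i < b") (simp_all add: comp)
  ultimately have "(\<lambda>v. if (\<forall>i\<in>{..<b}. 0 \<le> v i) \<and> (\<Sum>i<b. v i) = 1
      then (if i < b then v i else 0) else of_bool (i = 0)) \<in> borel_measurable \<nu>"
    unfolding pred_def by (rule measurable_If[OF _ borel_measurable_const, rotated])
  then show ?thesis by (simp only: pmf_child_pmf Ball_def lessThan_iff)
qed

lemma measurable_child_pmf_square: "(\<lambda>v. (ennreal (pmf (child_pmf b v) i))\<^sup>2) \<in> borel_measurable \<nu>"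
  unfolding power2_eq_square
  by (intro borel_measurable_times_ennreal measurable_compose[OF measurable_child_pmf_single measurable_ennreal])

text \<open>The integrand involves only the coordinates in \<open>J\<close>, so the infinite product
  measure can be projected to a finite one.\<close>

lemma nn_integral_PiM_prod:
  assumes J: "finite J" and f: "\<And>u. u \<in> J \<Longrightarrow> f u \<in> borel_measurable \<nu>"
  shows "(\<integral>\<^sup>+V. (\<Prod>u\<in>J. f u (V u)) \<partial>PiM UNIV (\<lambda>_::node. \<nu>)) = (\<Prod>u\<in>J. \<integral>\<^sup>+v. f u v \<partial>\<nu>)"
proof -
  have meas: "(\<lambda>V. \<Prod>u\<in>J. f u (V u)) \<in> borel_measurable (PiM J (\<lambda>_. \<nu>))"
    using f by (intro borel_measurable_prod_ennreal measurable_compose[OF measurable_component_singleton]) auto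
  have "(\<integral>\<^sup>+V. (\<Prod>u\<in>J. f u (V u)) \<partial>PiM UNIV (\<lambda>_::node. \<nu>))
      = (\<integral>\<^sup>+V. (\<Prod>u\<in>J. f u (restrict V J u)) \<partial>PiM UNIV (\<lambda>_::node. \<nu>))"
    by simp
  also have "\<dots> = (\<integral>\<^sup>+V. (\<Prod>u\<in>J. f u (V u)) \<partial>distr (PiM UNIV (\<lambda>_. \<nu>)) (PiM J (\<lambda>_. \<nu>)) (\<lambda>V. restrict V J))"
    by (rule nn_integral_distr[symmetric], rule measurable_restrict_subset) (simp_all add: meas)
  also have "\<dots> = (\<integral>\<^sup>+V. (\<Prod>u\<in>J. f u (V u)) \<partial>PiM J (\<lambda>_. \<nu>))"
    using P.distr_PiM_restrict_finite[OF J] by simp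
  also have "\<dots> = (\<Prod>u\<in>J. \<integral>\<^sup>+v. f u v \<partial>\<nu>)"
    using f by (intro P.product_nn_integral_prod J)
  finally show ?thesis .
qed

text \<open>The factors sit at the distinct proper prefixes of \<open>g\<close> and are independent;
  \<open>g ! length u\<close> is the child taken at the prefix \<open>u\<close>.\<close>

lemma nn_integral_path_prob:
  "(\<integral>\<^sup>+V. (ennreal (path_prob b V [] g))\<^sup>2 \<partial>PiM UNIV (\<lambda>_::node. \<nu>))
    = (\<Prod>i<length g. \<integral>\<^sup>+v. (ennreal (pmf (child_pmf b v) (g ! i)))\<^sup>2 \<partial>\<nu>)"
proof -
  let ?J = "(\<lambda>i. take i g) ` {..<length g}"
  have inj: "inj_on (\<lambda>i. take i g) {..<length g}" by (rule inj_on_take)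
  have "(ennreal (path_prob b V [] g))\<^sup>2 = (\<Prod>u\<in>?J. (ennreal (pmf (child_pmf b (V u)) (g ! length u)))\<^sup>2)" for V
  proof -
    have "(ennreal (path_prob b V [] g))\<^sup>2 = (\<Prod>i<length g. ennreal (pmf (child_pmf b (V (take i g))) (g ! i)))\<^sup>2"
      unfolding path_prob_eq_prod by (simp add: prod_ennreal)
    also have "\<dots> = (\<Prod>i<length g. (ennreal (pmf (child_pmf b (V (take i g))) (g ! i)))\<^sup>2)"
      by (simp add: prod_power_distrib)
    also have "\<dots> = (\<Prod>u\<in>?J. (ennreal (pmf (child_pmf b (V u)) (g ! length u)))\<^sup>2)"
      by (subst prod.reindex[OF inj]) simp
    finally show ?thesis .
  qed
  then have "(\<integral>\<^sup>+V. (ennreal (path_prob b V [] g))\<^sup>2 \<partial>PiM UNIV (\<lambda>_::node. \<nu>))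
      = (\<integral>\<^sup>+V. (\<Prod>u\<in>?J. (ennreal (pmf (child_pmf b (V u)) (g ! length u)))\<^sup>2) \<partial>PiM UNIV (\<lambda>_::node. \<nu>))"
    by simp
  also have "\<dots> = (\<Prod>u\<in>?J. \<integral>\<^sup>+v. (ennreal (pmf (child_pmf b v) (g ! length u)))\<^sup>2 \<partial>\<nu>)"
    by (intro nn_integral_PiM_prod[where f = "\<lambda>u v. (ennreal (pmf (child_pmf b v) (g ! length u)))\<^sup>2"]
        measurable_child_pmf_square) simp
  also have "\<dots> = (\<Prod>i<length g. \<integral>\<^sup>+v. (ennreal (pmf (child_pmf b v) (g ! i)))\<^sup>2 \<partial>\<nu>)"
    by (subst prod.reindex[OF inj]) simp
  finally show ?thesis .
qed

context
  assumes valid: "AE v in \<nu>. (\<forall>i<b. 0 \<le> v i) \<and> (\<Sum>i<b. v i) = 1"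
    and ident: "\<And>i j. i < b \<Longrightarrow> j < b \<Longrightarrow> distr \<nu> borel (\<lambda>v. v i) = distr \<nu> borel (\<lambda>v. v j)"
    and nontriv: "\<P>(v in \<nu>. \<exists>i<b. v i = 1) < 1"
    and b: "1 \<le> b"
begin

lemma component_measurable: "i < b \<Longrightarrow> (\<lambda>v. v i) \<in> borel_measurable \<nu>"
  using measurable_component_singleton[of i "{..<b}" "\<lambda>_. borel"]
  by (simp add: measurable_cong_sets[OF sets_\<nu> refl])

lemma second_moment_cong:
  assumes "i < b"
  shows "(\<integral>\<^sup>+v. (ennreal (pmf (child_pmf b v) i))\<^sup>2 \<partial>\<nu>) = (\<integral>\<^sup>+v. (ennreal (v 0))\<^sup>2 \<partial>\<nu>)"
proof -
  have "(\<integral>\<^sup>+v. (ennreal (pmf (child_pmf b v) i))\<^sup>2 \<partial>\<nu>) = (\<integral>\<^sup>+v. (ennreal (v i))\<^sup>2 \<partial>\<nu>)"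
  proof (rule nn_integral_cong_AE, rule eventually_mono[OF valid])
    fix v :: "nat \<Rightarrow> real" assume "(\<forall>i<b. 0 \<le> v i) \<and> (\<Sum>i<b. v i) = 1"
    then show "(ennreal (pmf (child_pmf b v) i))\<^sup>2 = (ennreal (v i))\<^sup>2"
      by (simp add: pmf_child_pmf assms)
  qed
  also have "\<dots> = (\<integral>\<^sup>+x. (ennreal x)\<^sup>2 \<partial>distr \<nu> borel (\<lambda>v. v i))"
    by (subst nn_integral_distr) (auto simp: component_measurable assms)
  also have "\<dots> = (\<integral>\<^sup>+x. (ennreal x)\<^sup>2 \<partial>distr \<nu> borel (\<lambda>v. v 0))"
    using ident[OF assms, of 0] b by simp
  also have "\<dots> = (\<integral>\<^sup>+v. (ennreal (v 0))\<^sup>2 \<partial>\<nu>)"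
    by (subst nn_integral_distr) (use b in \<open>auto simp: component_measurable\<close>)
  finally show ?thesis .
qed

text \<open>The sum \<open>Q\<close> of the squared components is at most the sum of the components,
  which is 1, with equality only if some component is 1. Mean 1 would force \<open>Q = 1\<close>
  almost everywhere, against \<open>nontriv\<close>.\<close>

lemma second_moment_lt1: "of_nat b * (\<integral>\<^sup>+v. (ennreal (v 0))\<^sup>2 \<partial>\<nu>) < 1"
proof -
  define Q where "Q v = (\<Sum>i<b. (v i)\<^sup>2)" for v :: "nat \<Rightarrow> real"
  have Qm: "Q \<in> borel_measurable \<nu>"
    unfolding Q_def by (intro borel_measurable_sum borel_measurable_power component_measurable) simp
  have AEle: "AE v in \<nu>. 0 \<le> Q v \<and> Q v \<le> 1 \<and> (Q v = 1 \<longrightarrow> (\<exists>i<b. v i = 1))"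
    using valid
  proof (rule eventually_mono)
    fix v :: "nat \<Rightarrow> real" assume v: "(\<forall>i<b. 0 \<le> v i) \<and> (\<Sum>i<b. v i) = 1"
    have le1: "v i \<le> 1" if "i < b" for i
      using member_le_sum[of i "{..<b}" v] v that by auto
    have sq: "(v i)\<^sup>2 \<le> v i" if "i < b" for i
      using mult_left_mono[OF le1[OF that], of "v i"] v that by (simp add: power2_eq_square)
    have "Q v \<le> (\<Sum>i<b. v i)" unfolding Q_def using sq by (intro sum_mono) auto
    moreover have "\<exists>i<b. v i = 1" if "Q v = 1"
    proof (rule ccontr)
      assume no: "\<not> (\<exists>i<b. v i = 1)"
      obtain i where i: "i < b" "v i \<noteq> 0"
        using v by (metis lessThan_iff sum.not_neutral_contains_not_neutral zero_neq_one)
      then have "v i * v i < v i * 1" using v le1[OF i(1)] no by (intro mult_strict_left_mono) (auto simp: less_le)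
      then have "Q v < (\<Sum>i<b. v i)"
        unfolding Q_def using sq i by (intro sum_strict_mono_ex1) (auto simp: power2_eq_square)
      then show False using that v by simp
    qed
    moreover have "0 \<le> Q v" unfolding Q_def by (intro sum_nonneg) simp
    ultimately show "0 \<le> Q v \<and> Q v \<le> 1 \<and> (Q v = 1 \<longrightarrow> (\<exists>i<b. v i = 1))" using v by auto
  qed
  have "of_nat b * (\<integral>\<^sup>+v. (ennreal (v 0))\<^sup>2 \<partial>\<nu>) = (\<Sum>i<b. \<integral>\<^sup>+v. (ennreal (v 0))\<^sup>2 \<partial>\<nu>)" by simp
  also have "\<dots> = (\<Sum>i<b. \<integral>\<^sup>+v. (ennreal (pmf (child_pmf b v) i))\<^sup>2 \<partial>\<nu>)"
    by (intro sum.cong refl second_moment_cong[symmetric]) simp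
  also have "\<dots> = (\<integral>\<^sup>+v. (\<Sum>i<b. (ennreal (pmf (child_pmf b v) i))\<^sup>2) \<partial>\<nu>)"
    by (intro nn_integral_sum[symmetric] measurable_child_pmf_square)
  also have "\<dots> = (\<integral>\<^sup>+v. ennreal (Q v) \<partial>\<nu>)"
  proof (rule nn_integral_cong_AE, rule eventually_mono[OF valid])
    fix v :: "nat \<Rightarrow> real" assume v: "(\<forall>i<b. 0 \<le> v i) \<and> (\<Sum>i<b. v i) = 1"
    have "(\<Sum>i<b. (ennreal (pmf (child_pmf b v) i))\<^sup>2) = (\<Sum>i<b. ennreal ((v i)\<^sup>2))"
      using v by (intro sum.cong refl) (auto simp: pmf_child_pmf ennreal_power)
    also have "\<dots> = ennreal (Q v)" unfolding Q_def by (rule sum_ennreal) simp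
    finally show "(\<Sum>i<b. (ennreal (pmf (child_pmf b v) i))\<^sup>2) = ennreal (Q v)" .
  qed
  also have "\<dots> < 1"
  proof (rule ccontr)
    assume "\<not> (\<integral>\<^sup>+v. ennreal (Q v) \<partial>\<nu>) < 1"
    then have ge: "1 \<le> (\<integral>\<^sup>+v. ennreal (Q v) \<partial>\<nu>)" by (simp add: not_less)
    have int: "(\<integral>\<^sup>+v. ennreal (Q v) \<partial>\<nu>) \<le> 1"
    proof -
      have "(\<integral>\<^sup>+v. ennreal (Q v) \<partial>\<nu>) \<le> (\<integral>\<^sup>+v. 1 \<partial>\<nu>)"
        by (rule nn_integral_mono_AE, rule eventually_mono[OF AEle]) simp
      then show ?thesis by (simp add: prob_space.emeasure_space_1[OF prob])
    qed
    have sum1: "(\<integral>\<^sup>+v. ennreal (Q v) \<partial>\<nu>) + (\<integral>\<^sup>+v. ennreal (1 - Q v) \<partial>\<nu>) = 1"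
    proof -
      have "(\<integral>\<^sup>+v. ennreal (Q v) \<partial>\<nu>) + (\<integral>\<^sup>+v. ennreal (1 - Q v) \<partial>\<nu>) = (\<integral>\<^sup>+v. ennreal (Q v) + ennreal (1 - Q v) \<partial>\<nu>)"
        using Qm by (intro nn_integral_add[symmetric]) auto
      also have "\<dots> = (\<integral>\<^sup>+v. 1 \<partial>\<nu>)"
        by (rule nn_integral_cong_AE, rule eventually_mono[OF AEle]) (simp flip: ennreal_plus)
      finally show ?thesis by (simp add: prob_space.emeasure_space_1[OF prob])
    qed
    have "(\<integral>\<^sup>+v. ennreal (Q v) \<partial>\<nu>) = 1" using ge int by (rule antisym[rotated])
    then have "1 + (\<integral>\<^sup>+v. ennreal (1 - Q v) \<partial>\<nu>) = 1 + 0" using sum1 by simp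
    then have "(\<integral>\<^sup>+v. ennreal (1 - Q v) \<partial>\<nu>) = 0"
      unfolding ennreal_add_left_cancel by simp
    then have "AE v in \<nu>. ennreal (1 - Q v) = 0"
      using Qm by (subst (asm) nn_integral_0_iff_AE) auto
    then have AE1: "AE v in \<nu>. \<exists>i<b. v i = 1"
      using AEle
    proof eventually_elim
      fix v assume *: "ennreal (1 - Q v) = 0" "0 \<le> Q v \<and> Q v \<le> 1 \<and> (Q v = 1 \<longrightarrow> (\<exists>i<b. v i = 1))"
      then have "Q v = 1" unfolding ennreal_eq_0_iff by linarith
      then show "\<exists>i<b. v i = 1" using * by blast
    qed
    have "\<P>(v in \<nu>. \<exists>i<b. v i = 1) = 1"
    proof (rule prob_space.prob_Collect_eq_1[OF prob, THEN iffD2, OF _ AE1])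
      have "Measurable.pred \<nu> (\<lambda>v. \<exists>i\<in>{..<b}. v i = 1)"
      proof (rule pred_intros_finite(4))
        fix i assume "i \<in> {..<b}"
        then show "Measurable.pred \<nu> (\<lambda>v. v i = 1)"
          unfolding pred_def by (intro borel_measurable_eq borel_measurable_const component_measurable) simp
      qed simp
      then show "{v \<in> space \<nu>. \<exists>i<b. v i = 1} \<in> sets \<nu>"
        by (simp only: pred_def Bex_def lessThan_iff)
    qed
    then show False using nontriv by simp
  qed
  finally show ?thesis .
qed

text \<open>By identical distribution this is the expected sum of the squared components, the ratio
  q by which the sum of expected squared path probabilities shrinks per level.\<close>

definition mean_square :: real where
  "mean_square = enn2real (of_nat b * (\<integral>\<^sup>+v. (ennreal (v 0))\<^sup>2 \<partial>\<nu>))"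

lemma mean_square: "0 \<le> mean_square" "mean_square < 1"
  "ennreal mean_square = of_nat b * (\<integral>\<^sup>+v. (ennreal (v 0))\<^sup>2 \<partial>\<nu>)"
proof -
  have fin: "of_nat b * (\<integral>\<^sup>+v. (ennreal (v 0))\<^sup>2 \<partial>\<nu>) < top"
    using second_moment_lt1 by (rule order.strict_trans) simp
  show "0 \<le> mean_square" by (simp add: mean_square_def)
  show eq: "ennreal mean_square = of_nat b * (\<integral>\<^sup>+v. (ennreal (v 0))\<^sup>2 \<partial>\<nu>)"
    unfolding mean_square_def using fin by (intro ennreal_enn2real)
  then have "ennreal mean_square < ennreal 1" using second_moment_lt1 by simp
  then show "mean_square < 1" by (simp add: ennreal_less_iff mean_square_def)
qed

text \<open>Identical distribution gives each of the b^j paths the same expectation, the j-th power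
  of one second moment.\<close>

lemma sum_nn_integral_path_prob:
  "(\<Sum>g | set g \<subseteq> {..<b} \<and> length g = j. \<integral>\<^sup>+V. (ennreal (path_prob b V [] g))\<^sup>2 \<partial>PiM UNIV (\<lambda>_::node. \<nu>))
    = ennreal (mean_square ^ j)"
proof -
  let ?e = "\<integral>\<^sup>+v. (ennreal (v 0))\<^sup>2 \<partial>\<nu>"
  have "(\<Sum>g | set g \<subseteq> {..<b} \<and> length g = j. \<integral>\<^sup>+V. (ennreal (path_prob b V [] g))\<^sup>2 \<partial>PiM UNIV (\<lambda>_::node. \<nu>))
    = (\<Sum>g | set g \<subseteq> {..<b} \<and> length g = j. ?e ^ j)"
  proof (rule sum.cong[OF refl])
    fix g assume g: "g \<in> {g. set g \<subseteq> {..<b} \<and> length g = j}"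
    have "(\<Prod>i<length g. \<integral>\<^sup>+v. (ennreal (pmf (child_pmf b v) (g ! i)))\<^sup>2 \<partial>\<nu>) = (\<Prod>i<length g. ?e)"
      using g by (intro prod.cong refl second_moment_cong) (auto dest!: nth_mem)
    then show "(\<integral>\<^sup>+V. (ennreal (path_prob b V [] g))\<^sup>2 \<partial>PiM UNIV (\<lambda>_::node. \<nu>)) = ?e ^ j"
      using g unfolding nn_integral_path_prob by simp
  qed
  also have "\<dots> = of_nat (b ^ j) * ?e ^ j"
    by (simp add: card_lists_length_eq)
  also have "\<dots> = (of_nat b * ?e) ^ j" by (simp add: power_mult_distrib)
  also have "\<dots> = ennreal (mean_square ^ j)"
    unfolding mean_square(3)[symmetric] using mean_square(1) by (simp add: ennreal_power)
  finally show ?thesis .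
qed

section \<open>Expectation of the weighted excess\<close>

context
  fixes s s\<^sub>0 s\<^sub>1 :: nat
  assumes s: "1 \<le> s\<^sub>0" "s\<^sub>0 \<le> s" and bs: "b * s\<^sub>1 \<le> s + 1 - s\<^sub>0"
begin

lemma split_tree_kernel:
  "(\<lambda>V. measure_pmf (split_tree_given b s s\<^sub>0 s\<^sub>1 V n))
    \<in> PiM UNIV (\<lambda>_::node. \<nu>) \<rightarrow>\<^sub>M subprob_algebra (count_space UNIV)"
  by (intro measurable_prob_algebraD measurable_pmfI measurable_split_tree_given sets_\<nu>)

lemma nn_integral_random_split_tree:
  "(\<integral>\<^sup>+T. f T \<partial>random_split_tree b s s\<^sub>0 s\<^sub>1 \<nu> n)
    = (\<integral>\<^sup>+V. \<integral>\<^sup>+T. f T \<partial>measure_pmf (split_tree_given b s s\<^sub>0 s\<^sub>1 V n) \<partial>PiM UNIV (\<lambda>_::node. \<nu>))"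
  unfolding random_split_tree_def
  by (rule nn_integral_bind[where B = "count_space UNIV"]) (auto intro: split_tree_kernel)

text \<open>Integrating over the tree first and over the split vectors afterwards leaves n^2 times a
  geometric sum of ratio \<open>x * mean_square\<close>, bounded independently of the number of
  levels.\<close>

lemma nn_integral_weighted_excess_le:
  assumes x: "0 \<le> x" "x * mean_square < 1"
  shows "(\<integral>\<^sup>+T. ennreal (weighted_excess b s x T) \<partial>random_split_tree b s s\<^sub>0 s\<^sub>1 \<nu> n)
    \<le> ennreal (real (n * n) / (1 - x * mean_square))"
proof -
  let ?P = "PiM UNIV (\<lambda>_::node. \<nu>)"
  let ?G = "\<lambda>j. {g. set g \<subseteq> {..<b} \<and> length g = j}"
  have finG: "finite (?G j)" for j by (rule finite_lists_length_eq) simp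
  have meas: "(\<lambda>V. ennreal (path_prob b V [] g)) \<in> borel_measurable ?P" for g
    unfolding path_prob_eq_prod
    by (intro measurable_compose[OF _ measurable_ennreal] borel_measurable_prod measurable_child_pmf sets_\<nu>)
  have "(\<integral>\<^sup>+T. ennreal (weighted_excess b s x T) \<partial>measure_pmf (split_tree_given b s s\<^sub>0 s\<^sub>1 V n))
      \<le> (\<Sum>j\<le>n. ennreal (x ^ j) * (\<Sum>g\<in>?G j. of_nat (n * n) * (ennreal (path_prob b V [] g))\<^sup>2))" for V
  proof -
    have "(\<integral>\<^sup>+T. ennreal (weighted_excess b s x T) \<partial>measure_pmf (split_tree_given b s s\<^sub>0 s\<^sub>1 V n))
      = (\<integral>\<^sup>+T. (\<Sum>j\<le>n. ennreal (x ^ j) * (\<Sum>g\<in>?G j. of_nat (excess s T g * (excess s T g - 1))))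
          \<partial>measure_pmf (split_tree_given b s s\<^sub>0 s\<^sub>1 V n))"
    proof (rule nn_integral_cong_AE, unfold AE_measure_pmf_iff, intro ballI)
      fix T assume "T \<in> set_pmf (split_tree_given b s s\<^sub>0 s\<^sub>1 V n)"
      then have n: "length T = n" using set_pmf_split_tree_given[OF b s bs] by blast
      have "ennreal (weighted_excess b s x T) = (\<Sum>j\<le>n. ennreal (x ^ j * excess_pairs b s j T))"
        unfolding weighted_excess_def n using x
        by (intro sum_ennreal[symmetric] mult_nonneg_nonneg) (auto simp: excess_pairs_def intro!: sum_nonneg)
      also have "\<dots> = (\<Sum>j\<le>n. ennreal (x ^ j) * (\<Sum>g\<in>?G j. of_nat (excess s T g * (excess s T g - 1))))"
      proof (rule sum.cong[OF refl])
        fix j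
        have "ennreal (excess_pairs b s j T) = (\<Sum>g\<in>?G j. ennreal (real (excess s T g * (excess s T g - 1))))"
          unfolding excess_pairs_def by (rule sum_ennreal[symmetric]) simp
        also have "\<dots> = (\<Sum>g\<in>?G j. of_nat (excess s T g * (excess s T g - 1)))"
          by (simp only: ennreal_of_nat_eq_real_of_nat)
        finally show "ennreal (x ^ j * excess_pairs b s j T)
            = ennreal (x ^ j) * (\<Sum>g\<in>?G j. of_nat (excess s T g * (excess s T g - 1)))"
          using x by (subst ennreal_mult) (auto simp: excess_pairs_def intro!: sum_nonneg)
      qed
      finally show "ennreal (weighted_excess b s x T)
          = (\<Sum>j\<le>n. ennreal (x ^ j) * (\<Sum>g\<in>?G j. of_nat (excess s T g * (excess s T g - 1))))" .
    qed
    also have "\<dots> = (\<Sum>j\<le>n. ennreal (x ^ j) * (\<Sum>g\<in>?G j. \<integral>\<^sup>+T. of_nat (excess s T g * (excess s T g - 1))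
          \<partial>measure_pmf (split_tree_given b s s\<^sub>0 s\<^sub>1 V n)))"
      by (subst nn_integral_sum, simp, intro sum.cong refl, subst nn_integral_cmult, simp,
          intro arg_cong2[where f = "(*)"] refl, subst nn_integral_sum, simp, rule refl)
    also have "\<dots> \<le> (\<Sum>j\<le>n. ennreal (x ^ j) * (\<Sum>g\<in>?G j. of_nat (n * n) * (ennreal (path_prob b V [] g))\<^sup>2))"
      by (intro sum_mono mult_left_mono nn_integral_excess_pairs_le[OF b s bs]) simp
    finally show ?thesis .
  qed
  then have "(\<integral>\<^sup>+T. ennreal (weighted_excess b s x T) \<partial>random_split_tree b s s\<^sub>0 s\<^sub>1 \<nu> n)
      \<le> (\<integral>\<^sup>+V. (\<Sum>j\<le>n. ennreal (x ^ j) * (\<Sum>g\<in>?G j. of_nat (n * n) * (ennreal (path_prob b V [] g))\<^sup>2)) \<partial>?P)"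
    unfolding nn_integral_random_split_tree by (intro nn_integral_mono)
  also have "\<dots> = (\<Sum>j\<le>n. ennreal (x ^ j) * (\<Sum>g\<in>?G j. of_nat (n * n) * (\<integral>\<^sup>+V. (ennreal (path_prob b V [] g))\<^sup>2 \<partial>?P)))"
    using meas by (simp add: nn_integral_sum nn_integral_cmult)
  also have "\<dots> = (\<Sum>j\<le>n. of_nat (n * n) * (ennreal (x ^ j) * ennreal (mean_square ^ j)))"
  proof (rule sum.cong[OF refl])
    fix j
    have "(\<Sum>g\<in>?G j. of_nat (n * n) * (\<integral>\<^sup>+V. (ennreal (path_prob b V [] g))\<^sup>2 \<partial>?P)) = of_nat (n * n) * ennreal (mean_square ^ j)"
      unfolding sum_distrib_left[symmetric] sum_nn_integral_path_prob ..
    then show "ennreal (x ^ j) * (\<Sum>g\<in>?G j. of_nat (n * n) * (\<integral>\<^sup>+V. (ennreal (path_prob b V [] g))\<^sup>2 \<partial>?P))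
        = of_nat (n * n) * (ennreal (x ^ j) * ennreal (mean_square ^ j))"
      by (simp only: mult.left_commute)
  qed
  also have "\<dots> = of_nat (n * n) * ennreal (\<Sum>j\<le>n. (x * mean_square) ^ j)"
    unfolding sum_distrib_left[symmetric] using x mean_square(1)
    by (subst sum_ennreal[symmetric]) (auto simp: power_mult_distrib ennreal_mult)
  also have "\<dots> \<le> of_nat (n * n) * ennreal (1 / (1 - x * mean_square))"
  proof (intro mult_left_mono ennreal_leI)
    have y: "0 \<le> x * mean_square" using x mean_square by simp
    have "(\<Sum>j\<le>n. (x * mean_square) ^ j) \<le> (\<Sum>j. (x * mean_square) ^ j)"
      using x y by (intro sum_le_suminf summable_geometric) auto
    also have "\<dots> = 1 / (1 - x * mean_square)" using x y by (intro suminf_geometric) auto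
    finally show "(\<Sum>j\<le>n. (x * mean_square) ^ j) \<le> 1 / (1 - x * mean_square)" .
  qed simp
  also have "\<dots> = ennreal (real (n * n) / (1 - x * mean_square))"
    using x by (simp add: ennreal_of_nat_eq_real_of_nat flip: ennreal_mult)
  finally show ?thesis .
qed

text \<open>Markov's inequality, carried out for given split vectors, where the possible trees are
  known to be regular with \<open>n\<close> balls; so \<open>A\<close> has to be shown for those
  only.\<close>

lemma prob_random_split_tree_ge:
  assumes x: "0 \<le> x" "x * mean_square < 1" and a: "0 < a"
    and A: "\<And>T. regular_tree b s T \<Longrightarrow> length T = n \<Longrightarrow> weighted_excess b s x T \<le> a \<Longrightarrow> A T"
  shows "1 - real (n * n) / ((1 - x * mean_square) * a) \<le> \<P>(T in random_split_tree b s s\<^sub>0 s\<^sub>1 \<nu> n. A T)"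
proof -
  let ?M = "random_split_tree b s s\<^sub>0 s\<^sub>1 \<nu> n"
  interpret M: prob_space ?M by (rule prob_space_random_split_tree[OF sets_\<nu> prob])
  have sets: "sets ?M = UNIV" by (rule prob_space_random_split_tree[OF sets_\<nu> prob])
  have sp: "space ?M = UNIV" using sets_eq_imp_space_eq[of ?M "count_space UNIV"] sets by simp
  let ?B = "{T. \<not> A T}"
  have "emeasure ?M ?B = (\<integral>\<^sup>+T. indicator ?B T \<partial>?M)"
    using sets by simp
  also have "\<dots> = (\<integral>\<^sup>+V. \<integral>\<^sup>+T. indicator ?B T \<partial>measure_pmf (split_tree_given b s s\<^sub>0 s\<^sub>1 V n) \<partial>PiM UNIV (\<lambda>_::node. \<nu>))"
    by (rule nn_integral_random_split_tree)
  also have "\<dots> \<le> (\<integral>\<^sup>+V. \<integral>\<^sup>+T. ennreal (1 / a) * ennreal (weighted_excess b s x T) \<partial>measure_pmf (split_tree_given b s s\<^sub>0 s\<^sub>1 V n) \<partial>PiM UNIV (\<lambda>_::node. \<nu>))"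
  proof (rule nn_integral_mono, rule nn_integral_mono_AE, unfold AE_measure_pmf_iff, intro ballI)
    fix V T assume "T \<in> set_pmf (split_tree_given b s s\<^sub>0 s\<^sub>1 V n)"
    then have T: "regular_tree b s T" "length T = n" using set_pmf_split_tree_given[OF b s bs] by blast+
    show "indicator ?B T \<le> ennreal (1 / a) * ennreal (weighted_excess b s x T)"
    proof (cases "A T")
      case False
      then have "a < weighted_excess b s x T" using A[OF T] by (meson not_le)
      then have "1 \<le> 1 / a * weighted_excess b s x T" using a by (simp add: field_simps)
      then have "ennreal 1 \<le> ennreal (1 / a * weighted_excess b s x T)" by (rule ennreal_leI)
      also have "\<dots> = ennreal (1 / a) * ennreal (weighted_excess b s x T)"
        using a by (intro ennreal_mult') simp
      finally show ?thesis using False by simp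
    qed simp
  qed
  also have "\<dots> = (\<integral>\<^sup>+T. ennreal (1 / a) * ennreal (weighted_excess b s x T) \<partial>?M)"
    by (rule nn_integral_random_split_tree[symmetric])
  also have "\<dots> = ennreal (1 / a) * (\<integral>\<^sup>+T. ennreal (weighted_excess b s x T) \<partial>?M)"
    by (rule nn_integral_cmult) (simp add: measurable_def sets)
  also have "\<dots> \<le> ennreal (1 / a) * ennreal (real (n * n) / (1 - x * mean_square))"
    by (intro mult_left_mono nn_integral_weighted_excess_le x) simp
  also have "\<dots> = ennreal (real (n * n) / ((1 - x * mean_square) * a))"
    using a x by (simp flip: ennreal_mult add: mult.commute)
  finally have "M.prob ?B \<le> real (n * n) / ((1 - x * mean_square) * a)"
    using a x by (simp add: M.emeasure_eq_measure)
  moreover have "M.prob {T. A T} = 1 - M.prob ?B"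
  proof -
    have "{T. A T} = space ?M - ?B" using sp by auto
    then show ?thesis using M.prob_compl[of ?B] sets by simp
  qed
  ultimately show ?thesis using sp by simp
qed

end

end

end

subsection \<open>Bounds for regular trees\<close>

lemma subtree_size_eq_card: "subtree_size T u = card {v \<in> balls T. prefix u (T ! v)}"
proof -
  have "subtree_size T u = length (filter (prefix u) T)"
    unfolding subtree_size_def by (metis mset_filter size_mset)
  then show ?thesis by (simp add: length_filter_conv_card)
qed

lemma regular_treeD:
  assumes "regular_tree b s T"
  shows "w \<in> set T \<Longrightarrow> set w \<subseteq> {..<b}" "count_list T u \<le> s"
    "internal T u \<Longrightarrow> 1 \<le> count_list T u" "internal T u \<Longrightarrow> s < subtree_size T u"
  using assms by (auto simp: regular_tree_def)

lemma count_list_ball: "1 \<le> count_list T u \<Longrightarrow> \<exists>v\<in>balls T. T ! v = u"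
  by (metis One_nat_def Suc_le_lessD count_list_0_iff in_set_conv_nth lessThan_iff less_irrefl)

text \<open>Every proper prefix of an occupied node is internal and so holds a ball, which is an
  ancestor of \<open>v\<close>.\<close>

lemma length_le_ball_depth:
  assumes reg: "regular_tree b s T" and v: "v \<in> balls T"
  shows "length (T ! v) \<le> ball_depth T v"
proof -
  have "(\<lambda>i. take i (T ! v)) ` {..<length (T ! v)} \<subseteq> (\<lambda>u. T ! u) ` ancestors T v"
  proof
    fix p assume "p \<in> (\<lambda>i. take i (T ! v)) ` {..<length (T ! v)}"
    then obtain i where i: "i < length (T ! v)" "p = take i (T ! v)" by auto
    then have p: "strict_prefix p (T ! v)"
      by (simp add: strict_prefix_def take_is_prefix)
    then have "internal T p" using v by (auto simp: internal_def)
    then obtain u where "u \<in> balls T" "T ! u = p"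
      using count_list_ball regular_treeD(3)[OF reg] by blast
    then show "p \<in> (\<lambda>u. T ! u) ` ancestors T v"
      using p by (auto simp: ancestors_def ball_less_def)
  qed
  moreover have "inj_on (\<lambda>i. take i (T ! v)) {..<length (T ! v)}" by (rule inj_on_take)
  ultimately have "length (T ! v) \<le> card ((\<lambda>u. T ! u) ` ancestors T v)"
    using card_mono[OF finite_imageI[OF finite_ancestors]] card_image by fastforce
  also have "\<dots> \<le> ball_depth T v"
    using card_image_le[OF finite_ancestors] by (simp add: card_ancestors)
  finally show ?thesis .
qed

lemma ball_depth_le:
  assumes s: "\<And>u. count_list T u \<le> s"
  shows "ball_depth T v \<le> s * length (T ! v)"
proof -
  have "ancestors T v \<subseteq> (\<Union>i<length (T ! v). {w \<in> balls T. T ! w = take i (T ! v)})"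
  proof
    fix u assume u: "u \<in> ancestors T v"
    then have "strict_prefix (T ! u) (T ! v)" by (auto simp: ancestors_def ball_less_def)
    then have "length (T ! u) < length (T ! v)" "T ! u = take (length (T ! u)) (T ! v)"
      by (auto simp: prefix_length_less strict_prefix_def prefix_def)
    then show "u \<in> (\<Union>i<length (T ! v). {w \<in> balls T. T ! w = take i (T ! v)})"
      using u by (auto simp: ancestors_def)
  qed
  then have "ball_depth T v \<le> card (\<Union>i<length (T ! v). {w \<in> balls T. T ! w = take i (T ! v)})"
    unfolding card_ancestors[symmetric] by (intro card_mono) auto
  also have "\<dots> \<le> (\<Sum>i<length (T ! v). card {w \<in> balls T. T ! w = take i (T ! v)})"
    by (intro card_UN_le) auto
  also have "\<dots> \<le> (\<Sum>i<length (T ! v). s)"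
    by (intro sum_mono card_node_le s)
  finally show ?thesis by (simp add: mult.commute)
qed

lemma ball_depth_less_length: "v \<in> balls T \<Longrightarrow> ball_depth T v < length T"
proof -
  assume v: "v \<in> balls T"
  have "ancestors T v \<subset> balls T"
    using v not_ball_less_self by (auto simp: ancestors_def)
  then have "card (ancestors T v) < card (balls T)" by (intro psubset_card_mono) auto
  then show ?thesis by (simp add: card_ancestors)
qed

text \<open>For \<open>2 \<le> b\<close> the geometric sum shows that at most \<open>b ^ h\<close>
  nodes have depth less than \<open>h\<close>.\<close>

lemma card_shallow_le:
  assumes reg: "regular_tree b s T" and b: "2 \<le> b"
  shows "card {v \<in> balls T. length (T ! v) < h} \<le> s * b ^ h"
proof -
  let ?N = "{u. set u \<subseteq> {..<b} \<and> length u < h}"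
  have N: "?N = (\<Union>j<h. {u. set u \<subseteq> {..<b} \<and> length u = j})" by auto
  have finN: "finite ?N" unfolding N by (auto intro!: finite_lists_length_eq)
  have "card ?N \<le> (\<Sum>j<h. card {u::node. set u \<subseteq> {..<b} \<and> length u = j})"
    unfolding N by (intro card_UN_le) auto
  also have "\<dots> = (\<Sum>j<h. b ^ j)" by (simp add: card_lists_length_eq)
  also have "\<dots> \<le> b ^ h"
  proof (induction h)
    case (Suc h)
    have "b ^ h + b ^ h \<le> b * b ^ h" using b by (metis mult_2 mult_le_mono1)
    then show ?case using Suc by simp
  qed simp
  finally have cN: "card ?N \<le> b ^ h" .
  have "{v \<in> balls T. length (T ! v) < h} \<subseteq> (\<Union>u\<in>?N. {w \<in> balls T. T ! w = u})"
    using regular_treeD(1)[OF reg] by auto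
  then have "card {v \<in> balls T. length (T ! v) < h} \<le> card (\<Union>u\<in>?N. {w \<in> balls T. T ! w = u})"
    using finN by (intro card_mono) auto
  also have "\<dots> \<le> (\<Sum>u\<in>?N. card {w \<in> balls T. T ! w = u})"
    by (rule card_UN_le[OF finN])
  also have "\<dots> \<le> (\<Sum>u\<in>?N. s)"
    by (intro sum_mono card_node_le regular_treeD(2)[OF reg])
  also have "\<dots> \<le> s * b ^ h" using cN by simp
  finally show ?thesis .
qed

text \<open>At least half of the balls have depth \<open>h\<close> or more. For a tuple of such
  balls a ball at the root is a common ancestor, and (d choose m) is at least (d / m)^m. Dividing by
  \<open>k\<close> and not by \<open>k - 2\<close> keeps the formula meaningful for
  \<open>k = 2\<close>.\<close>

lemma Upsilon_ge:
  assumes reg: "regular_tree b s T" and b: "2 \<le> b" and r: "2 \<le> r" and k: "2 \<le> k" and h: "k \<le> h"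
    and n: "s * b ^ h * 2 \<le> length T"
  shows "(real (length T) / 2 * (real h / real k) ^ (k - 2)) ^ r \<le> Upsilon r k T"
proof -
  define B where "B = {v \<in> balls T. h \<le> length (T ! v)}"
  let ?V = "{1..r} \<rightarrow>\<^sub>E balls T" and ?W = "{1..r} \<rightarrow>\<^sub>E B"
  have cB: "real (length T) / 2 \<le> real (card B)"
  proof -
    have "balls T = B \<union> {v \<in> balls T. length (T ! v) < h}" by (auto simp: B_def)
    then have "length T \<le> card B + card {v \<in> balls T. length (T ! v) < h}"
      by (metis card_Un_le card_lessThan)
    also have "\<dots> \<le> card B + s * b ^ h"
      using card_shallow_le[OF reg b, of h] by simp
    finally show ?thesis using n by linarith
  qed
  have "real (length T) / 2 * (real h / real k) ^ (k - 2) \<le> real (card B) * (real h / real k) ^ (k - 2)"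
    by (intro mult_right_mono cB) simp
  then have "(real (length T) / 2 * (real h / real k) ^ (k - 2)) ^ r \<le> (real (card B) * (real h / real k) ^ (k - 2)) ^ r"
    by (intro power_mono) simp_all
  also have "\<dots> = (\<Sum>v\<in>?W. ((real h / real k) ^ (k - 2)) ^ r)"
    by (simp add: card_PiE power_mult_distrib)
  also have "\<dots> \<le> (\<Sum>v\<in>?W. real (card (ups_confs T k {1..r} v)))"
  proof (rule sum_mono)
    fix v assume v: "v \<in> ?W"
    have long: "h \<le> length (T ! v i)" "v i \<in> balls T" if "i \<in> {1..r}" for i
      using v that by (auto simp: B_def)
    have one: "1 \<in> {1..r}" using r by simp
    have "strict_prefix [] (T ! v 1)" using long[OF one] h k by (auto simp: strict_prefix_def)
    then have "internal T []" using long(2)[OF one] by (auto simp: internal_def)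
    then obtain u where u: "u \<in> balls T" "T ! u = []"
      using count_list_ball regular_treeD(3)[OF reg] by blast
    have "u \<in> common T {1..r} v"
    proof -
      have "ball_less T u (v i)" if "i \<in> {1..r}" for i
        using u long[OF that] h k by (auto simp: ball_less_def strict_prefix_def)
      then show ?thesis using u by (auto simp: common_def)
    qed
    moreover have "finite (common T {1..r} v)" by (simp add: common_def)
    ultimately have "1 \<le> card (common T {1..r} v)" by (rule card_ge_Suc0[rotated])
    then have c1: "1 \<le> real (card (common T {1..r} v))" by linarith
    have c2: "(real h / real k) ^ (k - 2) \<le> real (card (middles T k (v i)))" if i: "i \<in> {1..r}" for i
    proof -
      let ?d = "ball_depth T (v i)"
      have hd: "h \<le> ?d" using long[OF i] length_le_ball_depth[OF reg] order.trans by blast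
      show ?thesis
      proof (cases "k = 2")
        case True
        have "middles T k (v i) = {{}}"
          using True finite_subset[OF _ finite_ancestors] by (auto simp: middles_def)
        then show ?thesis using True by simp
      next
        case False
        then have k2: "0 < k - 2" using k by simp
        have "(real h / real k) ^ (k - 2) \<le> (real ?d / real (k - 2)) ^ (k - 2)"
          using hd k2 by (intro power_mono frac_le) auto
        also have "\<dots> \<le> real (?d choose (k - 2))"
          using binomial_ge_n_over_k_pow_k[of "k - 2" ?d, where 'a = real] h hd by simp
        also have "\<dots> = real (card (middles T k (v i)))"
          by (simp add: middles_def n_subsets[OF finite_ancestors] card_ancestors)
        finally show ?thesis .
      qed
    qed
    have "((real h / real k) ^ (k - 2)) ^ r = (\<Prod>i\<in>{1..r}. (real h / real k) ^ (k - 2))" by simp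
    also have "\<dots> \<le> (\<Prod>i\<in>{1..r}. real (card (middles T k (v i))))"
      using c2 by (intro prod_mono) auto
    also have "\<dots> \<le> real (card (common T {1..r} v)) * (\<Prod>i\<in>{1..r}. real (card (middles T k (v i))))"
      using mult_right_mono[OF c1, of "\<Prod>i\<in>{1..r}. real (card (middles T k (v i)))"]
      by (simp add: prod_nonneg)
    also have "\<dots> = real (card (ups_confs T k {1..r} v))"
      by (simp add: ups_confs_def card_cartesian_product card_PiE)
    finally show "((real h / real k) ^ (k - 2)) ^ r \<le> real (card (ups_confs T k {1..r} v))" .
  qed
  also have "\<dots> \<le> (\<Sum>v\<in>?V. real (card (ups_confs T k {1..r} v)))"
    by (intro sum_mono2 PiE_mono) (auto simp: B_def intro!: finite_PiE)
  also have "\<dots> = Upsilon r k T" by (rule Upsilon_eq_sum_confs[symmetric])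
  finally show ?thesis .
qed

text \<open>The prefixes of length \<open>j\<close> and \<open>j + 1\<close> are both internal.
  Below the longer one there are more than \<open>s\<close> balls, and the shorter one holds a
  further ball, so its excess is at least 2.\<close>

lemma excess_pairs_ge2:
  assumes reg: "regular_tree b s T" and w: "w \<in> set T" "j + 2 \<le> length w"
  shows "2 \<le> excess_pairs b s j T"
proof -
  let ?g = "take j w" and ?p = "take (Suc j) w"
  have sp: "strict_prefix (take i w) w" if "i < length w" for i
    using that by (simp add: strict_prefix_def take_is_prefix)
  have ig: "internal T ?g" and ip: "internal T ?p"
    using sp[of j] sp[of "Suc j"] w by (auto simp: internal_def)
  have gp: "strict_prefix ?g ?p"
  proof -
    have "?g = take j ?p" by simp
    moreover have "j < length ?p" using w by simp
    ultimately show ?thesis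
      by (metis length_take min.absorb4 nat_neq_iff strict_prefix_def take_is_prefix)
  qed
  obtain u where u: "u \<in> balls T" "T ! u = ?g"
    using count_list_ball regular_treeD(3)[OF reg ig] by blast
  have "insert u {v \<in> balls T. prefix ?p (T ! v)} \<subseteq> {v \<in> balls T. prefix ?g (T ! v)}"
    using u gp prefix_order.trans[of ?g ?p] by (auto simp: strict_prefix_def)
  then have "card (insert u {v \<in> balls T. prefix ?p (T ! v)}) \<le> subtree_size T ?g"
    unfolding subtree_size_eq_card by (intro card_mono) auto
  moreover have "u \<notin> {v \<in> balls T. prefix ?p (T ! v)}"
    using u gp by (auto simp: strict_prefix_def dest: prefix_order.antisym)
  ultimately have "Suc (subtree_size T ?p) \<le> subtree_size T ?g"
    by (simp add: subtree_size_eq_card)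
  then have e: "2 \<le> excess s T ?g"
    using regular_treeD(4)[OF reg ip] by (simp add: excess_def)
  then have "2 * 1 \<le> excess s T ?g * (excess s T ?g - 1)" by (intro mult_le_mono) auto
  then have "2 \<le> real (excess s T ?g * (excess s T ?g - 1))" by linarith
  also have "\<dots> \<le> excess_pairs b s j T"
    unfolding excess_pairs_def
  proof (rule member_le_sum)
    show "?g \<in> {g. set g \<subseteq> {..<b} \<and> length g = j}"
      using regular_treeD(1)[OF reg w(1)] w(2) set_take_subset[of j w] by auto
    show "finite {g. set g \<subseteq> {..<b} \<and> length g = j}" by (rule finite_lists_length_eq) simp
  qed simp
  finally show ?thesis .
qed

lemma excess_pairs_nonneg: "0 \<le> excess_pairs b s j T"
  by (simp add: excess_pairs_def sum_nonneg)

text \<open>A single term of the weighted sum is already this large, so a bound on the sum limits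
  the height.\<close>

lemma power_height_le:
  assumes reg: "regular_tree b s T" and w: "w \<in> set T" "j + 2 \<le> length w" and x: "1 \<le> x"
    and a: "weighted_excess b s x T \<le> a"
  shows "x ^ j \<le> a"
proof -
  obtain v where v: "v \<in> balls T" "T ! v = w" using w(1) by (auto simp: in_set_conv_nth)
  have "length w \<le> length T"
    using length_le_ball_depth[OF reg v(1)] ball_depth_less_length[OF v(1)] v(2) by simp
  then have j: "j \<in> {..length T}" using w(2) by simp
  have "x ^ j * 1 \<le> x ^ j * excess_pairs b s j T"
    using excess_pairs_ge2[OF reg w] x by (intro mult_left_mono) auto
  also have "\<dots> \<le> weighted_excess b s x T"
    unfolding weighted_excess_def using j x
    by (intro member_le_sum[of j]) (auto intro!: mult_nonneg_nonneg excess_pairs_nonneg)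
  finally show ?thesis using a by simp
qed

text \<open>The value is 0 or 1; the set in it turns sums over pairs of balls into sums over nodes
  of level \<open>j\<close>.\<close>

definition common_prefixes :: "split_tree \<Rightarrow> nat \<Rightarrow> nat \<Rightarrow> nat \<Rightarrow> nat" where
  "common_prefixes T j v w = card {u. length u = j \<and> prefix u (T ! v) \<and> prefix u (T ! w)}"

text \<open>If \<open>J\<close> is the deepest common level, the prefix count is
  \<open>J + 1\<close>, and the term for \<open>j = J\<close> already reaches its power.\<close>

lemma prefix_count_power_le:
  assumes H: "length (T ! v) \<le> H"
  shows "real (prefix_count T v w) ^ m
    \<le> (\<Sum>j\<le>H. real (j + 1) ^ m * real (common_prefixes T j v w))"
proof -
  let ?S = "{u. prefix u (T ! v) \<and> prefix u (T ! w)}"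
  have fin: "finite ?S" by (rule finite_subset[OF _ finite_prefixes[of "T ! v"]]) auto
  have ne: "?S \<noteq> {}" using Nil_prefix by blast
  define J where "J = Max (length ` ?S)"
  have "J \<in> length ` ?S" unfolding J_def using fin ne by (intro Max_in) auto
  then obtain u where u: "u \<in> ?S" "length u = J" by auto
  have inj: "inj_on length ?S"
  proof (rule inj_onI)
    fix p q assume "p \<in> ?S" "q \<in> ?S" "length p = length q"
    then show "p = q" by (auto simp: prefix_def append_eq_append_conv)
  qed
  have "prefix_count T v w = card (length ` ?S)"
    unfolding prefix_count_def using inj by (simp add: card_image)
  also have "\<dots> \<le> card {..J}"
    using fin unfolding J_def by (intro card_mono) auto
  finally have le: "real (prefix_count T v w) \<le> real (J + 1)" by simp
  have JH: "J \<in> {..H}" using u H prefix_length_le[of u "T ! v"] by auto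
  have "1 \<le> common_prefixes T J v w"
    using u unfolding common_prefixes_def by (intro card_ge_Suc0[of _ u] finite_subset[OF _ fin]) auto
  then have c: "1 \<le> real (common_prefixes T J v w)" by linarith
  have "real (prefix_count T v w) ^ m \<le> real (J + 1) ^ m * 1"
    using le by (simp add: power_mono)
  also have "\<dots> \<le> real (J + 1) ^ m * real (common_prefixes T J v w)"
    by (intro mult_left_mono c) simp
  also have "\<dots> \<le> (\<Sum>j\<le>H. real (j + 1) ^ m * real (common_prefixes T j v w))"
    using JH by (intro member_le_sum) auto
  finally show ?thesis .
qed

text \<open>If n exceeds 2 s + 2, then n - s - 1 is at least n / 2; otherwise the linear term is
  enough.\<close>

lemma square_le_excess: "(n::nat)\<^sup>2 \<le> (2 * s + 2) * n + 4 * ((n - s) * (n - s - 1))"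
proof (cases "n \<le> 2 * s + 2")
  case True
  then have "n * n \<le> (2 * s + 2) * n" by (rule mult_le_mono1)
  then show ?thesis unfolding power2_eq_square by (rule trans_le_add1)
next
  case False
  then have "n \<le> 2 * (n - s - 1)" "n \<le> 2 * (n - s)" by auto
  then have "n * n \<le> (2 * (n - s)) * (2 * (n - s - 1))" by (intro mult_le_mono)
  then show ?thesis by (simp add: power2_eq_square)
qed

text \<open>After exchanging sums, the pairs that agree down to level \<open>j\<close> are counted
  by the squared subtree sizes of that level. Subtrees of one level are disjoint, so the linear part
  of \<open>square_le_excess\<close> adds up to at most (2 s + 2) n.\<close>

lemma sum_card_common_prefixes:
  assumes reg: "regular_tree b s T"
  shows "(\<Sum>v\<in>balls T. \<Sum>w\<in>balls T. real (common_prefixes T j v w))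
    \<le> real ((2 * s + 2) * length T) + 4 * excess_pairs b s j T"
proof -
  let ?G = "{g. set g \<subseteq> {..<b} \<and> length g = j}"
  have fin: "finite ?G" by (rule finite_lists_length_eq) simp
  have setw: "set u \<subseteq> {..<b}" if "prefix u (T ! v)" "v \<in> balls T" for u v
    using that regular_treeD(1)[OF reg, of "T ! v"] set_mono_prefix[OF that(1)] by auto
  have "real (common_prefixes T j v w)
      = (\<Sum>u\<in>?G. of_bool (prefix u (T ! v)) * of_bool (prefix u (T ! w)))" if v: "v \<in> balls T" for v w
  proof -
    have "{u. length u = j \<and> prefix u (T ! v) \<and> prefix u (T ! w)} = {u \<in> ?G. prefix u (T ! v) \<and> prefix u (T ! w)}"
      using setw v by auto
    moreover have "(\<Sum>u\<in>?G. of_bool (prefix u (T ! v)) * of_bool (prefix u (T ! w)))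
      = (\<Sum>u\<in>?G. of_bool (prefix u (T ! v) \<and> prefix u (T ! w)) :: real)"
      by (intro sum.cong) auto
    moreover have "\<dots> = real (card {u \<in> ?G. prefix u (T ! v) \<and> prefix u (T ! w)})"
      using fin by (simp add: sum_of_bool_eq Int_def)
    ultimately show ?thesis by (simp add: common_prefixes_def)
  qed
  then have "(\<Sum>v\<in>balls T. \<Sum>w\<in>balls T. real (common_prefixes T j v w))
    = (\<Sum>v\<in>balls T. \<Sum>w\<in>balls T. \<Sum>u\<in>?G. of_bool (prefix u (T ! v)) * of_bool (prefix u (T ! w)))"
    by (intro sum.cong refl)
  also have "\<dots> = (\<Sum>v\<in>balls T. \<Sum>u\<in>?G. \<Sum>w\<in>balls T. of_bool (prefix u (T ! v)) * of_bool (prefix u (T ! w)))"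
    by (intro sum.cong refl sum.swap)
  also have "\<dots> = (\<Sum>u\<in>?G. \<Sum>v\<in>balls T. \<Sum>w\<in>balls T. of_bool (prefix u (T ! v)) * of_bool (prefix u (T ! w)))"
    by (rule sum.swap)
  also have "\<dots> = (\<Sum>u\<in>?G. (\<Sum>v\<in>balls T. of_bool (prefix u (T ! v))) * (\<Sum>w\<in>balls T. of_bool (prefix u (T ! w))))"
    by (simp only: sum_product)
  also have "\<dots> = (\<Sum>u\<in>?G. real ((subtree_size T u)\<^sup>2))"
    by (simp add: subtree_size_eq_card sum_of_bool_eq Int_def power2_eq_square)
  also have "\<dots> \<le> (\<Sum>u\<in>?G. real ((2 * s + 2) * subtree_size T u + 4 * (excess s T u * (excess s T u - 1))))"
    unfolding excess_def using square_le_excess by (intro sum_mono of_nat_mono)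
  also have "\<dots> = real ((2 * s + 2) * (\<Sum>u\<in>?G. subtree_size T u)) + 4 * excess_pairs b s j T"
    unfolding excess_pairs_def by (simp add: sum.distrib sum_distrib_left)
  finally have sum: "(\<Sum>v\<in>balls T. \<Sum>w\<in>balls T. real (common_prefixes T j v w))
    \<le> real ((2 * s + 2) * (\<Sum>u\<in>?G. subtree_size T u)) + 4 * excess_pairs b s j T" .
  have "(\<Sum>u\<in>?G. subtree_size T u) \<le> length T"
  proof -
    have "(\<Sum>u\<in>?G. subtree_size T u) = card (\<Union>u\<in>?G. {v \<in> balls T. prefix u (T ! v)})"
      unfolding subtree_size_eq_card
    proof (rule card_UN_disjoint[symmetric, OF fin])
      show "\<forall>i\<in>?G. \<forall>j\<in>?G. i \<noteq> j \<longrightarrow> {v \<in> balls T. prefix i (T ! v)} \<inter> {v \<in> balls T. prefix j (T ! v)} = {}"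
        by (auto simp: prefix_def append_eq_append_conv)
    qed simp
    also have "\<dots> \<le> card (balls T)" by (intro card_mono) auto
    finally show ?thesis by simp
  qed
  then have "real ((2 * s + 2) * (\<Sum>u\<in>?G. subtree_size T u)) \<le> real ((2 * s + 2) * length T)"
    by (intro of_nat_mono mult_le_mono2)
  with sum show ?thesis by linarith
qed

text \<open>\<open>C * x ^ j\<close> absorbs the polynomial weight and turns the excess part into
  \<open>weighted_excess\<close>. The linear part does not decay in \<open>j\<close> and costs a
  further factor \<open>H + 1\<close>, which is affordable because it comes with n and not
  n^2.\<close>

lemma prefix_moment_le:
  assumes reg: "regular_tree b s T" and H: "\<And>w. w \<in> set T \<Longrightarrow> length w \<le> H" "H \<le> length T"
    and x: "0 \<le> x" and C: "\<And>j. real (j + 1) ^ m \<le> C * x ^ j" "0 \<le> C"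
  shows "prefix_moment m T
    \<le> real (H + 1) ^ (m + 1) * real ((2 * s + 2) * length T) + 4 * C * weighted_excess b s x T"
proof -
  let ?n = "length T"
  have "prefix_moment m T \<le> (\<Sum>v\<in>balls T. \<Sum>w\<in>balls T. \<Sum>j\<le>H. real (j + 1) ^ m
      * real (common_prefixes T j v w))"
    unfolding prefix_moment_def by (intro sum_mono prefix_count_power_le H) simp
  also have "\<dots> = (\<Sum>v\<in>balls T. \<Sum>j\<le>H. \<Sum>w\<in>balls T. real (j + 1) ^ m
      * real (common_prefixes T j v w))"
    by (intro sum.cong refl sum.swap)
  also have "\<dots> = (\<Sum>j\<le>H. \<Sum>v\<in>balls T. \<Sum>w\<in>balls T. real (j + 1) ^ m
      * real (common_prefixes T j v w))"
    by (rule sum.swap)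
  also have "\<dots> = (\<Sum>j\<le>H. real (j + 1) ^ m * (\<Sum>v\<in>balls T. \<Sum>w\<in>balls T.
      real (common_prefixes T j v w)))"
    by (simp only: sum_distrib_left)
  also have "\<dots> \<le> (\<Sum>j\<le>H. real (j + 1) ^ m * (real ((2 * s + 2) * ?n) + 4 * excess_pairs b s j T))"
    by (intro sum_mono mult_left_mono sum_card_common_prefixes[OF reg]) simp
  also have "\<dots> \<le> (\<Sum>j\<le>H. real (H + 1) ^ m * real ((2 * s + 2) * ?n) + 4 * C * (x ^ j * excess_pairs b s j T))"
  proof (rule sum_mono)
    fix j assume j: "j \<in> {..H}"
    have "real (j + 1) ^ m * real ((2 * s + 2) * ?n) \<le> real (H + 1) ^ m * real ((2 * s + 2) * ?n)"
      using j by (intro mult_right_mono power_mono) auto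
    moreover have "real (j + 1) ^ m * (4 * excess_pairs b s j T) \<le> C * x ^ j * (4 * excess_pairs b s j T)"
      by (intro mult_right_mono C) (simp add: excess_pairs_nonneg)
    ultimately show "real (j + 1) ^ m * (real ((2 * s + 2) * ?n) + 4 * excess_pairs b s j T)
        \<le> real (H + 1) ^ m * real ((2 * s + 2) * ?n) + 4 * C * (x ^ j * excess_pairs b s j T)"
      by (simp add: algebra_simps)
  qed
  also have "\<dots> = real (H + 1) ^ (m + 1) * real ((2 * s + 2) * ?n) + 4 * C * (\<Sum>j\<le>H. x ^ j * excess_pairs b s j T)"
    by (simp add: sum.distrib sum_distrib_left)
  also have "\<dots> \<le> real (H + 1) ^ (m + 1) * real ((2 * s + 2) * ?n) + 4 * C * weighted_excess b s x T"
    unfolding weighted_excess_def using H(2) C(2) x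
    by (intro add_left_mono mult_left_mono sum_mono2) (auto intro!: mult_nonneg_nonneg excess_pairs_nonneg)
  finally show ?thesis .
qed

lemma prefix_pairs_le:
  assumes s: "\<And>u. count_list T u \<le> s" and \<Delta>: "\<And>v. v \<in> balls T \<Longrightarrow> real (ball_depth T v) \<le> \<Delta>"
  shows "prefix_pairs T \<le> real (length T) * (\<Delta> + real s)"
proof -
  have "prefix_pairs T = (\<Sum>w\<in>balls T. \<Sum>v\<in>balls T. of_bool (prefix (T ! v) (T ! w)))"
    unfolding prefix_pairs_def by (rule sum.swap)
  also have "\<dots> \<le> (\<Sum>w\<in>balls T. \<Delta> + real s)"
  proof (rule sum_mono)
    fix w assume w: "w \<in> balls T"
    have "(\<Sum>v\<in>balls T. of_bool (prefix (T ! v) (T ! w)) :: real) = real (card {v \<in> balls T. prefix (T ! v) (T ! w)})"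
      by (simp add: sum_of_bool_eq Int_def)
    also have "card {v \<in> balls T. prefix (T ! v) (T ! w)} \<le> card (ancestors T w \<union> {v \<in> balls T. T ! v = T ! w})"
      by (intro card_mono finite_UnI finite_ancestors) (auto simp: ancestors_def ball_less_def strict_prefix_def)
    also have "\<dots> \<le> card (ancestors T w) + card {v \<in> balls T. T ! v = T ! w}" by (rule card_Un_le)
    also have "\<dots> \<le> ball_depth T w + s"
      using card_node_le[OF s] by (simp add: card_ancestors)
    finally show "(\<Sum>v\<in>balls T. of_bool (prefix (T ! v) (T ! w)) :: real) \<le> \<Delta> + real s"
      using \<Delta>[OF w] by simp
  qed
  finally show ?thesis by simp
qed


subsection \<open>The error relative to Upsilon\<close>

text \<open>Bernoulli's inequality for the m-th root \<open>z\<close> of \<open>x\<close>: with c =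
  min 1 (z - 1), c (j + 1) is at most 1 + j (z - 1), hence at most z^j.\<close>

lemma power_le_exponential:
  assumes x: "1 < x" and m: "1 \<le> m"
  shows "\<exists>C\<ge>0. \<forall>j. real (j + 1) ^ m \<le> C * x ^ j"
proof -
  define z where "z = root m x"
  have z: "1 < z" "z ^ m = x" using x m by (auto simp: z_def)
  define c where "c = min 1 (z - 1)"
  have c: "0 < c" "c \<le> 1" "c \<le> z - 1" using z by (auto simp: c_def)
  have "real (j + 1) ^ m \<le> (1 / c) ^ m * x ^ j" for j
  proof -
    have "real j * c \<le> real j * (z - 1)" using c(3) by (rule mult_left_mono) simp
    then have "c * real (j + 1) \<le> 1 + real j * (z - 1)"
      using c by (simp add: algebra_simps)
    also have "\<dots> \<le> (1 + (z - 1)) ^ j" using z by (intro Bernoulli_inequality) simp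
    finally have "real (j + 1) \<le> z ^ j / c" using c by (simp add: field_simps)
    then have "real (j + 1) ^ m \<le> (z ^ j / c) ^ m" by (intro power_mono) auto
    also have "\<dots> = (1 / c) ^ m * x ^ j"
      unfolding z(2)[symmetric] by (simp add: power_divide mult.commute flip: power_mult)
    finally show ?thesis .
  qed
  then show ?thesis using c by (intro exI[of _ "(1 / c) ^ m"]) auto
qed

text \<open>\<open>h\<close> is half of log_b n, rounded down, so that b^h is at most sqrt n, as is
  2 s. The bound \<open>b ^ (4 * k) \<le> n\<close> makes log_b n at least 4 k, which leaves room
  for the rounding: \<open>h\<close> is at least a quarter of the logarithm and at least
  \<open>k\<close>.\<close>

lemma exists_level:
  fixes b s k n :: nat
  assumes b: "2 \<le> b" and k: "2 \<le> k" and n: "4 * s\<^sup>2 \<le> n" "b ^ (4 * k) \<le> n"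
  shows "1 \<le> ln (real n)"
    and "\<exists>h. k \<le> h \<and> s * b ^ h * 2 \<le> n \<and> 1 / (4 * real k * ln (real b)) * ln (real n) \<le> real h / real k"
proof -
  have lnb: "2 / 3 \<le> ln (real b)"
  proof -
    have "ln 2 \<le> ln (real b)" using b by simp
    then show ?thesis using ln2_ge_two_thirds by linarith
  qed
  have n0: "0 < n" using n(2) b by (metis gr0I le_zero_eq not_numeral_le_zero power_eq_0_iff)
  have "real b ^ (4 * k) \<le> real n" using n(2) by (metis of_nat_le_iff of_nat_power)
  then have "ln (real b ^ (4 * k)) \<le> ln (real n)" using b n0 by simp
  then have lnn: "real (4 * k) * ln (real b) \<le> ln (real n)" using b by (simp add: ln_realpow)
  moreover have "8 * (2 / 3) \<le> real (4 * k) * ln (real b)" using k lnb by (intro mult_mono) auto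
  ultimately show "1 \<le> ln (real n)" by linarith
  define l where "l = log (real b) (real n)"
  have l: "4 * real k \<le> l" using lnn lnb by (simp add: l_def log_def field_simps)
  define h where "h = nat \<lfloor>l / 2\<rfloor>"
  have hl: "real h \<le> l / 2" "l / 4 \<le> real h"
  proof -
    have "0 \<le> l / 2" using l by simp
    then have h: "real h = of_int \<lfloor>l / 2\<rfloor>" unfolding h_def by simp
    then show "real h \<le> l / 2" using of_int_floor_le[of "l / 2"] by simp
    have "l / 2 - 1 < real h" unfolding h by linarith
    then show "l / 4 \<le> real h" using l k by linarith
  qed
  have kh: "k \<le> h" using hl l by linarith
  have bh: "real b ^ h \<le> sqrt (real n)"
  proof -
    have "real b ^ h = real b powr real h" using b by (simp add: powr_realpow)
    also have "\<dots> \<le> real b powr (l / 2)" using b hl by (intro powr_mono) auto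
    also have "\<dots> = sqrt (real n)"
    proof -
      have "(real b powr (l / 2))\<^sup>2 = real b powr l"
        by (simp add: power2_eq_square flip: powr_add)
      also have "\<dots> = real n" using b n0 by (simp add: l_def)
      finally show ?thesis by (simp add: real_sqrt_unique)
    qed
    finally show ?thesis .
  qed
  have s2: "2 * real s \<le> sqrt (real n)"
  proof (rule real_le_rsqrt)
    have "real (4 * s\<^sup>2) \<le> real n" using n(1) by (rule of_nat_mono)
    then show "(2 * real s)\<^sup>2 \<le> real n" by (simp add: power_mult_distrib)
  qed
  have "2 * real s * real b ^ h \<le> sqrt (real n) * sqrt (real n)"
    using s2 bh by (intro mult_mono) auto
  then have "real (s * b ^ h * 2) \<le> real n" by (simp add: mult_ac)
  then have sb: "s * b ^ h * 2 \<le> n" by (simp only: of_nat_le_iff)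
  have "1 / (4 * real k * ln (real b)) * ln (real n) = l / 4 / real k"
    by (simp add: l_def log_def field_simps)
  also have "\<dots> \<le> real h / real k" using hl by (intro divide_right_mono) auto
  finally show "\<exists>h. k \<le> h \<and> s * b ^ h * 2 \<le> n \<and> 1 / (4 * real k * ln (real b)) * ln (real n) \<le> real h / real k"
    using kh sb by blast
qed

text \<open>For j = length w - 2 the weighted sum gives that x^j is at most n^2 sqrt(ln n), hence at
  most n^3. The summand 2 restores the shift, as ln n is at least 1.\<close>

lemma height_le:
  assumes reg: "regular_tree b s T" and n: "length T = n" "1 \<le> n" and x: "1 < x"
    and L: "1 \<le> ln (real n)"
    and a: "weighted_excess b s x T \<le> (real n)\<^sup>2 * sqrt (ln (real n))" and w: "w \<in> set T"
  shows "real (length w) \<le> (2 + 3 / ln x) * ln (real n)" "length w \<le> n"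
proof -
  let ?L = "ln (real n)"
  obtain v where v: "v \<in> balls T" "T ! v = w" using w(1) by (auto simp: in_set_conv_nth)
  show "length w \<le> n"
    using length_le_ball_depth[OF reg v(1)] ball_depth_less_length[OF v(1)] v(2) n by simp
  have lx: "0 < ln x" using x by simp
  show "real (length w) \<le> (2 + 3 / ln x) * ?L"
  proof (cases "2 \<le> length w")
    case True
    define j where "j = length w - 2"
    have j: "length w = j + 2" using True by (simp add: j_def)
    have "x ^ j \<le> (real n)\<^sup>2 * sqrt ?L"
      using power_height_le[OF reg w _ _ a, of j] j x by simp
    also have "sqrt ?L \<le> real n"
    proof (rule real_le_lsqrt)
      have "?L \<le> real n" using ln_le_minus_one[of "real n"] n by simp
      also have "\<dots> \<le> (real n)\<^sup>2" using n by (simp add: power2_eq_square)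
      finally show "?L \<le> (real n)\<^sup>2" .
    qed (use L in auto)
    finally have "x ^ j \<le> real n ^ 3" by (simp add: power2_eq_square power3_eq_cube mult_left_mono)
    then have "ln (x ^ j) \<le> ln (real n ^ 3)" using x n by simp
    then have "real j * ln x \<le> 3 * ?L" using x n by (simp add: ln_realpow)
    then have "real j \<le> 3 / ln x * ?L" using lx by (simp add: field_simps)
    then show ?thesis using j L by (simp add: algebra_simps)
  next
    case False
    then have "real (length w) \<le> 2 * 1" by simp
    also have "\<dots> \<le> (2 + 3 / ln x) * ?L" using lx L by (intro mult_mono) auto
    finally show ?thesis .
  qed
qed

text \<open>\<open>W\<close> has the order of \<open>Upsilon\<close>. Degenerate tuples contribute W
  times a multiple of L^(r+1) / n. In the other part the moment of order r + 1 is of order n^2 sqrt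
  L, up to the contribution of the linear terms, and is divided by \<open>\<Delta>\<close>, which is
  of order L; this leaves W / sqrt L.\<close>

lemma cumulant_relative_error:
  fixes b s k r :: nat and \<alpha> :: "nat list" and x :: real
  assumes b: "2 \<le> b" and s: "1 \<le> s" and k: "2 \<le> k" and r: "2 \<le> r" and x: "1 < x"
    and \<alpha>: "\<alpha> \<in> permutations_of_set {1..k}"
  shows "\<exists>K\<ge>0. \<exists>n\<^sub>0. \<forall>T. n\<^sub>0 \<le> length T \<longrightarrow> regular_tree b s T
    \<longrightarrow> weighted_excess b s x T \<le> (real (length T))\<^sup>2 * sqrt (ln (real (length T)))
    \<longrightarrow> \<bar>cumulant r (measure_pmf (pmf_of_set (labellings T))) (R \<alpha> T) - D_coeff k \<alpha> r * Upsilon r k T\<bar>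
      \<le> K * (ln (real (length T)) ^ (r + 1) / real (length T) + 1 / sqrt (ln (real (length T)))) * Upsilon r k T"
proof -
  \<comment> \<open>In units of ln n, \<open>c\<^sub>0\<close> bounds the height and
    \<open>c\<^sub>1\<close> the ball depth from above, and \<open>c\<^sub>2\<close> bounds
    \<open>h / k\<close> from below for the level \<open>h\<close> that most balls reach.\<close>
  define c\<^sub>0 where "c\<^sub>0 = 2 + 3 / ln x"
  define c\<^sub>1 where "c\<^sub>1 = real s * c\<^sub>0"
  define c\<^sub>2 where "c\<^sub>2 = 1 / (4 * real k * ln (real b))"
  obtain C where C: "0 \<le> C" "\<And>j. real (j + 1) ^ (r + 1) \<le> C * x ^ j"
    using power_le_exponential[OF x, of "r + 1"] by auto
  define A where "A = real r * (real s * real (r\<^sup>2)) ^ (r + 1) * real (r\<^sup>2)"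
  define B where "B = (2 * c\<^sub>0) ^ (r + 2) * real (2 * s + 2)"
  define K\<^sub>0 where "K\<^sub>0 = (\<Sum>\<tau> | partition_on {1..r} \<tau>. fact (card \<tau> - 1)) + 2 * \<bar>D_coeff k \<alpha> r\<bar>"
  define K\<^sub>1 where "K\<^sub>1 = 2 * real (r\<^sup>2) * c\<^sub>1 ^ (r + 1) + A * B + 4 * A * C"
  define C\<^sub>3 where "C\<^sub>3 = (2 * (c\<^sub>1 / c\<^sub>2) ^ (k - 2)) ^ r"
  have lx: "0 < ln x" using x by simp
  have c0: "2 \<le> c\<^sub>0" using lx by (simp add: c\<^sub>0_def)
  have c1: "2 \<le> c\<^sub>1" "real s \<le> c\<^sub>1"
    using mult_mono[of 1 "real s" 2 c\<^sub>0] mult_left_mono[of 1 c\<^sub>0 "real s"] c0 s by (auto simp: c\<^sub>1_def)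
  have c2: "0 < c\<^sub>2" using b k by (simp add: c\<^sub>2_def)
  have A0: "0 \<le> A" and B0: "0 \<le> B" and K0: "0 \<le> K\<^sub>0" and C3: "0 \<le> C\<^sub>3"
    using c0 c1 c2 by (auto simp: A_def B_def K\<^sub>0_def C\<^sub>3_def intro!: add_nonneg_nonneg sum_nonneg)
  have K1: "0 \<le> K\<^sub>1" using A0 B0 C(1) c1 by (auto simp: K\<^sub>1_def intro!: add_nonneg_nonneg)
  show ?thesis
  proof (intro exI[of _ "K\<^sub>0 * K\<^sub>1 * C\<^sub>3"] conjI exI[of _ "max (4 * s\<^sup>2) (b ^ (4 * k))"] allI impI)
    show "0 \<le> K\<^sub>0 * K\<^sub>1 * C\<^sub>3" using K0 K1 C3 by simp
    fix T assume big: "max (4 * s\<^sup>2) (b ^ (4 * k)) \<le> length T" and reg: "regular_tree b s T"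
      and we: "weighted_excess b s x T \<le> (real (length T))\<^sup>2 * sqrt (ln (real (length T)))"
    define n where "n = length T"
    define L where "L = ln (real n)"
    have nb: "4 * s\<^sup>2 \<le> n" "b ^ (4 * k) \<le> n" using big by (auto simp: n_def)
    have L1: "1 \<le> L" unfolding L_def by (rule exists_level(1)[OF b k nb])
    have n1: "1 \<le> n"
    proof (rule ccontr)
      assume "\<not> 1 \<le> n"
      then have "n = 0" by simp
      \<comment> \<open>By convention ln 0 = 0, against \<open>1 \<le> L\<close>.\<close>
      then show False using L1 by (simp add: L_def)
    qed
    note we' = we[folded n_def]
    obtain h where h: "k \<le> h" "s * b ^ h * 2 \<le> n" "c\<^sub>2 * L \<le> real h / real k"
      using exists_level(2)[OF b k nb] by (auto simp: c\<^sub>2_def L_def)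
    have sl: "count_list T u \<le> s" for u using regular_treeD(2)[OF reg] .
    define H where "H = Max (length ` set T)"
    have neT: "set T \<noteq> {}" using n1 by (auto simp: n_def)
    have Hle: "length w \<le> H" if "w \<in> set T" for w
      unfolding H_def using that by (intro Max_ge) auto
    have "H \<in> length ` set T" unfolding H_def using neT by (intro Max_in) auto
    then obtain w where w: "w \<in> set T" "length w = H" by auto
    have H: "real H \<le> c\<^sub>0 * L" "H \<le> n"
      using height_le[OF reg n_def[symmetric] n1 x _ we' w(1)] L1 w(2) by (auto simp: L_def c\<^sub>0_def)
    define \<Delta> where "\<Delta> = c\<^sub>1 * L"
    have \<Delta>: "real (ball_depth T v) \<le> \<Delta>" if v: "v \<in> balls T" for v
    proof -
      have "ball_depth T v \<le> s * length (T ! v)" by (rule ball_depth_le[OF sl])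
      also have "\<dots> \<le> s * H" using v Hle by (intro mult_left_mono) auto
      finally have "real (ball_depth T v) \<le> real s * real H" by (metis of_nat_le_iff of_nat_mult)
      also have "\<dots> \<le> real s * (c\<^sub>0 * L)" by (intro mult_left_mono H) simp
      finally show ?thesis by (simp add: \<Delta>_def c\<^sub>1_def)
    qed
    have cL: "c\<^sub>1 \<le> \<Delta>" "L \<le> \<Delta>"
      using mult_left_mono[OF L1, of c\<^sub>1] mult_right_mono[of 1 c\<^sub>1 L] c1 L1 by (auto simp: \<Delta>_def)
    have \<Delta>1: "1 \<le> \<Delta>" "real s \<le> \<Delta>" using cL c1 by auto
    define Y where "Y = \<Delta> ^ (k - 2)"
    have Y0: "0 \<le> Y" using \<Delta>1 by (simp add: Y_def)
    define W where "W = (real n * Y) ^ r"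
    have W0: "0 \<le> W" using Y0 by (simp add: W_def)
    have nr: "real n ^ r = real n ^ (r - 2) * (real n)\<^sup>2"
      using r by (metis le_add_diff_inverse2 power_add)
    define E where "E = (\<Sum>v\<in>{1..r} \<rightarrow>\<^sub>E balls T. err T s k \<Delta> {1..r} v)"
    define Q where "Q = prefix_moment (r + 1) T"
    have "E \<le> real (r\<^sup>2) * real n ^ (r - 2) * prefix_pairs T * (\<Delta> * Y) ^ r
        + A * real n ^ (r - 2) * Q * Y ^ r / \<Delta>"
      using sum_err_le[of "{1..r}" \<Delta> T s k] r \<Delta>1 unfolding E_def Y_def Q_def A_def n_def by simp
    also have "real (r\<^sup>2) * real n ^ (r - 2) * prefix_pairs T * (\<Delta> * Y) ^ r
        \<le> real (r\<^sup>2) * real n ^ (r - 2) * (real n * (2 * \<Delta>)) * (\<Delta> * Y) ^ r"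
    proof -
      have "prefix_pairs T \<le> real n * (\<Delta> + real s)" unfolding n_def by (rule prefix_pairs_le[OF sl \<Delta>])
      also have "\<dots> \<le> real n * (2 * \<Delta>)" using \<Delta>1 by (intro mult_left_mono) auto
      finally show ?thesis using \<Delta>1 Y0 by (intro mult_right_mono mult_left_mono) auto
    qed
    also have "real (r\<^sup>2) * real n ^ (r - 2) * (real n * (2 * \<Delta>)) * (\<Delta> * Y) ^ r
        = W * (2 * real (r\<^sup>2) * c\<^sub>1 ^ (r + 1) * (L ^ (r + 1) / real n))"
      using n1 unfolding W_def power_mult_distrib[of "real n"] nr \<Delta>_def
      by (simp add: power_mult_distrib power2_eq_square field_simps)
    also have "A * real n ^ (r - 2) * Q * Y ^ r / \<Delta> \<le> W * (A * B * (L ^ (r + 1) / real n) + 4 * A * C * (1 / sqrt L))"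
    proof -
      have "Q \<le> real (H + 1) ^ (r + 1 + 1) * real ((2 * s + 2) * n) + 4 * C * weighted_excess b s x T"
        unfolding Q_def n_def using Hle H(2) x C by (intro prefix_moment_le[OF reg]) (auto simp: n_def)
      also have "\<dots> \<le> (2 * c\<^sub>0 * L) ^ (r + 2) * real ((2 * s + 2) * n) + 4 * C * ((real n)\<^sup>2 * sqrt L)"
      proof (intro add_mono mult_right_mono mult_left_mono)
        have "1 * 1 \<le> c\<^sub>0 * L" using c0 L1 by (intro mult_mono) auto
        then have "real (H + 1) \<le> 2 * c\<^sub>0 * L" using H(1) by simp
        then show "real (H + 1) ^ (r + 1 + 1) \<le> (2 * c\<^sub>0 * L) ^ (r + 2)"
          using power_mono[of "real (H + 1)" "2 * c\<^sub>0 * L" "r + 2"] by simp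
        show "weighted_excess b s x T \<le> (real n)\<^sup>2 * sqrt L" using we' by (simp add: L_def)
      qed (use C in auto)
      also have "\<dots> = (real n)\<^sup>2 * (L * (B * (L ^ (r + 1) / real n) + 4 * C * (1 / sqrt L)))"
      proof -
        define S p q where "S = real (2 * s + 2)" and "p = L ^ (r + 1) / real n" and "q = 1 / sqrt L"
        have "real ((2 * s + 2) * n) = S * real n" unfolding S_def by (rule of_nat_mult)
        then have e: "(2 * c\<^sub>0 * L) ^ (r + 2) * real ((2 * s + 2) * n) = (real n)\<^sup>2 * (L * (B * p))"
          using n1 unfolding B_def S_def[symmetric] p_def by (simp add: power_mult_distrib power2_eq_square)
        have q: "sqrt L = L * q" using L1 by (simp add: q_def real_div_sqrt)
        show ?thesis
          unfolding p_def[symmetric] q_def[symmetric] unfolding e q by (simp add: algebra_simps)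
      qed
      finally have Q: "Q \<le> (real n)\<^sup>2 * (L * (B * (L ^ (r + 1) / real n) + 4 * C * (1 / sqrt L)))" .
      define M where "M = B * (L ^ (r + 1) / real n) + 4 * C * (1 / sqrt L)"
      have M0: "0 \<le> M" using B0 C(1) L1 by (auto simp: M_def)
      have "Q / \<Delta> \<le> (real n)\<^sup>2 * (L * M) / \<Delta>"
        using Q \<Delta>1 unfolding M_def by (intro divide_right_mono) auto
      also have "\<dots> \<le> (real n)\<^sup>2 * M"
      proof -
        have "L * M \<le> \<Delta> * M" using cL M0 by (intro mult_right_mono)
        then have "(real n)\<^sup>2 * (L * M) \<le> (real n)\<^sup>2 * (\<Delta> * M)" by (intro mult_left_mono) auto
        then show ?thesis using \<Delta>1 by (simp add: field_simps)
      qed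
      finally have "A * real n ^ (r - 2) * Y ^ r * (Q / \<Delta>) \<le> A * real n ^ (r - 2) * Y ^ r * ((real n)\<^sup>2 * M)"
        using A0 Y0 by (intro mult_left_mono) auto
      also have "\<dots> = W * (A * M)"
        unfolding W_def power_mult_distrib nr by (simp add: mult_ac)
      finally show ?thesis unfolding M_def by (simp add: algebra_simps)
    qed
    finally have "E \<le> W * (2 * real (r\<^sup>2) * c\<^sub>1 ^ (r + 1) * (L ^ (r + 1) / real n))
        + W * (A * B * (L ^ (r + 1) / real n) + 4 * A * C * (1 / sqrt L))" by simp
    also have "\<dots> \<le> W * (K\<^sub>1 * (L ^ (r + 1) / real n + 1 / sqrt L))"
    proof -
      define p q where "p = L ^ (r + 1) / real n" and "q = 1 / sqrt L"
      have pq: "0 \<le> p" "0 \<le> q" using L1 by (auto simp: p_def q_def)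
      \<comment> \<open>The added cross terms are nonnegative and let a single constant multiply
        \<open>p + q\<close>.\<close>
      have "2 * real (r\<^sup>2) * c\<^sub>1 ^ (r + 1) * p + (A * B * p + 4 * A * C * q)
        \<le> (2 * real (r\<^sup>2) * c\<^sub>1 ^ (r + 1) * p + (A * B * p + 4 * A * C * q))
          + (4 * A * C * p + (2 * real (r\<^sup>2) * c\<^sub>1 ^ (r + 1) + A * B) * q)"
        using pq A0 B0 C(1) c1 by (auto intro!: add_nonneg_nonneg mult_nonneg_nonneg)
      also have "\<dots> = K\<^sub>1 * (p + q)" unfolding K\<^sub>1_def by (simp add: algebra_simps)
      finally show ?thesis
        unfolding p_def[symmetric] q_def[symmetric] distrib_left[symmetric] using W0 by (intro mult_left_mono)
    qed
    finally have E: "E \<le> W * (K\<^sub>1 * (L ^ (r + 1) / real n + 1 / sqrt L))" .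
    have W: "W \<le> C\<^sub>3 * Upsilon r k T"
    proof -
      \<comment> \<open>The upper and the lower bound on depths differ by the constant factor in
        \<open>C\<^sub>3\<close> only.\<close>
      have "Y = (c\<^sub>1 / c\<^sub>2) ^ (k - 2) * (c\<^sub>2 * L) ^ (k - 2)"
        using c2 by (simp add: Y_def \<Delta>_def flip: power_mult_distrib)
      then have "real n * Y = (2 * (c\<^sub>1 / c\<^sub>2) ^ (k - 2)) * (real n / 2 * (c\<^sub>2 * L) ^ (k - 2))"
        by simp
      then have "W = C\<^sub>3 * (real n / 2 * (c\<^sub>2 * L) ^ (k - 2)) ^ r"
        by (simp only: W_def C\<^sub>3_def power_mult_distrib)
      also have "\<dots> \<le> C\<^sub>3 * (real n / 2 * (real h / real k) ^ (k - 2)) ^ r"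
        using h(3) c2 L1 C3 by (intro mult_left_mono power_mono) auto
      also have "\<dots> \<le> C\<^sub>3 * Upsilon r k T"
        using Upsilon_ge[OF reg b r k h(1)] h(2) C3 unfolding n_def by (intro mult_left_mono) auto
      finally show ?thesis .
    qed
    have "\<bar>cumulant r (measure_pmf (pmf_of_set (labellings T))) (R \<alpha> T) - D_coeff k \<alpha> r * Upsilon r k T\<bar> \<le> K\<^sub>0 * E"
      unfolding K\<^sub>0_def E_def by (rule cumulant_Upsilon_approx[OF \<alpha> k r s sl \<Delta>1(1) \<Delta>])
    also have "\<dots> \<le> K\<^sub>0 * (W * (K\<^sub>1 * (L ^ (r + 1) / real n + 1 / sqrt L)))"
      by (intro mult_left_mono E K0)
    also have "\<dots> \<le> K\<^sub>0 * (C\<^sub>3 * Upsilon r k T * (K\<^sub>1 * (L ^ (r + 1) / real n + 1 / sqrt L)))"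
      using L1 K1 K0 by (intro mult_left_mono mult_right_mono W) auto
    finally show "\<bar>cumulant r (measure_pmf (pmf_of_set (labellings T))) (R \<alpha> T) - D_coeff k \<alpha> r * Upsilon r k T\<bar>
      \<le> K\<^sub>0 * K\<^sub>1 * C\<^sub>3 * (ln (real (length T)) ^ (r + 1) / real (length T) + 1 / sqrt (ln (real (length T)))) * Upsilon r k T"
      by (simp add: mult_ac L_def n_def)
  qed
qed

text \<open>The sequence is eventually the power m + 1 of ln n / n^(1/(m+1)).\<close>

lemma tendsto_ln_power_over_n: "(\<lambda>n. ln (real n) ^ (m + 1) / real n) \<longlonglongrightarrow> 0"
proof -
  have "(\<lambda>n. (ln (real n) / real n powr (1 / real (m + 1))) ^ (m + 1)) \<longlonglongrightarrow> 0 ^ (m + 1)"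
    by (intro tendsto_power lim_ln_over_power) simp
  moreover have "eventually (\<lambda>n. (ln (real n) / real n powr (1 / real (m + 1))) ^ (m + 1) = ln (real n) ^ (m + 1) / real n) sequentially"
    using eventually_gt_at_top[of 0]
  proof eventually_elim
    case (elim n)
    have "(real n powr (1 / real (m + 1))) ^ (m + 1) = (real n powr (1 / real (m + 1))) powr real (m + 1)"
      using elim by (subst powr_realpow) auto
    also have "\<dots> = real n" using elim by (simp add: powr_powr)
    finally show ?case by (simp only: power_divide)
  qed
  ultimately show ?thesis by (simp add: filterlim_cong)
qed

lemma tendsto_inverse_sqrt_ln: "(\<lambda>n. 1 / sqrt (ln (real n))) \<longlonglongrightarrow> 0"
proof -
  have "filterlim (\<lambda>n. ln (real n)) at_top sequentially"
    by (rule filterlim_compose[OF ln_at_top filterlim_real_sequentially])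
  then have "filterlim (\<lambda>n. sqrt (ln (real n))) at_top sequentially"
    by (rule filterlim_compose[OF sqrt_at_top])
  then show ?thesis
    using tendsto_inverse_0_at_top by (simp add: inverse_eq_divide)
qed

theorem theorem1p6:
  fixes b s s\<^sub>0 s\<^sub>1 k r :: nat
    and \<nu> :: "(nat \<Rightarrow> real) measure"
    and \<alpha> :: "nat list"
  assumes "2 \<le> b" and "0 < s" and "s\<^sub>0 \<le> s" and "b * s\<^sub>1 \<le> s + 1 - s\<^sub>0" and "1 \<le> s\<^sub>0"
    and "prob_space \<nu>" and "sets \<nu> = sets (PiM {..<b} (\<lambda>_. borel))"
    and "AE v in \<nu>. (\<forall>i<b. 0 \<le> v i) \<and> (\<Sum>i<b. v i) = 1"
    and "\<And>i j. i < b \<Longrightarrow> j < b \<Longrightarrow> distr \<nu> borel (\<lambda>v. v i) = distr \<nu> borel (\<lambda>v. v j)"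
    and "\<P>(v in \<nu>. \<exists>i<b. v i = 1) < 1"
    and "2 \<le> k" and "\<alpha> \<in> permutations_of_set {1..k}" and "2 \<le> r"
  shows "\<exists>\<epsilon> :: nat \<Rightarrow> real. \<epsilon> \<longlonglongrightarrow> 0 \<and>
    (\<lambda>n. \<P>(T in random_split_tree b s s\<^sub>0 s\<^sub>1 \<nu> n.
        \<bar>cumulant r (measure_pmf (pmf_of_set (labellings T))) (R \<alpha> T)
           - D_coeff k \<alpha> r * Upsilon r k T\<bar> \<le> \<epsilon> n * Upsilon r k T)) \<longlonglongrightarrow> 1"
proof -
  have b1: "1 \<le> b" and s1: "1 \<le> s" using assms(1,2) by auto
  note ms = mean_square[OF assms(6-10) b1]
  define q where "q = mean_square \<nu> b"
  have q: "0 \<le> q" "q < 1" using ms(1,2) by (auto simp: q_def)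
  \<comment> \<open>A number above 1 whose product with q stays below 1, chosen so as to make sense
    for \<open>q = 0\<close>.\<close>
  define x where "x = 2 / (1 + q)"
  have x: "1 < x" "x * q < 1" using q by (auto simp: x_def field_simps)
  obtain K n\<^sub>0 where K: "\<And>T. n\<^sub>0 \<le> length T \<Longrightarrow> regular_tree b s T
      \<Longrightarrow> weighted_excess b s x T \<le> (real (length T))\<^sup>2 * sqrt (ln (real (length T)))
      \<Longrightarrow> \<bar>cumulant r (measure_pmf (pmf_of_set (labellings T))) (R \<alpha> T) - D_coeff k \<alpha> r * Upsilon r k T\<bar>
      \<le> K * (ln (real (length T)) ^ (r + 1) / real (length T) + 1 / sqrt (ln (real (length T)))) * Upsilon r k T"
    using cumulant_relative_error[OF assms(1) s1 assms(11,13) x(1) assms(12)] by blast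
  define \<epsilon> where "\<epsilon> n = K * (ln (real n) ^ (r + 1) / real n + 1 / sqrt (ln (real n)))" for n
  define p where "p n = \<P>(T in random_split_tree b s s\<^sub>0 s\<^sub>1 \<nu> n.
        \<bar>cumulant r (measure_pmf (pmf_of_set (labellings T))) (R \<alpha> T)
           - D_coeff k \<alpha> r * Upsilon r k T\<bar> \<le> \<epsilon> n * Upsilon r k T)" for n
  have "\<epsilon> \<longlonglongrightarrow> K * (0 + 0)"
    unfolding \<epsilon>_def by (intro tendsto_intros tendsto_ln_power_over_n tendsto_inverse_sqrt_ln)
  then have \<epsilon>: "\<epsilon> \<longlonglongrightarrow> 0" by simp
  have le1: "p n \<le> 1" for n
    unfolding p_def by (rule prob_space.prob_le_1[OF prob_space_random_split_tree(1)[OF assms(7,6)]])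
  \<comment> \<open>\<open>3 \<le> n\<close> makes ln n positive. The threshold n^2 sqrt(ln n) below
    is large enough for the failure probability to vanish and small enough for the relative error to
    do so.\<close>
  have ge: "1 - 1 / (1 - x * q) * (1 / sqrt (ln (real n))) \<le> p n" if n: "max n\<^sub>0 3 \<le> n" for n
  proof -
    define L where "L = ln (real n)"
    have "0 < L" using n by (simp add: L_def)
    then have a: "0 < (real n)\<^sup>2 * sqrt L" using n by simp
    have "1 - real (n * n) / ((1 - x * q) * ((real n)\<^sup>2 * sqrt L)) \<le> p n"
      unfolding p_def q_def
    proof (rule prob_random_split_tree_ge[OF assms(6-10) b1 assms(5,3,4)])
      fix T assume T: "regular_tree b s T" "length T = n" "weighted_excess b s x T \<le> (real n)\<^sup>2 * sqrt L"
      show "\<bar>cumulant r (measure_pmf (pmf_of_set (labellings T))) (R \<alpha> T)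
           - D_coeff k \<alpha> r * Upsilon r k T\<bar> \<le> \<epsilon> n * Upsilon r k T"
        using K[of T] T n by (simp add: \<epsilon>_def L_def)
    qed (use x a in \<open>auto simp: q_def\<close>)
    also have "real (n * n) / ((1 - x * q) * ((real n)\<^sup>2 * sqrt L)) = 1 / (1 - x * q) * (1 / sqrt L)"
      using n by (simp add: power2_eq_square)
    finally show ?thesis by (simp only: L_def)
  qed
  have "p \<longlonglongrightarrow> 1"
  proof (rule tendsto_sandwich)
    show "eventually (\<lambda>n. 1 - 1 / (1 - x * q) * (1 / sqrt (ln (real n))) \<le> p n) sequentially"
      unfolding eventually_sequentially using ge by blast
    show "eventually (\<lambda>n. p n \<le> 1) sequentially" using le1 by simp
    have "(\<lambda>n. 1 - 1 / (1 - x * q) * (1 / sqrt (ln (real n)))) \<longlonglongrightarrow> 1 - 1 / (1 - x * q) * 0"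
      by (intro tendsto_diff tendsto_const tendsto_mult tendsto_inverse_sqrt_ln)
    then show "(\<lambda>n. 1 - 1 / (1 - x * q) * (1 / sqrt (ln (real n)))) \<longlonglongrightarrow> 1" by simp
  qed simp
  then show ?thesis using \<epsilon> unfolding p_def by blast
qed

end
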